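(* Let $\mathcal{C}$ be a covering of the plane by complete folding curves, satisfying the local isomorphism property, which is generated by a (dragon) curve associated to the $\infty$-folding sequence $(a_k)_{k\in\mathbb{N}^*}$ with $a_{2^n}=+1$ for each $n\in\mathbb{N}$. Then $\mathcal{C}$ is locally isomorphic to two coverings by $3$ curves, one where each pair of curves has common vertices and one with two curves separated by the third one.
   Context: Curves and coverings. Identify $\mathbb{R}^2$ with $\mathbb{C}$ and $\mathbb{Z}^2$ with $\mathbb{Z}+i\mathbb{Z}$. To a sequence $(a_k)_{1\le k\le n-1}$, $(a_k)_{k\in\mathbb{N}^*}$ or $(a_k)_{k\in\mathbb{Z}}$ with all $a_k=\pm1$ are associated the curves $(C_k)_{1\le k\le n}$, $(C_k)_{k\in\mathbb{N}^*}$, $(C_k)_{k\in\mathbb{Z}}$ whose segments are oriented intervals $C_k=[x_k,x_k+\varepsilon_k]$ with $x_k\in\mathbb{Z}+i\mathbb{Z}$, $\varepsilon_k\in\{1,-1,i,-i\}$, and, whenever $C_k,C_{k+1}$ exist, $x_k+\varepsilon_k=x_{k+1}$ and $\varepsilon_{k+1}=i^{a_k}\varepsilon_k$. The vertices of a curve are the endpoints of its segments. Curves are rounded at the points $x_{k+1}$ so that they do not pass through them (so curves sharing no unit interval are disjoint, even if they have common vertices). Curves indexed by $\mathbb{Z}$ are called complete and are considered up to a shift of the index. A covering (of the plane) is a set of complete curves such that each nonoriented interval $[z,z+\varepsilon]$ with $z\in\mathbb{Z}+i\mathbb{Z}$, $\varepsilon\in\{1,i\}$ is the support of exactly one segment of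 exactly one of the curves. Orientation convention: for each $z=x+iy\in\mathbb{Z}+i\mathbb{Z}$, depending on the parity of $x+y$, the segments with endpoint $z$ are $[z,z+1],[z,z-1],[z+i,z],[z-i,z]$, or they are $[z+1,z],[z-1,z],[z,z+i],[z,z-i]$. Two curves of a covering are separated by a third one if they lie in different connected components of the complement of the third (rounded) curve in the plane. Folding sequences. For a finite sequence $S=(a_1,\dots,a_m)$ put $\overline{S}=(-a_m,\dots,-a_1)$. The $0$-folding sequence is empty, and the $(n+1)$-folding sequences are the sequences $(\overline{S},\varepsilon,S)$ with $S$ an $n$-folding sequence and $\varepsilon=\pm1$. An $\infty$-folding sequence is a sequence $S=(a_k)_{k\in\mathbb{N}^*}$ such that $(a_1,\dots,a_{2^n-1})$ is an $n$-folding sequence for every $n$; it is determined by the values $a_{2^n}$, $n\in\mathbb{N}$, which can be arbitrary. A complete folding sequence is a sequence $(a_k)_{k\in\mathbb{Z}}$ in $\{\pm1\}$ such that each finite block $(a_{k+1},\dots,a_{k+l})$ is a block of consecutive terms of an $n$-folding sequence for some $n$. $\infty$-folding curves and complete folding curves are the curves associated to such sequences. Local isomorphism. For sets of curves $\mathcal{B},\mathcal{C}$: $\mathcal{B}\cong\mathcal{C}$ means that $\mathcal{C}$ is the image of $\mathcal{B}$ under a translation; $\mathcal{B}<\mathcal{C}$ means that $\mathcal{B}\ne\mathcal{C}$, each curve of $\mathcal{B}$ is contained in (is a subcurve of) a curve of $\mathcal{C}$, and any consecutive segments of a curve of $\mathcal{C}$ which belong to curves of $\mathcal{B}$ are consecutive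 in one of them. A covering $\mathcal{C}$ satisfies the local isomorphism property if for each bounded set of curves (finitely many segments) $\mathcal{B}<\mathcal{C}$ there is $r>0$ such that every disc of radius $r$ contains some $\mathcal{B}'<\mathcal{C}$ with $\mathcal{B}'\cong\mathcal{B}$. Coverings $\mathcal{C},\mathcal{D}$ are locally isomorphic if for each bounded $\mathcal{B}<\mathcal{C}$ there is $\mathcal{B}'<\mathcal{D}$ with $\mathcal{B}'\cong\mathcal{B}$, and conversely with $\mathcal{C}$ and $\mathcal{D}$ exchanged. Generation. A covering $\mathcal{C}$ by complete folding curves which satisfies the local isomorphism property is generated by an $\infty$-folding curve $D$ with initial point $x$ if, up to reversal of orientation, the four curves obtained from $D$ by the rotations of angles $0,\pi/2,\pi,3\pi/2$ around $x$ are subcurves of curves of $\mathcal{C}$ (they are then connected at $x$ into two complete curves of $\mathcal{C}$). *)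

theory Defs
  imports "HOL-Analysis.Analysis" "HOL-Library.Sublist"
begin

subsection \<open>Segments and curves\<close>

definition lattice :: "complex set" where
  "lattice = {z. Re z \<in> \<int> \<and> Im z \<in> \<int>}"

text \<open>The pair \<open>(x, e)\<close> stands for the oriented interval \<open>[x, x + e]\<close>.\<close>

type_synonym segment = "complex \<times> complex"

definition is_segment :: "segment \<Rightarrow> bool" where
  "is_segment s \<longleftrightarrow> fst s \<in> lattice \<and> snd s \<in> {1, -1, \<i>, -\<i>}"

definition seg_end :: "segment \<Rightarrow> complex" where
  "seg_end s = fst s + snd s"

definition seg_supp :: "segment \<Rightarrow> complex set" where
  "seg_supp s = closed_segment (fst s) (seg_end s)"

definition rev_seg :: "segment \<Rightarrow> segment" where
  "rev_seg s = (seg_end s, - snd s)"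

definition translate :: "complex \<Rightarrow> segment \<Rightarrow> segment" where
  "translate v s = (fst s + v, snd s)"

text \<open>Rotation around \<open>x\<close> of angle \<open>q\<pi>/2\<close>.\<close>

definition rotate_seg :: "complex \<Rightarrow> nat \<Rightarrow> segment \<Rightarrow> segment" where
  "rotate_seg x q s = (x + \<i> ^ q * (fst s - x), \<i> ^ q * snd s)"

text \<open>\<open>I\<close> is the set of indices of the segments: \<open>UNIV\<close> for complete curves, \<open>{1..}\<close>
  for curves indexed by the positive integers. Only the values of \<open>C\<close> on \<open>I\<close> matter.\<close>

definition curve_of :: "int set \<Rightarrow> (int \<Rightarrow> int) \<Rightarrow> (int \<Rightarrow> segment) \<Rightarrow> bool" where
  "curve_of I a C \<longleftrightarrow>
     (\<forall>k\<in>I. is_segment (C k)) \<and>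
     (\<forall>k. k \<in> I \<and> k + 1 \<in> I \<longrightarrow>
        a k \<in> {1, -1} \<and>
        seg_end (C k) = fst (C (k + 1)) \<and>
        snd (C (k + 1)) = \<i> powi a k * snd (C k))"

definition complete_curve :: "(int \<Rightarrow> segment) \<Rightarrow> bool" where
  "complete_curve C \<longleftrightarrow> (\<exists>a. curve_of UNIV a C)"

definition vertices :: "(int \<Rightarrow> segment) \<Rightarrow> complex set" where
  "vertices C = range (\<lambda>k. fst (C k)) \<union> range (\<lambda>k. seg_end (C k))"

definition shift_equiv :: "(int \<Rightarrow> segment) \<Rightarrow> (int \<Rightarrow> segment) \<Rightarrow> bool" where
  "shift_equiv C D \<longleftrightarrow> (\<exists>m. \<forall>k. D k = C (k + m))"


subsection \<open>Rounded curves\<close>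

text \<open>At each vertex the corner is replaced by a quarter of a circle of radius \<open>1/4\<close>, tangent to
  the two segments. \<open>rounded_corner s t\<close>, for consecutive segments \<open>s\<close> and \<open>t\<close>, is that
  quarter circle, with centre \<open>seg_end s + (snd t - snd s) / 4\<close>.\<close>

definition rounded_corner :: "segment \<Rightarrow> segment \<Rightarrow> complex set" where
  "rounded_corner s t =
     (\<lambda>\<theta>. seg_end s + (snd t - snd s) / 4
          + (of_real (cos \<theta>) * snd s - of_real (sin \<theta>) * snd t) / 4) ` {0..pi/2}"

definition rounded_curve :: "(int \<Rightarrow> segment) \<Rightarrow> complex set" where
  "rounded_curve C =
     (\<Union>k. closed_segment (fst (C k) + snd (C k) / 4) (fst (C k) + 3 * snd (C k) / 4)
          \<union> rounded_corner (C k) (C (k + 1)))"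

definition separated_by :: "(int \<Rightarrow> segment) \<Rightarrow> (int \<Rightarrow> segment) \<Rightarrow> (int \<Rightarrow> segment) \<Rightarrow> bool" where
  "separated_by A B E \<longleftrightarrow>
     (\<exists>U \<in> components (- rounded_curve E). \<exists>V \<in> components (- rounded_curve E).
        U \<noteq> V \<and> rounded_curve A \<subseteq> U \<and> rounded_curve B \<subseteq> V)"


subsection \<open>Coverings\<close>

definition segments_at :: "(int \<Rightarrow> segment) set \<Rightarrow> complex \<Rightarrow> segment set" where
  "segments_at \<C> z = {s. (\<exists>C\<in>\<C>. s \<in> range C) \<and> (fst s = z \<or> seg_end s = z)}"

definition horizontal_out :: "complex \<Rightarrow> segment set" where
  "horizontal_out z = {(z, 1), (z, -1), (z + \<i>, -\<i>), (z - \<i>, \<i>)}"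

definition vertical_out :: "complex \<Rightarrow> segment set" where
  "vertical_out z = {(z + 1, -1), (z - 1, 1), (z, \<i>), (z, -\<i>)}"

definition even_point :: "complex \<Rightarrow> bool" where
  "even_point z \<longleftrightarrow> even (\<lfloor>Re z\<rfloor> + \<lfloor>Im z\<rfloor>)"

definition well_oriented :: "(int \<Rightarrow> segment) set \<Rightarrow> bool" where
  "well_oriented \<C> \<longleftrightarrow>
     (\<exists>b. \<forall>z\<in>lattice. segments_at \<C> z =
            (if even_point z = b then horizontal_out z else vertical_out z))"

text \<open>A complete curve is a function up to a shift of its argument, and a covering is given by one
  function for each of its curves: since a shifted copy of \<open>C\<close> is another function with the same
  segments, the uniqueness below excludes two shift-equivalent members. Hence \<open>card \<C>\<close> is
  the number of curves. Equality of coverings is \<open>same_covering\<close>.\<close>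

definition covering :: "(int \<Rightarrow> segment) set \<Rightarrow> bool" where
  "covering \<C> \<longleftrightarrow>
     (\<forall>C\<in>\<C>. complete_curve C) \<and>
     (\<forall>z\<in>lattice. \<forall>e\<in>{1, \<i>}.
        \<exists>!p. fst p \<in> \<C> \<and> seg_supp (fst p (snd p)) = closed_segment z (z + e)) \<and>
     well_oriented \<C>"

definition same_covering :: "(int \<Rightarrow> segment) set \<Rightarrow> (int \<Rightarrow> segment) set \<Rightarrow> bool" where
  "same_covering \<C> \<D> \<longleftrightarrow>
     (\<forall>C\<in>\<C>. \<exists>D\<in>\<D>. shift_equiv C D) \<and> (\<forall>D\<in>\<D>. \<exists>C\<in>\<C>. shift_equiv C D)"


subsection \<open>Folding sequences\<close>

definition bar :: "int list \<Rightarrow> int list" where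
  "bar S = map uminus (rev S)"

inductive folding :: "nat \<Rightarrow> int list \<Rightarrow> bool" where
  "folding 0 []"
| "folding n S \<Longrightarrow> e \<in> {1, -1} \<Longrightarrow> folding (Suc n) (bar S @ [e] @ S)"

text \<open>The terms of an infinite folding sequence are \<open>a k\<close> for \<open>k \<ge> 1\<close>.\<close>

definition infty_folding :: "(int \<Rightarrow> int) \<Rightarrow> bool" where
  "infty_folding a \<longleftrightarrow> (\<forall>n. folding n (map a [1..2 ^ n - 1]))"

definition complete_folding :: "(int \<Rightarrow> int) \<Rightarrow> bool" where
  "complete_folding a \<longleftrightarrow>
     (\<forall>k. \<forall>l::nat. \<exists>n S. folding n S \<and> sublist (map a [k + 1..k + int l]) S)"

definition complete_folding_curve :: "(int \<Rightarrow> segment) \<Rightarrow> bool" where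
  "complete_folding_curve C \<longleftrightarrow> (\<exists>a. complete_folding a \<and> curve_of UNIV a C)"


subsection \<open>Local isomorphism\<close>

text \<open>A bounded set of curves is a finite set of nonempty finite lists of segments. It always
  differs from a covering, so this part of the definition of \<open><\<close> needs no clause.\<close>

definition finite_subcurve :: "segment list \<Rightarrow> (int \<Rightarrow> segment) \<Rightarrow> bool" where
  "finite_subcurve xs C \<longleftrightarrow>
     xs \<noteq> [] \<and> (\<exists>m. \<forall>j<length xs. xs ! j = C (m + int j))"

definition segments_of :: "segment list set \<Rightarrow> segment set" where
  "segments_of \<B> = (\<Union>xs\<in>\<B>. set xs)"

definition bounded_below :: "segment list set \<Rightarrow> (int \<Rightarrow> segment) set \<Rightarrow> bool" where
  "bounded_below \<B> \<C> \<longleftrightarrow>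
     finite \<B> \<and>
     (\<forall>xs\<in>\<B>. \<exists>C\<in>\<C>. finite_subcurve xs C) \<and>
     (\<forall>C\<in>\<C>. \<forall>k. C k \<in> segments_of \<B> \<and> C (k + 1) \<in> segments_of \<B> \<longrightarrow>
        (\<exists>xs\<in>\<B>. \<exists>j. Suc j < length xs \<and> xs ! j = C k \<and> xs ! Suc j = C (k + 1)))"

definition translate_set :: "complex \<Rightarrow> segment list set \<Rightarrow> segment list set" where
  "translate_set v \<B> = map (translate v) ` \<B>"

definition local_isomorphism_property :: "(int \<Rightarrow> segment) set \<Rightarrow> bool" where
  "local_isomorphism_property \<C> \<longleftrightarrow>
     (\<forall>\<B>. bounded_below \<B> \<C> \<longrightarrow>
        (\<exists>r>0. \<forall>c. \<exists>v. bounded_below (translate_set v \<B>) \<C> \<and>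
           (\<forall>s\<in>segments_of (translate_set v \<B>). seg_supp s \<subseteq> cball c r)))"

definition locally_isomorphic :: "(int \<Rightarrow> segment) set \<Rightarrow> (int \<Rightarrow> segment) set \<Rightarrow> bool" where
  "locally_isomorphic \<C> \<D> \<longleftrightarrow>
     (\<forall>\<B>. bounded_below \<B> \<C> \<longrightarrow> (\<exists>v. bounded_below (translate_set v \<B>) \<D>)) \<and>
     (\<forall>\<B>. bounded_below \<B> \<D> \<longrightarrow> (\<exists>v. bounded_below (translate_set v \<B>) \<C>))"


subsection \<open>Generation\<close>

text \<open>\<open>D\<close> is a curve indexed by the positive integers. Each of the four rotated copies may
  occur in a curve of the covering with either orientation.\<close>

definition half_subcurve :: "(int \<Rightarrow> segment) \<Rightarrow> (int \<Rightarrow> segment) \<Rightarrow> bool" where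
  "half_subcurve D C \<longleftrightarrow>
     (\<exists>m. \<forall>k\<ge>1. C (m + k) = D k) \<or> (\<exists>m. \<forall>k\<ge>1. C (m - k) = rev_seg (D k))"

definition generated_by :: "(int \<Rightarrow> segment) set \<Rightarrow> (int \<Rightarrow> segment) \<Rightarrow> bool" where
  "generated_by \<C> D \<longleftrightarrow>
     (\<forall>q<4. \<exists>C\<in>\<C>. half_subcurve (\<lambda>k. rotate_seg (fst (D 1)) q (D k)) C)"

end

theory Submission
  imports Defs
begin

text \<open>
  The two arcs of a covering at a vertex turn to the same side, so a covering is given by a sign
  at each lattice point. For the dragon curve centred at 0 the sign at \<open>(1 + \<i>)\<^sup>k w\<close>, \<open>w\<close> odd, only
  depends on \<open>w\<close> modulo 2, and the covering generated by the curve has these signs. Moving the centre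
  to a point \<open>p / q\<close>, \<open>q\<close> odd, which is not in the lattice gives the signs of \<open>q z - p\<close>; they
  are approximated by those of the dragon covering in the \<open>(1 + \<i>)\<close>-adic topology, whence the local
  isomorphism.

  Unfolding maps each edge to its parent, pairs of consecutive edges having the same parent. It halves
  distances along curves and contracts the plane towards the centre. Thus two edges belong to
  the same curve if and only if this holds for their distant ancestors, which lie in a finite set.
  For \<open>q = 1 - 2\<i>\<close> and \<open>q = 3\<close> a finite computation yields three curves. The parents of the sides of
  a unit square are sides of a square of the same orientation, or a single edge. This determines
  which curves can meet along a square: for \<open>q = 3\<close> one curve touches the two others on
  different sides, and colouring the complement accordingly shows that it separates them.
\<close>

subsection \<open>The turn function and the grid\<close>

text \<open>A covering centred at \<open>p / q\<close> is not shrunk but drawn with edges of length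
  \<open>q = m + n\<i>\<close> on the points \<open>q z - p\<close>; all coverings then share one
  sign function and one unfolding map. With \<open>m\<close> odd and \<open>n\<close> even,
  \<open>q\<close> is 1 modulo 2, so multiplication by \<open>q\<close> preserves all signs. Passing
  to parents divides by 1 + \<i> modulo \<open>q\<close> and thus permutes the cosets: for 1 - 2\<i>
  the class in use returns after two steps, for 3 after eight, since 1 + \<i> generates the nonzero
  elements of the field with nine elements. Each time, three periodic edges lie in the coset of
  \<open>-p\<close>: one for each curve.

  The given covering has an arbitrary sign at its centre, while the new ones have no vertex at
  theirs. A translation that matches a finite pattern must therefore bring a point of prescribed
  sign to the centre. The translations come from 16, which is exactly the eighth power of 1 + \<i>,
  without a unit factor that would flip signs, and which is 1 modulo 15; both values of
  \<open>q\<close> divide 15.\<close>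

type_synonym edge = "int \<times> int \<times> int"

text \<open>The recursive call divides by 1 + \<i>. The parameter \<open>s\<close> is the sign at 0,
  the only point divisible by all powers of 1 + \<i>.\<close>

function dturn :: "int \<Rightarrow> int \<Rightarrow> int \<Rightarrow> int" where
  "dturn s x y =
     (if x = 0 \<and> y = 0 then s
      else if odd (x + y) then (if odd x then 1 else -1)
      else dturn s ((x + y) div 2) ((y - x) div 2))"
  by auto
termination
\<comment> \<open>Division by 1 + \<i> halves the norm.\<close>
proof (relation "Wellfounded.measure (\<lambda>(s, x, y). nat (x\<^sup>2 + y\<^sup>2))", goal_cases)
  case 1
  then show ?case by simp
next
  case (2 s x y)
  then obtain k where k: "x + y = 2 * k" by (metis evenE)
  then have y: "y = 2 * k - x" by simp
  have "k\<^sup>2 + (k - x)\<^sup>2 < x\<^sup>2 + y\<^sup>2"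
  proof -
    have "x\<^sup>2 + y\<^sup>2 = 2 * (k\<^sup>2 + (k - x)\<^sup>2)" unfolding y by (simp add: power2_eq_square algebra_simps)
    moreover have "x\<^sup>2 + y\<^sup>2 > 0" using 2(1) by (simp add: sum_power2_gt_zero_iff)
    ultimately show ?thesis by simp
  qed
  moreover have "(x + y) div 2 = k" "(y - x) div 2 = k - x" using y by auto
  ultimately show ?case using 2(1) by (simp add: sum_power2_gt_zero_iff)
qed

declare dturn.simps [simp del]

lemma dturn_0 [simp]: "dturn s 0 0 = s"
  by (simp add: dturn.simps)

lemma dturn_odd: "odd (x + y) \<Longrightarrow> dturn s x y = (if odd x then 1 else -1)"
  by (subst dturn.simps) auto

lemma dturn_scale: "dturn s (x - y) (x + y) = dturn s x y"
proof (cases "x = 0 \<and> y = 0")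
  case False
  then have "\<not> (x - y = 0 \<and> x + y = 0)" by arith
  then show ?thesis
    by (subst dturn.simps) auto
qed auto

lemma dturn_even:
  assumes "even (x + y)"
  shows "dturn s x y = dturn s ((x + y) div 2) ((y - x) div 2)"
proof -
  obtain k where "x + y = 2 * k" using assms by (metis evenE)
  then have y: "y = 2 * k - x" by simp
  show ?thesis using dturn_scale [of s k "k - x"] by (simp add: y)
qed

lemma dturn_cases: "s \<in> {1, -1} \<Longrightarrow> dturn s x y \<in> {1, -1}"
proof (induction s x y rule: dturn.induct)
  case (1 s x y)
  then show ?case by (subst dturn.simps) auto
qed

text \<open>Multiplication by \<i> commutes with division by 1 + \<i> and exchanges the two odd
  classes modulo 2.\<close>

lemma dturn_rotate: "dturn (-s) (-y) x = - dturn s x y"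
proof (induction s x y rule: dturn.induct)
  case (1 s x y)
  show ?case
  proof (cases "x = 0 \<and> y = 0 \<or> odd (x + y)")
    case True
    then show ?thesis by (auto simp: dturn_odd)
  next
    case False
    then obtain k where "x + y = 2 * k" by (metis evenE)
    then have y: "y = 2 * k - x" by simp
    have "dturn (-s) (-y) x = dturn (-s) (-(k - x)) k"
      using dturn_scale [of "-s" "x - k" k] by (simp add: y)
    also have "\<dots> = - dturn s k (k - x)"
      using 1 [of] False by (simp add: y)
    also have "\<dots> = - dturn s x y"
      using dturn_scale [of s k "k - x"] by (simp add: y)
    finally show ?thesis .
  qed
qed

text \<open>Away from 0, the turn function is locally constant in the \<open>(1 + \<i>)\<close>-adic topology.\<close>

lemma dturn_approx:
  assumes "odd m" "even n" "(x, y) \<noteq> (0, 0)"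
  shows "\<exists>k. \<forall>t t'. dturn s (m * x - n * y + 2 ^ k * t) (n * x + m * y + 2 ^ k * t') = dturn s' x y"
  using assms(3)
proof (induction s x y rule: dturn.induct)
  case (1 s x y)
  show ?case
  proof (cases "odd (x + y)")
    case True
    have "dturn s (m * x - n * y + 2 ^ 1 * t) (n * x + m * y + 2 ^ 1 * t') = dturn s' x y" for t t'
      using assms(1,2) True by (subst (1 2) dturn_odd) auto
    then show ?thesis by blast
  next
    case False
    then obtain k where "x + y = 2 * k" by (metis evenE)
    then have y: "y = 2 * k - x" by simp
    obtain j where j: "\<forall>t t'. dturn s (m * k - n * (k - x) + 2 ^ j * t) (n * k + m * (k - x) + 2 ^ j * t') = dturn s' k (k - x)"
      using 1 False by (auto simp: y)
    \<comment> \<open>A multiple of \<open>2 ^ Suc j\<close> divided by 1 + \<i> is still a multiple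
      of \<open>2 ^ j\<close>: each division costs at most one factor 2.\<close>
    have "dturn s (m * x - n * y + 2 ^ Suc j * t) (n * x + m * y + 2 ^ Suc j * t') = dturn s' x y" for t t'
    proof -
      have "dturn s (m * x - n * y + 2 ^ Suc j * t) (n * x + m * y + 2 ^ Suc j * t')
          = dturn s (m * k - n * (k - x) + 2 ^ j * (t + t')) (n * k + m * (k - x) + 2 ^ j * (t' - t))"
        by (subst dturn_scale [symmetric]) (simp add: y algebra_simps)
      also have "\<dots> = dturn s' k (k - x)" using j by blast
      also have "\<dots> = dturn s' x y"
        using dturn_scale [of s' k "k - x"] by (simp add: y)
      finally show ?thesis .
    qed
    then show ?thesis by blast
  qed
qed

text \<open>2 is -\<i> times the square of 1 + \<i>; in 16, the fourth power of 2, the rotations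
  cancel.\<close>

lemma dturn_power16: "dturn s (16 ^ j * x) (16 ^ j * y) = dturn s x y"
proof (induction j)
  case (Suc j)
  have *: "dturn s (2 * a) (2 * b) = dturn s b (-a)" for a b
    using dturn_even [of "2 * a" "2 * b" s] dturn_scale [of s b "- a"] by (simp add: add.commute)
  have "dturn s (16 * a) (16 * b) = dturn s a b" for a b
    using * [of "8 * a" "8 * b"] * [of "4 * b" "- 4 * a"] * [of "- 2 * a" "- 2 * b"] * [of "-b" "a"] by simp
  from this [of "16 ^ j * x" "16 ^ j * y"] Suc show ?case by (simp add: mult.assoc)
qed simp

text \<open>An edge \<open>(x, y, c)\<close> starts at \<open>(x, y)\<close>; its direction is \<open>(c, 0)\<close> if \<open>x + y\<close> is even and
  \<open>(0, c)\<close> otherwise, and its length is multiplied by \<open>m + n\<i>\<close>.\<close>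

fun edge_end :: "int \<Rightarrow> int \<Rightarrow> edge \<Rightarrow> int \<times> int" where
  "edge_end m n (x, y, c) = (if even (x + y) then (x + m * c, y + n * c) else (x - n * c, y + m * c))"

text \<open>\<open>r = 1\<close> is a left turn and \<open>r = -1\<close> a right turn. Directions
  along \<open>q\<close> and \<open>\<i> q\<close> alternate; the minus sign is the square of
  \<i>.\<close>

fun turned :: "int \<Rightarrow> int \<Rightarrow> int \<Rightarrow> edge \<Rightarrow> edge" where
  "turned m n r (x, y, c) =
     (if even (x + y) then (x + m * c, y + n * c, r * c) else (x - n * c, y + m * c, - r * c))"

lemma turned_even: "even (x + y) \<Longrightarrow> turned m n r (x, y, c) = (x + m * c, y + n * c, r * c)"
  and turned_odd: "odd (x + y) \<Longrightarrow> turned m n r (x, y, c) = (x - n * c, y + m * c, - r * c)"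
  by simp_all

definition next_edge :: "int \<Rightarrow> int \<Rightarrow> (int \<Rightarrow> int \<Rightarrow> int) \<Rightarrow> edge \<Rightarrow> edge" where
  "next_edge m n \<tau> e = turned m n (case_prod \<tau> (edge_end m n e)) e"

text \<open>Two consecutive edges, the first with even start, are the fold of one edge scaled by 1 +
  \<i>. An edge with odd start is the second of them: \<open>d\<close> is the coefficient of the
  first, recovered from the sign of the odd point between them, and the start is moved back along it
  before dividing.\<close>

fun parent :: "int \<Rightarrow> int \<Rightarrow> edge \<Rightarrow> edge" where
  "parent m n (x, y, c) =
     (if even (x + y) then ((x + y) div 2, (y - x) div 2, if even y then c else - c)
      else let d = (if odd x then c else - c)
        in ((x - m * d + y - n * d) div 2, (y - n * d - x + m * d) div 2, c))"

definition even_edge :: "edge \<Rightarrow> bool" where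
  "even_edge e = even (fst e + fst (snd e))"

definition is_edge :: "edge \<Rightarrow> bool" where
  "is_edge e \<longleftrightarrow> snd (snd e) \<in> {1, -1}"

lemma is_edge_simp [simp]: "is_edge (x, y, c) \<longleftrightarrow> c = 1 \<or> c = -1"
  by (simp add: is_edge_def)

lemma is_edge_turned: "r \<in> {1, -1} \<Longrightarrow> is_edge e \<Longrightarrow> is_edge (turned m n r e)"
  by (cases e) auto

lemma is_edge_parent: "is_edge e \<Longrightarrow> is_edge (parent m n e)"
  by (cases e) (auto simp: Let_def)

definition signs :: "(int \<Rightarrow> int \<Rightarrow> int) \<Rightarrow> bool" where
  "signs \<tau> \<longleftrightarrow> (\<forall>x y. \<tau> x y \<in> {1, -1})"

lemma signs_cases: "signs \<tau> \<Longrightarrow> \<tau> x y = 1 \<or> \<tau> x y = -1"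
  by (auto simp: signs_def)

lemma signs_dturn: "s \<in> {1, -1} \<Longrightarrow> signs (dturn s)"
  unfolding signs_def using dturn_cases by blast

fun prev_edge :: "int \<Rightarrow> int \<Rightarrow> (int \<Rightarrow> int \<Rightarrow> int) \<Rightarrow> edge \<Rightarrow> edge" where
  "prev_edge m n \<tau> (x, y, c) =
     (let d = (if even (x + y) then - c else c) * \<tau> x y
      in if even (x + y) then (x + n * d, y - m * d, d) else (x - m * d, y - n * d, d))"

definition orbit :: "int \<Rightarrow> int \<Rightarrow> (int \<Rightarrow> int \<Rightarrow> int) \<Rightarrow> edge \<Rightarrow> int \<Rightarrow> edge" where
  "orbit m n \<tau> e k =
     (if k \<ge> 0 then (next_edge m n \<tau> ^^ nat k) e else (prev_edge m n \<tau> ^^ nat (- k)) e)"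

text \<open>The parities of \<open>m\<close> and \<open>n\<close> make every edge join points of
  different parity, which keeps the two directions alternating.\<close>

locale turn_grid =
  fixes m n :: int and \<tau> :: "int \<Rightarrow> int \<Rightarrow> int"
  assumes odd_m: "odd m" and even_n: "even n" and signs: "signs \<tau>"
begin

abbreviation "nxt \<equiv> next_edge m n \<tau>"
abbreviation "prv \<equiv> prev_edge m n \<tau>"
abbreviation "orb \<equiv> orbit m n \<tau>"

lemma is_edge_nxt: "is_edge e \<Longrightarrow> is_edge (nxt e)"
  unfolding next_edge_def using signs by (auto intro!: is_edge_turned simp: split_beta signs_def)

lemma is_edge_prv: "is_edge e \<Longrightarrow> is_edge (prv e)"
  using signs_cases [OF signs, of "fst e" "fst (snd e)"] by (cases e) (auto simp: Let_def)

lemma even_edge_nxt: "is_edge e \<Longrightarrow> even_edge (nxt e) \<longleftrightarrow> \<not> even_edge e"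
  using odd_m even_n by (cases e) (auto simp: next_edge_def even_edge_def)

lemma prv_nxt:
  assumes "is_edge e"
  shows "prv (nxt e) = e"
proof -
  obtain x y c where e: "e = (x, y, c)" by (cases e)
  have c: "c = 1 \<or> c = -1" using assms by (simp add: e)
  obtain u v where uv: "edge_end m n e = (u, v)" by (cases "edge_end m n e")
  have t: "\<tau> u v = 1 \<or> \<tau> u v = -1" by (rule signs_cases [OF signs])
  show ?thesis
  proof (cases "even (x + y)")
    case True
    then have "odd (u + v)" using uv c odd_m even_n by (auto simp: e)
    with True uv t show ?thesis by (auto simp: e next_edge_def Let_def)
  next
    case False
    then have "even (u + v)" using uv c odd_m even_n by (auto simp: e)
    with False uv t show ?thesis by (auto simp: e next_edge_def Let_def)
  qed
qed

lemma nxt_prv: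
  assumes "is_edge e"
  shows "nxt (prv e) = e"
proof -
  obtain x y c where e: "e = (x, y, c)" by (cases e)
  have c: "c = 1 \<or> c = -1" using assms by (simp add: e)
  have t: "\<tau> x y = 1 \<or> \<tau> x y = -1" by (rule signs_cases [OF signs])
  show ?thesis
  proof (cases "even (x + y)")
    case True
    define d where "d = - c * \<tau> x y"
    have d: "d = 1 \<or> d = -1" "- (\<tau> x y * d) = c" using c t by (auto simp: d_def)
    have "odd (x + n * d + (y - m * d))" using True d odd_m even_n by auto
    moreover have "prv e = (x + n * d, y - m * d, d)" using True by (simp add: e d_def Let_def)
    ultimately show ?thesis using d by (simp only: next_edge_def e) auto
  next
    case False
    define d where "d = c * \<tau> x y"
    have d: "d = 1 \<or> d = -1" "\<tau> x y * d = c" using c t by (auto simp: d_def)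
    have "even (x - m * d + (y - n * d))" using False d odd_m even_n by auto
    moreover have "prv e = (x - m * d, y - n * d, d)" using False by (simp add: e d_def Let_def)
    ultimately show ?thesis using d by (simp only: next_edge_def e) auto
  qed
qed

lemma nxt_inj: "is_edge e \<Longrightarrow> is_edge f \<Longrightarrow> nxt e = nxt f \<Longrightarrow> e = f"
  by (metis prv_nxt)

lemma is_edge_orb:
  assumes "is_edge e"
  shows "is_edge (orb e k)"
proof -
  have "is_edge ((nxt ^^ i) e)" "is_edge ((prv ^^ i) e)" for i
    using assms by (induction i) (auto intro: is_edge_nxt is_edge_prv)
  then show ?thesis by (simp add: orbit_def)
qed

lemma orb_0 [simp]: "orb e 0 = e"
  by (simp add: orbit_def)

lemma orb_Suc:
  assumes "is_edge e"
  shows "orb e (k + 1) = nxt (orb e k)"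
proof (cases "k \<ge> 0")
  case True
  then show ?thesis by (simp add: orbit_def nat_add_distrib)
next
  case False
  define j where "j = nat (- k - 1)"
  have k: "k = - int (Suc j)" using False by (simp add: j_def)
  have "orb e (k + 1) = (prv ^^ j) e" by (auto simp: k orbit_def)
  moreover have "orb e k = (prv ^^ Suc j) e"
    unfolding orbit_def k by (simp del: funpow.simps of_nat_Suc)
  then have "orb e k = prv ((prv ^^ j) e)" by simp
  moreover have "is_edge ((prv ^^ j) e)" using assms by (induction j) (auto intro: is_edge_prv)
  ultimately show ?thesis by (simp add: nxt_prv)
qed

text \<open>Backward steps are settled by the injectivity of \<open>nxt\<close>. Identities between
  orbits are later proved by exhibiting a sequence of edges with the right step.\<close>

lemma orb_unique:
  assumes "\<And>k. is_edge (h k)" "\<And>k. h (k + 1) = nxt (h k)"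
  shows "h k = orb (h 0) k"
proof (induction k rule: int_induct [where k = 0])
  case (step1 i)
  then show ?case using assms orb_Suc by metis
next
  case (step2 i)
  have "nxt (h (i - 1)) = nxt (orb (h 0) (i - 1))"
    using step2 assms(2) [of "i - 1"] orb_Suc [OF assms(1), of 0 "i - 1"] by simp
  then show ?case using nxt_inj assms(1) is_edge_orb by blast
qed auto

lemma orb_add:
  assumes "is_edge e"
  shows "orb e (j + k) = orb (orb e j) k"
  using orb_unique [of "\<lambda>k. orb e (j + k)" k] assms
  by (metis add.assoc add.right_neutral is_edge_orb orb_Suc)

lemma even_edge_orb:
  assumes "is_edge e"
  shows "even_edge (orb e k) \<longleftrightarrow> (even k \<longleftrightarrow> even_edge e)"
proof (induction k rule: int_induct [where k = 0])
  case (step1 i)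
  then show ?case using assms by (auto simp: orb_Suc even_edge_nxt is_edge_orb)
next
  case (step2 i)
  then show ?case using assms orb_Suc [OF assms, of "i - 1"]
    by (auto simp: even_edge_nxt is_edge_orb)
qed auto

end

section \<open>Unfolding: children and parents of edges\<close>

locale fold_grid = turn_grid m n "dturn s" for m n s :: int
begin

abbreviation "par \<equiv> parent m n"

text \<open>The two children of an edge start at \<open>(1 + \<i>)\<close> times its starting point, resp. at
  the point where they meet.\<close>

fun child0 :: "edge \<Rightarrow> edge" where
  "child0 (x, y, c) = (x - y, x + y, if even (x + y) then c else - c)"

fun child1 :: "edge \<Rightarrow> edge" where
  "child1 (x, y, c) = (let d = (if even (x + y) then c else - c) in (x - y + m * d, x + y + n * d, c))"

lemma even_edge_child0: "even_edge (child0 e)"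
  by (cases e) (simp add: even_edge_def)

lemma is_edge_child: "is_edge e \<Longrightarrow> is_edge (child0 e)" "is_edge e \<Longrightarrow> is_edge (child1 e)"
  by (cases e; auto simp: Let_def)+

lemma par_child0: "par (child0 e) = e"
proof -
  obtain x y c where e: "e = (x, y, c)" by (cases e)
  have "x - y + (x + y) = 2 * x" "x + y - (x - y) = 2 * y" by simp_all
  then show ?thesis
    unfolding e child0.simps parent.simps by (cases "even (x + y)") simp_all
qed

lemma par_child1:
  assumes "is_edge e"
  shows "par (child1 e) = e"
proof -
  obtain x y c where e: "e = (x, y, c)" by (cases e)
  define d where "d = (if even (x + y) then c else - c)"
  define X where "X = x - y + m * d"
  define Y where "Y = x + y + n * d"
  have c: "c = 1 \<or> c = -1" using assms by (simp add: e)
  have d: "d = 1 \<or> d = -1" using c by (auto simp: d_def)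
  have o: "odd (X + Y)" using d odd_m even_n by (auto simp: X_def Y_def)
  have "odd X \<longleftrightarrow> even (x + y)" using d odd_m by (auto simp: X_def)
  then have *: "(if odd X then c else - c) = d" by (simp add: d_def)
  have "par (X, Y, c) = ((X - m * d + Y - n * d) div 2, (Y - n * d - X + m * d) div 2, c)"
    unfolding parent.simps Let_def * using o by presburger
  also have "X - m * d + Y - n * d = 2 * x" by (simp add: X_def Y_def)
  also have "Y - n * d - X + m * d = 2 * y" by (simp add: X_def Y_def)
  finally show ?thesis by (simp add: e X_def Y_def d_def Let_def)
qed

lemma child0_par:
  assumes "even_edge e"
  shows "child0 (par e) = e"
proof -
  obtain x y c where e: "e = (x, y, c)" by (cases e)
  obtain k where "x + y = 2 * k" using assms by (metis e even_edge_def evenE fst_conv snd_conv)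
  then have y: "y = 2 * k - x" by simp
  show ?thesis by (simp add: e y)
qed

lemma child1_par:
  assumes "is_edge e" "\<not> even_edge e"
  shows "child1 (par e) = e"
proof -
  obtain x y c where e: "e = (x, y, c)" by (cases e)
  have c: "c = 1 \<or> c = -1" using assms by (simp add: e)
  have o: "odd (x + y)" using assms by (simp add: e even_edge_def)
  define d where "d = (if odd x then c else - c)"
  have d: "d = 1 \<or> d = -1" using c by (auto simp: d_def)
  have "even (x - m * d + y - n * d)" using o d odd_m even_n by auto
  then obtain X where X: "x - m * d + y - n * d = 2 * X" by (metis evenE)
  define Y where "Y = y - n * d - X"
  have Y: "y - n * d - x + m * d = 2 * Y" using X unfolding Y_def by algebra
  have x: "x = X - Y + m * d" "y = X + Y + n * d" using X Y by (auto simp: algebra_simps)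
  have "par e = ((x - m * d + y - n * d) div 2, (y - n * d - x + m * d) div 2, c)"
    unfolding e parent.simps Let_def d_def [symmetric] using o by presburger
  then have p: "par e = (X, Y, c)" unfolding X Y by simp
  have "odd x \<longleftrightarrow> even (X + Y)" using x(1) d odd_m by auto
  then have "(if even (X + Y) then c else - c) = d" by (simp add: d_def)
  then show ?thesis unfolding p using x by (simp add: e Let_def)
qed

text \<open>The children meet at an odd point, and its sign is the turn built into
  \<open>child1\<close>: left for an even parent, right for an odd one.\<close>

lemma nxt_child0:
  assumes "is_edge e"
  shows "nxt (child0 e) = child1 e"
proof -
  obtain x y c where e: "e = (x, y, c)" by (cases e)
  define d where "d = (if even (x + y) then c else - c)"
  have c: "c = 1 \<or> c = -1" using assms by (simp add: e)
  have d: "d = 1 \<or> d = -1" using c by (auto simp: d_def)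
  have o: "odd (x - y + m * d + (x + y + n * d))" using d odd_m even_n by auto
  have "odd (x - y + m * d) \<longleftrightarrow> even (x + y)" using d odd_m by auto
  then have t: "dturn s (x - y + m * d) (x + y + n * d) * d = c"
    by (subst dturn_odd [OF o]) (auto simp: d_def)
  have "even (x - y + (x + y))" by simp
  then show ?thesis using t
    unfolding e child0.simps child1.simps next_edge_def d_def [symmetric] edge_end.simps turned.simps
    by (simp add: Let_def del: even_add)
qed

lemma edge_end_child1:
  assumes "is_edge e" "edge_end m n e = (u, v)"
  shows "edge_end m n (child1 e) = (u - v, u + v)"
proof -
  obtain x y c where e: "e = (x, y, c)" by (cases e)
  define d where "d = (if even (x + y) then c else - c)"
  have c: "c = 1 \<or> c = -1" using assms by (simp add: e)
  have d: "d = 1 \<or> d = -1" using c by (auto simp: d_def)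
  have o: "odd (x - y + m * d + (x + y + n * d))" using d odd_m even_n by auto
  show ?thesis using o assms
    by (cases "even (x + y)") (auto simp: e Let_def d_def algebra_simps)
qed

text \<open>The second child ends at 1 + \<i> times the end of the parent, a point with the same
  sign.\<close>

lemma nxt_child1:
  assumes "is_edge e"
  shows "nxt (child1 e) = child0 (nxt e)"
proof -
  obtain x y c where e: "e = (x, y, c)" by (cases e)
  obtain u v where uv: "edge_end m n e = (u, v)" by (cases "edge_end m n e")
  define d where "d = (if even (x + y) then c else - c)"
  define r where "r = dturn s u v"
  have c: "c = 1 \<or> c = -1" using assms by (simp add: e)
  have d: "d = 1 \<or> d = -1" using c by (auto simp: d_def)
  have o: "odd (x - y + m * d + (x + y + n * d))" using d odd_m even_n by auto
  have n1: "nxt (child1 e) = turned m n r (child1 e)"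
    using edge_end_child1 [OF assms uv] by (simp add: next_edge_def dturn_scale r_def)
  have n2: "nxt e = turned m n r e"
    using uv by (simp add: next_edge_def r_def)
  show ?thesis unfolding n1 n2 using o c odd_m even_n
    by (cases "even (x + y)") (auto simp: e Let_def d_def algebra_simps)
qed

lemma par_nxt_even: "is_edge e \<Longrightarrow> even_edge e \<Longrightarrow> par (nxt e) = par e"
  by (metis child0_par is_edge_parent nxt_child0 par_child1)

lemma par_nxt_odd: "is_edge e \<Longrightarrow> \<not> even_edge e \<Longrightarrow> par (nxt e) = nxt (par e)"
  by (metis child1_par is_edge_parent nxt_child1 par_child0)

lemma par_orb_even:
  assumes "is_edge e" "even_edge e"
  shows "par (orb e (2 * k)) = orb (par e) k"
proof -
  have "par (orb e (2 * (k + 1))) = nxt (par (orb e (2 * k)))" for k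
  proof -
    have "orb e (2 * (k + 1)) = nxt (nxt (orb e (2 * k)))"
      using orb_Suc [OF assms(1), of "2 * k + 1"] orb_Suc [OF assms(1), of "2 * k"] by (simp add: algebra_simps)
    then show ?thesis using assms
      by (simp add: par_nxt_odd par_nxt_even is_edge_nxt even_edge_nxt is_edge_orb even_edge_orb)
  qed
  then show ?thesis
    using orb_unique [of "\<lambda>k. par (orb e (2 * k))" k] assms by (simp add: is_edge_parent is_edge_orb)
qed

text \<open>Two steps along a curve are one step of the parents. From a second child, the count
  starts at its sibling one step earlier, hence the rounding up.\<close>

lemma par_orb:
  assumes "is_edge e"
  shows "par (orb e k) = orb (par e) (if even_edge e then k div 2 else (k + 1) div 2)"
proof -
  have *: "par (orb e k) = orb (par e) (k div 2)" if e: "is_edge e" "even_edge e" for e k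
  proof (cases "even k")
    case True
    then show ?thesis using par_orb_even [OF e, of "k div 2"] by simp
  next
    case False
    then have k: "k = 2 * (k div 2) + 1" by presburger
    have "par (orb e (2 * (k div 2) + 1)) = par (orb e (2 * (k div 2)))"
      using e by (simp add: orb_Suc par_nxt_even is_edge_orb even_edge_orb)
    then show ?thesis using par_orb_even [OF e, of "k div 2"] k by simp
  qed
  show ?thesis
  proof (cases "even_edge e")
    case False
    define f where "f = orb e (-1)"
    have f: "is_edge f" "even_edge f" using assms False by (auto simp: f_def is_edge_orb even_edge_orb)
    have ef: "orb e k = orb f (k + 1)" for k
      unfolding f_def using orb_add [OF assms, of "-1" "k + 1"] by simp
    have "par f = par e" using ef [of 0] * [OF f, of 1] by simp
    then show ?thesis using False ef * [OF f] by simp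
  qed (use * assms in simp)
qed

text \<open>Parities alternate along a curve, so a period is even and half of it is a period for the
  parents: infinite descent.\<close>

lemma orb_no_cycle:
  assumes "is_edge e" "orb e k = e"
  shows "k = 0"
  using assms
proof (induction "nat \<bar>k\<bar>" arbitrary: e k rule: less_induct)
  case less
  have ev: "even k" using less(2,3) even_edge_orb [of e k] by auto
  then have "orb (par e) (k div 2) = par e"
    using par_orb [OF less(2), of k] less(3) by (auto split: if_splits)
  note cyc = this
  show ?case
  proof (rule ccontr)
    assume "k \<noteq> 0"
    with ev have "nat \<bar>k div 2\<bar> < nat \<bar>k\<bar>" by auto
    from less(1) [OF this is_edge_parent [OF less(2)] cyc] ev \<open>k \<noteq> 0\<close> show False by auto
  qed
qed

definition conn :: "edge \<Rightarrow> edge \<Rightarrow> bool" where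
  "conn e f \<longleftrightarrow> (\<exists>k. orb e k = f)"

lemma conn_refl: "conn e e"
  unfolding conn_def by (rule exI [of _ 0]) simp

lemma conn_trans: "is_edge e \<Longrightarrow> conn e f \<Longrightarrow> conn f g \<Longrightarrow> conn e g"
  unfolding conn_def using orb_add by metis

lemma conn_sym: "is_edge e \<Longrightarrow> conn e f \<Longrightarrow> conn f e"
  unfolding conn_def using orb_add [of e _ "- _"] by (metis add.right_inverse orb_0)

lemma conn_par_eq:
  assumes "is_edge e" "is_edge f" "par e = par f"
  shows "conn e f"
proof -
  have *: "conn e (child0 (par e))" if "is_edge e" for e
  proof (cases "even_edge e")
    case True
    then show ?thesis by (simp add: child0_par conn_refl)
  next
    case False
    have "nxt (child0 (par e)) = e" using False that by (simp add: nxt_child0 is_edge_parent child1_par)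
    then have "orb (child0 (par e)) 1 = e"
      using orb_Suc [of "child0 (par e)" 0] that by (simp add: is_edge_child is_edge_parent)
    then have "conn (child0 (par e)) e" unfolding conn_def by blast
    then show ?thesis using conn_sym that by (simp add: is_edge_child is_edge_parent)
  qed
  show ?thesis
    using conn_trans [OF assms(1) * [OF assms(1)]] conn_sym [OF assms(2) * [OF assms(2)]] assms(3) by simp
qed

text \<open>\<open>k\<close> steps between the parents lift to \<open>2 * k\<close> steps from a
  first child, and siblings are connected. Hence connection can be tested on distant
  ancestors.\<close>

lemma conn_par:
  assumes "is_edge e" "is_edge f" "conn (par e) (par f)"
  shows "conn e f"
proof -
  obtain k where k: "orb (par e) k = par f" using assms(3) by (auto simp: conn_def)
  define e0 where "e0 = child0 (par e)"
  have e0: "is_edge e0" "even_edge e0" "par e0 = par e"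
    using assms by (auto simp: e0_def is_edge_child is_edge_parent even_edge_child0 par_child0)
  have "par (orb e0 (2 * k)) = par f" using par_orb_even [OF e0(1,2)] e0(3) k by simp
  then have "conn (orb e0 (2 * k)) f" using conn_par_eq e0 assms is_edge_orb by blast
  moreover have "conn e0 (orb e0 (2 * k))" by (auto simp: conn_def)
  moreover have "conn e e0" using conn_par_eq assms e0 by simp
  ultimately show ?thesis using conn_trans e0(1) assms by blast
qed

lemma is_edge_par_pow: "is_edge e \<Longrightarrow> is_edge ((par ^^ N) e)"
  by (induction N) (auto intro: is_edge_parent)

lemma conn_par_pow:
  assumes "is_edge e" "is_edge f" "conn ((par ^^ N) e) ((par ^^ N) f)"
  shows "conn e f"
  using assms(3)
proof (induction N)
  case (Suc N)
  then show ?case using conn_par is_edge_par_pow assms by simp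
qed auto

text \<open>The bound records only the first halving; further passages to parents do not increase
  the distance.\<close>

lemma par_pow_orb:
  assumes "is_edge e"
  shows "\<exists>j. (par ^^ Suc N) (orb e k) = orb ((par ^^ Suc N) e) j \<and> \<bar>j\<bar> \<le> (\<bar>k\<bar> + 1) div 2"
proof (induction N)
  case 0
  show ?case
    using par_orb [OF assms, of k] by (intro exI [of _ "if even_edge e then k div 2 else (k + 1) div 2"]) auto
next
  case (Suc N)
  then obtain j where j: "(par ^^ Suc N) (orb e k) = orb ((par ^^ Suc N) e) j" "\<bar>j\<bar> \<le> (\<bar>k\<bar> + 1) div 2"
    by blast
  let ?f = "(par ^^ Suc N) e"
  let ?i = "if even_edge ?f then j div 2 else (j + 1) div 2"
  have "(par ^^ Suc (Suc N)) (orb e k) = orb (par ?f) ?i"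
    using par_orb [OF is_edge_par_pow [OF assms, of "Suc N"], of j] j(1) by simp
  moreover have "\<bar>?i\<bar> \<le> (\<bar>k\<bar> + 1) div 2" using j(2) by auto
  ultimately show ?case by auto
qed

text \<open>Passing to the parents halves the distance along a curve, so distinct periodic edges of the
  same curve are consecutive.\<close>

lemma conn_periodic:
  assumes "is_edge e" "(par ^^ Suc N) e = e" "(par ^^ Suc N) f = f" "conn e f"
  shows "f = e \<or> nxt e = f \<or> nxt f = e"
proof -
  \<comment> \<open>A connecting index of least absolute value. By periodicity the halved index also
    connects \<open>e\<close> to \<open>f\<close>, so it is no smaller, which leaves only 0, 1 and
    -1.\<close>
  define k where "k = (ARG_MIN (\<lambda>k. nat \<bar>k\<bar>) k. orb e k = f)"
  obtain k0 where "orb e k0 = f" using assms(4) by (auto simp: conn_def)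
  then have k: "orb e k = f" "\<And>j. orb e j = f \<Longrightarrow> nat \<bar>k\<bar> \<le> nat \<bar>j\<bar>"
    unfolding k_def by (auto intro: arg_min_natI arg_min_nat_le)
  obtain j where j: "orb e j = f" "\<bar>j\<bar> \<le> (\<bar>k\<bar> + 1) div 2"
    using par_pow_orb [OF assms(1), of N k] k(1) assms(2,3) by auto
  have "\<bar>k\<bar> \<le> 1" using k(2) [OF j(1)] j(2) by linarith
  then consider "k = 0" | "k = 1" | "k = -1" by linarith
  then show ?thesis
  proof cases
    case 3
    then show ?thesis using k(1) orb_Suc [OF assms(1), of "-1"] by auto
  qed (use k(1) orb_Suc [OF assms(1), of 0] in auto)
qed

text \<open>Repeated left turns (\<open>r = 1\<close>) run around the square on the left of
  \<open>e\<close>, right turns around the one on its right.\<close>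

definition same_face :: "int \<Rightarrow> edge \<Rightarrow> edge \<Rightarrow> bool" where
  "same_face r e f \<longleftrightarrow> (\<exists>j. (turned m n r ^^ j) e = f)"

text \<open>A second child is followed by the first child of the next side. A first child followed
  in the sense of the fold gives its sibling. Against the fold, the corner of the fold is the centre
  of the square of parents, where the opposite side folds too: the next edge is its second
  child.\<close>

lemma par_turned:
  assumes "is_edge e" "r \<in> {1, -1}"
  shows "same_face r (par e) (par (turned m n r e))"
proof -
  obtain x y c where t: "par e = (x, y, c)" by (cases "par e")
  have te: "is_edge (x, y, c)" using is_edge_parent assms(1) t by metis
  then have c: "c = 1 \<or> c = -1" by simp
  have r: "r = 1 \<or> r = -1" using assms by simp
  have "\<exists>j. par (turned m n r e) = (turned m n r ^^ j) (x, y, c)"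
  proof (cases "even_edge e")
    case True
    then have e: "e = child0 (x, y, c)" using child0_par t by metis
    show ?thesis
    proof (cases "even (x + y) \<longleftrightarrow> r = 1")
      case True
      then have "turned m n r e = child1 (x, y, c)"
        using c r by (auto simp: e Let_def)
      then show ?thesis by (intro exI [of _ 0]) (simp only: par_child1 [OF te] funpow_0)
    next
      case False
      have "turned m n r e = child1 (turned m n r (turned m n r (x, y, c)))"
      proof (cases "even (x + y)")
        case True
        with False r have r: "r = -1" by simp
        have o: "odd (x + m * c + (y + n * c))" using True c odd_m even_n by auto
        have "turned m n r (turned m n r (x, y, c)) = (x + m * c + n * c, y + n * c - m * c, -c)"
          unfolding turned_even [OF True] turned_odd [OF o] using r by simp
        moreover have "even (x + m * c + n * c + (y + n * c - m * c))" using True by auto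
        ultimately show ?thesis using True r
          by (simp only: e child0.simps child1.simps Let_def) (simp add: turned_even)
      next
        case f: False
        with False r have r: "r = 1" by simp
        have o: "even (x - n * c + (y + m * c))" using f c odd_m even_n by auto
        have "turned m n r (turned m n r (x, y, c)) = (x - n * c - m * c, y + m * c - n * c, -c)"
          unfolding turned_odd [OF f] turned_even [OF o] using r by simp
        moreover have "odd (x - n * c - m * c + (y + m * c - n * c))" using f by auto
        ultimately show ?thesis using f r
          by (simp only: e child0.simps child1.simps Let_def) (simp add: turned_even)
      qed
      then show ?thesis using te assms(2)
        by (intro exI [of _ 2]) (simp only: par_child1 is_edge_turned numeral_2_eq_2 funpow.simps o_apply id_apply)
    qed
  next
    case False
    then have e: "e = child1 (x, y, c)" using child1_par assms(1) t by metis
    have "turned m n r e = child0 (turned m n r (x, y, c))"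
      using c r odd_m even_n
      by (cases "even (x + y)") (auto simp: e Let_def)
    then show ?thesis by (intro exI [of _ 1]) (simp only: par_child0 One_nat_def funpow.simps o_apply id_apply)
  qed
  then show ?thesis by (auto simp: same_face_def t)
qed

lemma same_face_trans: "same_face r e f \<Longrightarrow> same_face r f g \<Longrightarrow> same_face r e g"
  unfolding same_face_def by (metis funpow_add o_apply)

lemma same_face_par:
  assumes "is_edge e" "r \<in> {1, -1}" "same_face r e f"
  shows "same_face r (par e) (par f)"
proof -
  obtain j where "f = (turned m n r ^^ j) e" using assms(3) by (auto simp: same_face_def)
  moreover have "same_face r (par e) (par ((turned m n r ^^ j) e)) \<and> is_edge ((turned m n r ^^ j) e)" for j
  proof (induction j)
    case 0
    show ?case using assms(1) by (auto simp: same_face_def intro: exI [of _ 0])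
  next
    case (Suc j)
    let ?f = "(turned m n r ^^ j) e"
    have "same_face r (par ?f) (par (turned m n r ?f))" using Suc assms(2) by (intro par_turned) auto
    then have "same_face r (par e) (par (turned m n r ?f))" using Suc same_face_trans by blast
    moreover have "is_edge (turned m n r ?f)" using Suc assms(2) by (intro is_edge_turned) auto
    ultimately show ?case by simp
  qed
  ultimately show ?thesis by simp
qed

end

section \<open>Finite computation of the periodic edges\<close>

primrec reaches :: "int \<Rightarrow> int \<Rightarrow> edge list \<Rightarrow> nat \<Rightarrow> edge \<Rightarrow> bool" where
  "reaches m n R 0 e \<longleftrightarrow> e \<in> set R"
| "reaches m n R (Suc k) e \<longleftrightarrow> e \<in> set R \<or> reaches m n R k (parent m n e)"

lemma reaches_imp: "reaches m n R k e \<Longrightarrow> \<exists>j. (parent m n ^^ j) e \<in> set R"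
proof (induction k arbitrary: e)
  case 0
  then show ?case by (auto intro: exI [of _ 0])
next
  case (Suc k)
  show ?case
  proof (cases "e \<in> set R")
    case True
    then show ?thesis by (auto intro: exI [of _ 0])
  next
    case False
    then obtain j where "(parent m n ^^ j) (parent m n e) \<in> set R"
      using Suc.prems Suc.IH [of "parent m n e"] by auto
    then have "(parent m n ^^ Suc j) e \<in> set R" by (simp only: funpow_Suc_right o_apply)
    then show ?thesis by blast
  qed
qed

text \<open>\<open>K\<close> selects cosets modulo \<open>q\<close>. Outside this box the parent map
  decreases the norm (see \<open>exists_reach\<close>); inside it nine steps are enough.\<close>

definition box_reaches :: "int \<Rightarrow> int \<Rightarrow> edge list \<Rightarrow> (int \<Rightarrow> int \<Rightarrow> bool) \<Rightarrow> bool" where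
  "box_reaches m n R K \<longleftrightarrow>
     list_all (\<lambda>x. list_all (\<lambda>y. K x y \<longrightarrow> list_all (\<lambda>c. reaches m n R 9 (x, y, c)) [1, -1]) [-7..7]) [-7..7]"

definition periodic :: "int \<Rightarrow> int \<Rightarrow> edge list \<Rightarrow> nat \<Rightarrow> bool" where
  "periodic m n R T \<longleftrightarrow> list_all (\<lambda>e. is_edge e \<and> parent m n e \<in> set R \<and> (parent m n ^^ T) e = e) R"

text \<open>The periodic edges of the parent maps for \<open>q = 1\<close>, \<open>q = 1 - 2\<i>\<close> (only in two of the four
  nonzero cosets) and \<open>q = 3\<close>, found by iterating these maps on a large box.\<close>

definition dragon_core :: "edge list" where
  "dragon_core = [(0, 0, 1), (0, 0, -1), (0, 1, -1), (0, -1, 1)]"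

definition star_core :: "edge list" where
  "star_core = [(1, 0, -1), (0, -2, -1), (-1, -1, -1), (-1, 0, 1), (0, 2, 1), (1, 1, 1)]"

definition path_core :: "edge list" where
  "path_core =
    [(3, 1, -1), (2, -1, 1), (2, -3, 1), (1, -4, 1), (-3, -1, 1), (-2, 1, -1), (-2, 3, -1), (-1, 4, -1),
     (0, 1, -1), (-1, 2, -1), (2, 0, -1), (1, -1, -1), (0, -1, 1), (1, -2, 1), (-2, 0, 1), (-1, 1, 1),
     (0, -2, -1), (-1, -1, -1), (-1, 0, 1), (-2, 2, 1), (0, 2, 1), (1, 1, 1), (1, 0, -1), (2, -2, -1)]"

lemma dragon_box: "box_reaches 1 0 dragon_core (\<lambda>x y. True)"
  by code_simp

text \<open>Modulo 1 - 2\<i> the Gaussian integers become the integers modulo 5, with \<i> sent to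
  3; so \<open>(x + 3 * y) mod 5\<close> is the coset.\<close>

lemma star_box: "box_reaches 1 (-2) star_core (\<lambda>x y. (x + 3 * y) mod 5 = 1 \<or> (x + 3 * y) mod 5 = 4)"
  by code_simp

lemma path_box: "box_reaches 3 0 path_core (\<lambda>x y. \<not> (x mod 3 = 0 \<and> y mod 3 = 0))"
  by code_simp

lemma dragon_periodic: "periodic 1 0 dragon_core 1"
  by code_simp

text \<open>The list is a single cycle of the parent map, along which the classes 1 and 4
  alternate.\<close>

lemma star_periodic: "periodic 1 (-2) star_core 6"
  by code_simp

lemma path_periodic: "periodic 3 0 path_core 8"
  by code_simp

context fold_grid
begin

text \<open>The start is 1 + \<i> times the start of the parent plus \<open>d q\<close>. This form
  gives both the coset of the parent and an estimate of its norm.\<close>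

lemma par_cong:
  assumes "is_edge (x, y, c)" "par (x, y, c) = (X, Y, c')"
  obtains d where "d = 0 \<or> d = 1 \<or> d = -1" "x = X - Y + m * d" "y = X + Y + n * d"
    "even (x + y) \<Longrightarrow> d = 0"
proof (cases "even_edge (x, y, c)")
  case True
  then have "child0 (X, Y, c') = (x, y, c)" using child0_par assms by metis
  then show thesis using that [of 0] by simp
next
  case False
  then have "child1 (X, Y, c') = (x, y, c)" using child1_par assms by metis
  moreover have "c' = 1 \<or> c' = -1" using is_edge_parent assms by (metis is_edge_simp)
  ultimately show thesis using that [of "if even (X + Y) then c' else - c'"] False
    by (auto simp: Let_def even_edge_def)
qed

lemma exists_reach:
  assumes q: "\<bar>m\<bar> \<le> 3" "\<bar>n\<bar> \<le> 2" "m\<^sup>2 + n\<^sup>2 \<le> 9"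
    and box: "box_reaches m n R K"
    and K: "\<And>x y c X Y c'. is_edge (x, y, c) \<Longrightarrow> K x y \<Longrightarrow> par (x, y, c) = (X, Y, c') \<Longrightarrow> K X Y"
  shows "is_edge (x, y, c) \<Longrightarrow> K x y \<Longrightarrow> \<exists>k. (par ^^ k) (x, y, c) \<in> set R"
proof (induction "nat (x\<^sup>2 + y\<^sup>2)" arbitrary: x y c rule: less_induct)
  case less
  show ?case
  proof (cases "x \<in> {-7..7} \<and> y \<in> {-7..7}")
    case True
    have c: "c \<in> set [1, -1]" using less by auto
    have xy: "x \<in> set [-7..7]" "y \<in> set [-7..7]" using True by (simp_all only: set_upto)
    have "reaches m n R 9 (x, y, c)"
      using box less(3) c xy unfolding box_reaches_def list_all_iff by blast
    then show ?thesis by (rule reaches_imp)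
  next
    case False
    obtain X Y c' where p: "par (x, y, c) = (X, Y, c')" by (cases "par (x, y, c)")
    obtain d where d: "d = 0 \<or> d = 1 \<or> d = -1" "x = X - Y + m * d" "y = X + Y + n * d"
      "even (x + y) \<Longrightarrow> d = 0"
      by (rule par_cong [OF less(2) p]) blast
    have big: "\<bar>x\<bar> \<ge> 8 \<or> \<bar>y\<bar> \<ge> 8" using False by auto
    have XY: "2 * (X\<^sup>2 + Y\<^sup>2) = (x - m * d)\<^sup>2 + (y - n * d)\<^sup>2"
    proof -
      have "x - m * d = X - Y" "y - n * d = X + Y" using d(2,3) by simp_all
      then show ?thesis by (simp only:) (simp add: power2_eq_square algebra_simps)
    qed
    have md: "\<bar>m * d\<bar> \<le> 3" "\<bar>n * d\<bar> \<le> 2" "(m * d)\<^sup>2 + (n * d)\<^sup>2 \<le> 9"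
      using d(1) q by (auto simp: power2_eq_square)
    \<comment> \<open>One coordinate is at least 8, and those of \<open>d q\<close> are at most 3.
      The parallelogram identity below then gives a smaller parent, because 25 exceeds twice
      9.\<close>
    have "\<bar>x + m * d\<bar> \<ge> 5 \<or> \<bar>y + n * d\<bar> \<ge> 5" using big md by linarith
    then have "(x + m * d)\<^sup>2 \<ge> 25 \<or> (y + n * d)\<^sup>2 \<ge> 25"
      using power_mono [of 5 "\<bar>x + m * d\<bar>" 2] power_mono [of 5 "\<bar>y + n * d\<bar>" 2] by auto
    then have "(x + m * d)\<^sup>2 + (y + n * d)\<^sup>2 \<ge> 25"
      using zero_le_power2 [of "x + m * d"] zero_le_power2 [of "y + n * d"]
      by (elim disjE) linarith+
    moreover have "2 * (x\<^sup>2 + y\<^sup>2) - 2 * (X\<^sup>2 + Y\<^sup>2)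
        = (x + m * d)\<^sup>2 + (y + n * d)\<^sup>2 - 2 * ((m * d)\<^sup>2 + (n * d)\<^sup>2)"
      unfolding XY by (simp add: power2_eq_square algebra_simps)
    moreover have "a < b" if "25 \<le> u" "2 * b - 2 * a = u - 2 * v" "v \<le> 9" for a b u v :: int
      using that by linarith
    ultimately have "X\<^sup>2 + Y\<^sup>2 < x\<^sup>2 + y\<^sup>2" using md(3) by blast
    moreover have "0 \<le> X\<^sup>2 + Y\<^sup>2" by simp
    ultimately have "nat (X\<^sup>2 + Y\<^sup>2) < nat (x\<^sup>2 + y\<^sup>2)" by linarith
    moreover have "is_edge (X, Y, c')" using is_edge_parent less(2) p by metis
    moreover have "K X Y" using K less p by blast
    ultimately obtain k where "(par ^^ k) (X, Y, c') \<in> set R" using less(1) by blast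
    then have "(par ^^ Suc k) (x, y, c) \<in> set R" by (simp only: funpow_Suc_right o_apply p)
    then show ?thesis by blast
  qed
qed

text \<open>\<open>K\<close> only has to be stable under \<open>T\<close> parents at once, so it may
  be a single coset and select the core edges lying there. That the ancestors are eventually
  constant along multiples of \<open>T\<close> allows two edges to be followed
  simultaneously.\<close>

lemma conn_core:
  assumes e: "is_edge e" "K e" and per: "periodic m n R T" "T > 0"
    and K: "\<And>e. is_edge e \<Longrightarrow> K e \<Longrightarrow> K ((par ^^ T) e)"
    and reach: "\<exists>k. (par ^^ k) e \<in> set R"
  shows "\<exists>r \<in> set R. K r \<and> conn e r \<and> (\<exists>k0. \<forall>k\<ge>k0. (par ^^ (T * k)) e = r)"
proof -
  obtain k where k: "(par ^^ k) e \<in> set R" using reach by blast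
  define r where "r = (par ^^ (T * k)) e"
  have "(par ^^ j) x \<in> set R" if "x \<in> set R" for j x
    using that per(1) by (induction j) (auto simp: periodic_def list_all_iff)
  from this [OF k, of "T * k - k"] have r: "r \<in> set R"
    using per(2) by (simp add: r_def flip: o_apply [of "par ^^ _"] funpow_add)
  have "K ((par ^^ (T * j)) e)" for j
  proof (induction j)
    case (Suc j)
    have "(par ^^ (T * Suc j)) e = (par ^^ T) ((par ^^ (T * j)) e)" by (simp add: funpow_add)
    then show ?case using Suc K e(1) is_edge_par_pow by simp
  qed (use e in simp)
  then have "K r" by (simp add: r_def)
  have fix_r: "(par ^^ (T * j)) r = r" for j
  proof (induction j)
    case (Suc j)
    have "(par ^^ (T * Suc j)) r = (par ^^ T) ((par ^^ (T * j)) r)" by (simp add: funpow_add)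
    then show ?case using Suc per(1) r by (simp add: periodic_def list_all_iff)
  qed simp
  then have "conn ((par ^^ (T * k)) e) ((par ^^ (T * k)) r)" by (simp add: conn_refl flip: r_def)
  moreover have "is_edge r" using e is_edge_par_pow by (simp add: r_def)
  ultimately have "conn e r" using conn_par_pow e by blast
  moreover have "(par ^^ (T * j)) e = r" if "j \<ge> k" for j
  proof -
    have "(par ^^ (T * j)) e = (par ^^ (T * (j - k))) r"
      using that unfolding r_def by (simp flip: o_apply [of "par ^^ _"] funpow_add distrib_left)
    then show ?thesis using fix_r by simp
  qed
  ultimately show ?thesis using r \<open>K r\<close> by blast
qed

end

section \<open>Coverings given by signs, and the cosets modulo \<open>q\<close>\<close>

text \<open>A covering whose turns are given by \<open>\<tau>\<close>, with one edge of each of its curves.\<close>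

locale curve_system = turn_grid 1 0 \<tau> for \<tau> +
  fixes Z :: "edge set"
  assumes is_edge_Z: "z \<in> Z \<Longrightarrow> is_edge z"
    and no_cycle: "is_edge e \<Longrightarrow> orb e k = e \<Longrightarrow> k = 0"
    and cover: "is_edge e \<Longrightarrow> \<exists>z\<in>Z. \<exists>k. orb z k = e"
    and distinct_Z: "z \<in> Z \<Longrightarrow> z' \<in> Z \<Longrightarrow> orb z k = z' \<Longrightarrow> z = z'"

text \<open>The points \<open>q z - p\<close> with \<open>q = m + n\<i>\<close>, \<open>p = p1 + p2\<i>\<close> form a coset of the ideal
  generated by \<open>q\<close>, which yields a covering centred at \<open>p / q\<close>.\<close>

locale coset_grid = fold_grid m n s for m n s :: int +
  fixes p1 p2 :: int
  assumes even_p: "even (p1 + p2)"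
begin

definition loc :: "edge \<Rightarrow> edge" where
  "loc = (\<lambda>(x, y, c). (m * x - n * y - p1, n * x + m * y - p2, c))"

definition cturn :: "int \<Rightarrow> int \<Rightarrow> int" where
  "cturn x y = dturn s (m * x - n * y - p1) (n * x + m * y - p2)"

lemma signs_cturn: "signs cturn"
  using signs by (auto simp: signs_def cturn_def)

sublocale Z: turn_grid 1 0 cturn
  by unfold_locales (auto simp: signs_cturn)

lemma is_edge_loc: "is_edge (loc e) \<longleftrightarrow> is_edge e"
  by (cases e) (simp add: loc_def)

lemma even_loc: "even (m * x - n * y - p1 + (n * x + m * y - p2)) \<longleftrightarrow> even (x + y)"
  using odd_m even_n even_p by auto

lemma loc_turned: "loc (turned 1 0 r e) = turned m n r (loc e)"
proof -
  obtain x y c where e: "e = (x, y, c)" by (cases e)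
  show ?thesis
  proof (cases "even (x + y)")
    case True
    then have l: "even (m * x - n * y - p1 + (n * x + m * y - p2))" using even_loc by blast
    show ?thesis
      unfolding e loc_def case_prod_conv turned_even [OF True] turned_even [OF l] by (simp add: algebra_simps)
  next
    case False
    then have l: "odd (m * x - n * y - p1 + (n * x + m * y - p2))" using even_loc by blast
    show ?thesis
      unfolding e loc_def case_prod_conv turned_odd [OF False] turned_odd [OF l] by (simp add: algebra_simps)
  qed
qed

lemma loc_nxt: "loc (Z.nxt e) = nxt (loc e)"
proof -
  obtain x y c where e: "e = (x, y, c)" by (cases e)
  have "case_prod cturn (edge_end 1 0 e) = case_prod (dturn s) (edge_end m n (loc e))"
    unfolding e loc_def case_prod_conv edge_end.simps even_loc cturn_def by (simp add: algebra_simps)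
  then show ?thesis by (simp add: next_edge_def loc_turned)
qed

lemma inj_loc: "loc e = loc f \<Longrightarrow> e = f"
proof -
  assume eq: "loc e = loc f"
  obtain x y c where e: "e = (x, y, c)" by (cases e)
  obtain x' y' c' where f: "f = (x', y', c')" by (cases f)
  have c: "c = c'" and 1: "m * (x - x') = n * (y - y')" and 2: "n * (x - x') = - (m * (y - y'))"
    using eq by (auto simp: e f loc_def algebra_simps)
  \<comment> \<open>Multiplication by the conjugate of \<open>q\<close>.\<close>
  have "(m * m + n * n) * (x - x') = m * (m * (x - x')) + n * (n * (x - x'))"
    by (simp add: algebra_simps)
  also have "\<dots> = 0" unfolding 1 2 by (simp add: algebra_simps)
  finally have "(m * m + n * n) * (x - x') = 0" .
  moreover have "m \<noteq> 0" using odd_m by auto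
  moreover have "m * m + n * n \<noteq> 0" using \<open>m \<noteq> 0\<close> by (simp add: sum_squares_eq_zero_iff)
  ultimately have "x = x'" by simp
  with 2 \<open>m \<noteq> 0\<close> have "y = y'" by simp
  with \<open>x = x'\<close> c show "e = f" by (simp add: e f)
qed

lemma loc_orb:
  assumes "is_edge e"
  shows "loc (Z.orb e k) = orb (loc e) k"
  using orb_unique [of "\<lambda>k. loc (Z.orb e k)" k] assms
  by (simp add: is_edge_loc Z.is_edge_orb Z.orb_Suc loc_nxt)

lemma Z_no_cycle: "is_edge e \<Longrightarrow> Z.orb e k = e \<Longrightarrow> k = 0"
  using orb_no_cycle loc_orb is_edge_loc by metis

lemma conn_loc: "is_edge e \<Longrightarrow> conn (loc e) (loc f) \<longleftrightarrow> (\<exists>k. Z.orb e k = f)"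
  unfolding conn_def using loc_orb inj_loc by metis

text \<open>Two periodic representatives on one curve would be equal or consecutive, so a check of
  finitely many pairs separates the curves.\<close>

lemma curve_systemI:
  assumes Z: "\<And>z. z \<in> Z \<Longrightarrow> is_edge z" "\<And>z. z \<in> Z \<Longrightarrow> (par ^^ Suc N) (loc z) = loc z"
    and cover: "\<And>e. is_edge e \<Longrightarrow> \<exists>z \<in> Z. conn (loc e) (loc z)"
    and nonadjacent: "\<And>z z'. z \<in> Z \<Longrightarrow> z' \<in> Z \<Longrightarrow> nxt (loc z) \<noteq> loc z'"
  shows "curve_system cturn Z"
proof
  fix z z' k assume z: "z \<in> Z" "z' \<in> Z" "Z.orb z k = z'"
  then have "conn (loc z) (loc z')" using conn_loc Z(1) by blast
  then have "loc z' = loc z \<or> nxt (loc z) = loc z' \<or> nxt (loc z') = loc z"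
    using conn_periodic Z z is_edge_loc by blast
  then show "z = z'" using nonadjacent z inj_loc by metis
next
  fix e assume e: "is_edge e"
  then obtain z where z: "z \<in> Z" "conn (loc e) (loc z)" using cover by blast
  then have "conn (loc z) (loc e)" using conn_sym e is_edge_loc by blast
  then show "\<exists>z\<in>Z. \<exists>k. Z.orb z k = e" using conn_loc Z(1) z(1) by blast
qed (use Z Z_no_cycle in auto)

end

section \<open>Approximation of signs by translations\<close>

lemma power16: "\<exists>r. (16::int) ^ j = 1 + 15 * r"
proof (induction j)
  case (Suc j)
  then obtain r where "(16::int) ^ j = 1 + 15 * r" by blast
  then have "(16::int) ^ Suc j = 1 + 15 * (1 + 16 * r)" by simp
  then show ?case by blast
qed (auto intro: exI [of _ 0])

text \<open>One exponent serves a whole finite set. Powers of 16 replace powers of 2 because they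
  are 1 modulo 15 as well.\<close>

lemma dturn_approx16:
  assumes "odd m" "even n" "finite F"
  obtains j where "j > 0" "\<And>x y t t'. (x, y) \<in> F \<Longrightarrow> (x, y) \<noteq> (0, 0) \<Longrightarrow>
    dturn s (m * x - n * y + 16 ^ j * t) (n * x + m * y + 16 ^ j * t') = dturn s' x y"
proof -
  have *: "\<exists>k. (x, y) \<noteq> (0, 0) \<longrightarrow> (\<forall>j\<ge>k. \<forall>t t'.
    dturn s (m * x - n * y + 16 ^ j * t) (n * x + m * y + 16 ^ j * t') = dturn s' x y)" for x y
  proof (cases "(x, y) = (0, 0)")
    case False
    obtain k where k: "\<And>t t'. dturn s (m * x - n * y + 2 ^ k * t) (n * x + m * y + 2 ^ k * t') = dturn s' x y"
      using dturn_approx [OF assms(1,2) False] by blast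
    have "dturn s (m * x - n * y + 16 ^ j * t) (n * x + m * y + 16 ^ j * t') = dturn s' x y"
      if "j \<ge> k" for j t t'
    proof -
      have "(16::int) ^ j = 2 ^ (4 * j)" by (simp add: power_mult)
      also have "\<dots> = 2 ^ k * 2 ^ (4 * j - k)" using that by (simp flip: power_add)
      finally show ?thesis using k [of "2 ^ (4 * j - k) * t" "2 ^ (4 * j - k) * t'"] by (simp add: mult.assoc)
    qed
    then show ?thesis by blast
  qed auto
  then obtain k where k: "\<And>x y j. (x, y) \<noteq> (0, 0) \<Longrightarrow> j \<ge> k x y \<Longrightarrow> (\<forall>t t'.
    dturn s (m * x - n * y + 16 ^ j * t) (n * x + m * y + 16 ^ j * t') = dturn s' x y)"
    by metis
  define j where "j = Suc (Max (insert 0 (case_prod k ` F)))"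
  have "j \<ge> k x y" if "(x, y) \<in> F" for x y
  proof -
    have "k x y \<le> Max (insert 0 (case_prod k ` F))"
      using that assms(3) by (intro Max_ge) force+
    then show ?thesis by (simp add: j_def)
  qed
  note jk = this
  have "j > 0" by (simp add: j_def)
  then show thesis
  proof (rule that)
    fix x y t t' assume "(x, y) \<in> F" "(x, y) \<noteq> (0, 0)"
    from k [OF this(2) jk [OF this(1)]]
    show "dturn s (m * x - n * y + 16 ^ j * t) (n * x + m * y + 16 ^ j * t') = dturn s' x y" by blast
  qed
qed

lemma dturn_mult:
  assumes "odd m" "even n"
  shows "dturn s (m * x - n * y) (n * x + m * y) = dturn s x y"
proof (cases "(x, y) = (0, 0)")
  case False
  then obtain k where "\<forall>t t'. dturn s (m * x - n * y + 2 ^ k * t) (n * x + m * y + 2 ^ k * t') = dturn s x y"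
    using dturn_approx [OF assms] by blast
  from spec [OF spec [OF this, of 0], of 0] show ?thesis by simp
qed auto

context coset_grid
begin

text \<open>Here \<open>\<alpha> + \<beta>\<i> = 15 / q\<close>, and 15 divides \<open>16\<^sup>j - 1\<close>.\<close>

lemma cturn_approx:
  assumes inv: "m * \<alpha> - n * \<beta> = 15" "m * \<beta> + n * \<alpha> = 0" and s': "s' \<in> {1, -1}" and F: "finite F"
  shows "\<exists>V W. even (V + W) \<and> (\<forall>(x, y)\<in>F. cturn (x + V) (y + W) = dturn s' x y)"
proof -
  obtain j where j: "j > 0" "\<And>x y t t'. (x, y) \<in> F \<Longrightarrow> (x, y) \<noteq> (0, 0) \<Longrightarrow>
    dturn s (m * x - n * y + 16 ^ j * t) (n * x + m * y + 16 ^ j * t') = dturn s' x y"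
    by (rule dturn_approx16 [OF odd_m even_n F]) (rule that; assumption)
  obtain r where r: "(16::int) ^ j = 1 + 15 * r" using power16 by blast
  \<comment> \<open>As \<open>q\<close> is 1 modulo 2, \<open>q t - p\<close> is congruent to 1 or
    to \<i>, hence has sign \<open>s'\<close>. Its multiple by \<open>16 ^ j\<close> will correspond
    to the centre.\<close>
  define t1 t2 where "t1 = (if s' = 1 then p1 + 1 else p1)" and "t2 = (if s' = 1 then p2 else p2 + 1)"
  define T1 T2 where "T1 = m * t1 - n * t2 - p1" and "T2 = n * t1 + m * t2 - p2"
  have T: "dturn s T1 T2 = s'"
    using s' odd_m even_n by (subst dturn_odd) (auto simp: T1_def T2_def t1_def t2_def)
  \<comment> \<open>Chosen such that \<open>q (V + W\<i>) - p = 16 ^ j (q t - p)\<close>: the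
    subtracted term is \<open>15 r p / q\<close>, and \<open>15 r = 16 ^ j - 1\<close>.\<close>
  define V W where "V = 16 ^ j * t1 - (p1 * \<alpha> - p2 * \<beta>) * r" and "W = 16 ^ j * t2 - (p1 * \<beta> + p2 * \<alpha>) * r"
  have V: "m * V - n * W - p1 = 16 ^ j * T1"
  proof -
    have "m * V - n * W - p1 = 16 ^ j * (m * t1 - n * t2) - p1 * r * (m * \<alpha> - n * \<beta>)
        + p2 * r * (m * \<beta> + n * \<alpha>) - p1"
      unfolding V_def W_def by algebra
    also have "\<dots> = 16 ^ j * T1" unfolding inv r T1_def by (simp add: algebra_simps)
    finally show ?thesis .
  qed
  have W: "n * V + m * W - p2 = 16 ^ j * T2"
  proof -
    have "n * V + m * W - p2 = 16 ^ j * (n * t1 + m * t2) - p2 * r * (m * \<alpha> - n * \<beta>)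
        - p1 * r * (m * \<beta> + n * \<alpha>) - p2"
      unfolding V_def W_def by algebra
    also have "\<dots> = 16 ^ j * T2" unfolding inv r T2_def by (simp add: algebra_simps)
    finally show ?thesis .
  qed
  have "even ((16::int) ^ j)" using j(1) by simp
  then have "even (V + W)" using even_p by (auto simp: V_def W_def)
  moreover have "cturn (x + V) (y + W) = dturn s' x y" if "(x, y) \<in> F" for x y
  proof -
    have "m * (x + V) - n * (y + W) - p1 = m * x - n * y + 16 ^ j * T1"
      "n * (x + V) + m * (y + W) - p2 = n * x + m * y + 16 ^ j * T2"
      unfolding V [symmetric] W [symmetric] by (simp_all add: algebra_simps)
    then have eq: "cturn (x + V) (y + W) = dturn s (m * x - n * y + 16 ^ j * T1) (n * x + m * y + 16 ^ j * T2)"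
      by (simp add: cturn_def)
    show ?thesis
    proof (cases "(x, y) = (0, 0)")
      case True
      then show ?thesis using eq T dturn_power16 by simp
    next
      case False
      then show ?thesis using eq j(2) that by simp
    qed
  qed
  ultimately show ?thesis by blast
qed

text \<open>With \<open>V + W\<i> = 15 r p / q\<close>, the point \<open>q (z + V + W\<i>)\<close>
  is \<open>(q z - p) + 16 ^ j p\<close>, close to \<open>q z - p\<close>, and the factor
  \<open>q\<close> does not affect signs. By \<open>nz\<close> the point 0, where closeness gives
  nothing, never occurs.\<close>

lemma approx_cturn:
  assumes inv: "m * \<alpha> - n * \<beta> = 15" "m * \<beta> + n * \<alpha> = 0" and F: "finite F"
    and nz: "\<And>x y. (m * x - n * y - p1, n * x + m * y - p2) \<noteq> (0, 0)"
  shows "\<exists>V W. even (V + W) \<and> (\<forall>(x, y)\<in>F. dturn s' (x + V) (y + W) = cturn x y)"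
proof -
  define G where "G = (\<lambda>(x, y). (m * x - n * y - p1, n * x + m * y - p2)) ` F"
  have "finite G" using F by (simp add: G_def)
  have odd_one: "odd (1::int)" and even_zero: "even (0::int)" by simp_all
  obtain j where j: "j > 0" "\<And>x y t t'. (x, y) \<in> G \<Longrightarrow> (x, y) \<noteq> (0, 0) \<Longrightarrow>
    dturn s' (1 * x - 0 * y + 16 ^ j * t) (0 * x + 1 * y + 16 ^ j * t') = dturn s x y"
    by (rule dturn_approx16 [OF odd_one even_zero \<open>finite G\<close>]) (rule that; assumption)
  obtain r where r: "(16::int) ^ j = 1 + 15 * r" using power16 by blast
  define V W where "V = (p1 * \<alpha> - p2 * \<beta>) * r" and "W = (p1 * \<beta> + p2 * \<alpha>) * r"
  have V: "m * V - n * W = 15 * p1 * r"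
  proof -
    have "m * V - n * W = p1 * r * (m * \<alpha> - n * \<beta>) - p2 * r * (m * \<beta> + n * \<alpha>)"
      unfolding V_def W_def by algebra
    then show ?thesis by (simp add: inv)
  qed
  have W: "n * V + m * W = 15 * p2 * r"
  proof -
    have "n * V + m * W = p2 * r * (m * \<alpha> - n * \<beta>) + p1 * r * (m * \<beta> + n * \<alpha>)"
      unfolding V_def W_def by algebra
    then show ?thesis by (simp add: inv)
  qed
  have "even (V + W)" using even_p by (auto simp: V_def W_def)
  moreover have "dturn s' (x + V) (y + W) = cturn x y" if "(x, y) \<in> F" for x y
  proof -
    let ?u = "m * x - n * y - p1" and ?v = "n * x + m * y - p2"
    have "(?u, ?v) \<in> G" using that by (auto simp: G_def)
    then have "cturn x y = dturn s' (?u + 16 ^ j * p1) (?v + 16 ^ j * p2)"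
      using j(2) [of ?u ?v p1 p2] nz by (simp add: cturn_def)
    also have "?u + 16 ^ j * p1 = m * (x + V) - n * (y + W)"
      using V by (simp add: r algebra_simps)
    also have "?v + 16 ^ j * p2 = n * (x + V) + m * (y + W)"
      using W by (simp add: r algebra_simps)
    finally show ?thesis using dturn_mult [OF odd_m even_n] by simp
  qed
  ultimately show ?thesis by blast
qed

end

subsection \<open>Two coverings by three curves\<close>

interpretation star: coset_grid 1 "-2" 1 0 "-2"
  by unfold_locales (auto simp: signs_dturn)

interpretation path: coset_grid 3 0 1 0 2
  by unfold_locales (auto simp: signs_dturn)

text \<open>The edges which \<open>star.loc\<close> sends to the three edges of
  \<open>star_core\<close> in the coset of \<open>-p\<close>; \<open>path_reps\<close> comes from
  \<open>path_core\<close> in the same way.\<close>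

definition star_reps :: "edge set" where
  "star_reps = {(1, 0, -1), (0, 0, 1), (1, -1, -1)}"

definition path_reps :: "edge set" where
  "path_reps = {(1, 1, -1), (0, 1, -1), (0, 0, -1)}"

lemma star_conn_core:
  assumes "is_edge e"
  shows "\<exists>z\<in>star_reps. star.conn (star.loc e) (star.loc z)"
proof -
  let ?K = "\<lambda>(x, y, c). (x + 3 * y) mod 5 = (1::int)"
  \<comment> \<open>Modulo 1 - 2\<i> the number 1 + \<i> is 4, that is -1: the class changes sign at
    each parent.\<close>
  have flip: "\<exists>k. x + 3 * y = 4 * (X + 3 * Y) + 5 * k"
    if h: "is_edge (x, y, c)" "star.par (x, y, c) = (X, Y, c')" for x y c X Y c'
  proof -
    obtain d where "x = X - Y + 1 * d" "y = X + Y + (-2) * d" using star.par_cong [OF h] by metis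
    then have "x + 3 * y = 4 * (X + 3 * Y) + 5 * (- 2 * Y - d)" by simp
    then show ?thesis by blast
  qed
  have K2: "?K (star.par (star.par e))" if h: "is_edge e" "?K e" for e
  proof -
    obtain x y c where e: "e = (x, y, c)" by (cases e)
    obtain x1 y1 c1 where e1: "star.par e = (x1, y1, c1)" by (cases "star.par e")
    obtain x2 y2 c2 where e2: "star.par (star.par e) = (x2, y2, c2)" by (cases "star.par (star.par e)")
    have "is_edge (x1, y1, c1)" using is_edge_parent h(1) e1 by metis
    then obtain k where "x1 + 3 * y1 = 4 * (x2 + 3 * y2) + 5 * k" using flip e1 e2 by metis
    moreover obtain j where "x + 3 * y = 4 * (x1 + 3 * y1) + 5 * j" using flip e e1 h(1) by metis
    ultimately have "x2 + 3 * y2 = x + 3 * y + 5 * (- 3 * (x2 + 3 * y2) - 4 * k - j)" by simp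
    then obtain l where "x2 + 3 * y2 = x + 3 * y + 5 * l" by blast
    then have "(x2 + 3 * y2) mod 5 = (x + 3 * y) mod 5" by (simp only: mod_mult_self2)
    then show ?thesis using h(2) unfolding e2 by (simp add: e)
  qed
  have K6: "?K ((star.par ^^ 6) e)" if "is_edge e" "?K e" for e
  proof -
    have "(star.par ^^ 6) e = star.par (star.par (star.par (star.par (star.par (star.par e)))))"
      by (simp add: numeral_eq_Suc)
    then show ?thesis by (simp only:) (intro K2 is_edge_parent that)
  qed
  obtain x y c where e: "e = (x, y, c)" by (cases e)
  define x' y' where "x' = x + 2 * y" and "y' = y + 2 - 2 * x"
  have l: "star.loc e = (x', y', c)" by (simp add: star.loc_def e x'_def y'_def)
  have "x' + 3 * y' = 1 + 5 * (1 - x + y)" by (simp add: x'_def y'_def)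
  then have K: "(x' + 3 * y') mod 5 = 1" by (simp only: mod_mult_self2) simp
  have ie: "is_edge (x', y', c)" using assms by (simp add: e)
  have "\<exists>k. (star.par ^^ k) (x', y', c) \<in> set star_core"
  proof (rule star.exists_reach [OF _ _ _ star_box])
    fix x y c X Y c'
    assume "is_edge (x, y, c)" "(x + 3 * y) mod 5 = 1 \<or> (x + 3 * y) mod 5 = 4"
      "star.par (x, y, c) = (X, Y, c')"
    with flip [OF this(1,3)] obtain k where "x + 3 * y = 4 * (X + 3 * Y) + 5 * k"
      "(x + 3 * y) mod 5 = 1 \<or> (x + 3 * y) mod 5 = 4" by blast
    moreover from this(1) have "X + 3 * Y = 4 * (x + 3 * y) + 5 * (- 3 * (X + 3 * Y) - 4 * k)" by simp
    then obtain l where "X + 3 * Y = 4 * (x + 3 * y) + 5 * l" by blast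
    then have "(X + 3 * Y) mod 5 = (4 * (x + 3 * y)) mod 5" by (simp only: mod_mult_self2)
    then have "(X + 3 * Y) mod 5 = (4 * ((x + 3 * y) mod 5)) mod 5" by (simp only: mod_mult_right_eq)
    ultimately show "(X + 3 * Y) mod 5 = 1 \<or> (X + 3 * Y) mod 5 = 4" by auto
  qed (use K ie in \<open>auto simp: star_core_def\<close>)
  then obtain r where r: "r \<in> set star_core" "?K r" "star.conn (x', y', c) r"
    using star.conn_core [OF ie _ star_periodic, of ?K] K K6 by auto
  then have "\<exists>z\<in>star_reps. star.loc z = r"
    by (auto simp: star_core_def star_reps_def star.loc_def)
  then show ?thesis using r(3-) unfolding l by blast
qed

lemma star_loc: "star.loc ` star_reps = {(1, 0, -1), (0, 2, 1), (-1, -1, -1)}"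
  by (simp add: star_reps_def star.loc_def)

lemma star_loc_core: "star.loc ` star_reps \<subseteq> set star_core"
  unfolding star_loc by (simp add: star_core_def)

lemma star_system: "curve_system star.cturn star_reps"
proof (rule star.curve_systemI [where N = 5])
  show "(star.par ^^ Suc 5) (star.loc z) = star.loc z" if "z \<in> star_reps" for z
  proof -
    have "star.loc z \<in> set star_core" using that star_loc_core by blast
    then have "(star.par ^^ 6) (star.loc z) = star.loc z"
      using star_periodic unfolding periodic_def list_all_iff by blast
    moreover have "Suc 5 = 6" by simp
    ultimately show ?thesis by (simp only:)
  qed
  show "star.nxt (star.loc z) \<noteq> star.loc z'" if "z \<in> star_reps" "z' \<in> star_reps" for z z'
    using that by (auto simp: star_reps_def star.loc_def next_edge_def dturn_odd dturn_even)
qed (use star_conn_core in \<open>auto simp: star_reps_def\<close>)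

lemma path_core_reach:
  assumes "is_edge e"
  shows "\<exists>z\<in>path_reps. path.conn (path.loc e) (path.loc z) \<and>
    (\<exists>k0. \<forall>k\<ge>k0. (path.par ^^ (8 * k)) (path.loc e) = path.loc z)"
proof -
  let ?K = "\<lambda>(x, y, c). x mod 3 = (0::int) \<and> y mod 3 = (1::int)"
  have flip: "\<exists>d. x = X - Y + 3 * d \<and> y = X + Y"
    if h: "is_edge (x, y, c)" "path.par (x, y, c) = (X, Y, c')" for x y c X Y c'
  proof -
    obtain d where "x = X - Y + 3 * d" "y = X + Y + 0 * d" using path.par_cong [OF h] by metis
    then show ?thesis by auto
  qed
  \<comment> \<open>The square of 1 + \<i> is 2\<i>, which is -\<i> modulo 3; the fourth power is -1
    and the eighth is 1.\<close>
  have flip2: "\<exists>j k. x = Y + 3 * j \<and> y = - X + 3 * k"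
    if h: "is_edge (x, y, c)" "path.par (path.par (x, y, c)) = (X, Y, c')" for x y c X Y c'
  proof -
    obtain x1 y1 c1 where e1: "path.par (x, y, c) = (x1, y1, c1)" by (cases "path.par (x, y, c)")
    have "is_edge (x1, y1, c1)" using h(1) is_edge_parent e1 by metis
    then obtain d where "x1 = X - Y + 3 * d" "y1 = X + Y"
      using flip [of x1 y1 c1 X Y c'] h(2) unfolding e1 by blast
    moreover obtain d' where "x = x1 - y1 + 3 * d'" "y = x1 + y1" using flip [OF h(1) e1] by blast
    ultimately have "x = Y + 3 * (d + d' - Y)" "y = - X + 3 * (d + X)" by simp_all
    then show ?thesis by blast
  qed
  have K4: "\<exists>j k. x = - X + 3 * j \<and> y = - Y + 3 * k"
    if h: "is_edge (x, y, c)" "path.par (path.par (path.par (path.par (x, y, c)))) = (X, Y, c')" for x y c X Y c'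
  proof -
    obtain x1 y1 c1 where e1: "path.par (path.par (x, y, c)) = (x1, y1, c1)"
      by (cases "path.par (path.par (x, y, c))")
    have "is_edge (x1, y1, c1)" using h(1) is_edge_parent e1 by metis
    then obtain j k where "x1 = Y + 3 * j" "y1 = - X + 3 * k"
      using flip2 [of x1 y1 c1 X Y c'] h(2) unfolding e1 by blast
    moreover obtain j' k' where "x = y1 + 3 * j'" "y = - x1 + 3 * k'" using flip2 [OF h(1) e1] by blast
    ultimately have "x = - X + 3 * (k + j')" "y = - Y + 3 * (k' - j)" by simp_all
    then show ?thesis by blast
  qed
  have K8: "?K ((path.par ^^ 8) e)" if h: "is_edge e" "?K e" for e
  proof -
    obtain x y c where e: "e = (x, y, c)" by (cases e)
    obtain x1 y1 c1 where e1: "path.par (path.par (path.par (path.par e))) = (x1, y1, c1)"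
      by (cases "path.par (path.par (path.par (path.par e)))")
    obtain X Y c' where e2: "path.par (path.par (path.par (path.par (x1, y1, c1)))) = (X, Y, c')"
      by (cases "path.par (path.par (path.par (path.par (x1, y1, c1))))")
    have p8: "(path.par ^^ 8) e = (X, Y, c')"
      unfolding e2 [symmetric] e1 [symmetric] by (simp add: numeral_eq_Suc)
    have "is_edge (x1, y1, c1)" using h(1) is_edge_parent e1 by metis
    then obtain j k where "x1 = - X + 3 * j" "y1 = - Y + 3 * k" using K4 [OF _ e2] by blast
    moreover obtain j' k' where "x = - x1 + 3 * j'" "y = - y1 + 3 * k'"
      using K4 [of x y c x1 y1 c1] e1 h(1) unfolding e by blast
    ultimately have "X = x + 3 * (j - j')" "Y = y + 3 * (k - k')" by simp_all
    then have "X mod 3 = x mod 3" "Y mod 3 = y mod 3" by (simp_all only: mod_mult_self2)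
    then show ?thesis unfolding p8 using h(2) by (simp add: e)
  qed
  obtain x y c where e: "e = (x, y, c)" by (cases e)
  define x' y' where "x' = 3 * x" and "y' = 3 * y - 2"
  have l: "path.loc e = (x', y', c)" by (simp add: path.loc_def e x'_def y'_def)
  have K: "x' mod 3 = 0" "y' mod 3 = 1" unfolding x'_def y'_def by presburger+
  have ie: "is_edge (x', y', c)" using assms by (simp add: e)
  have reach: "\<exists>k. (path.par ^^ k) (x', y', c) \<in> set path_core"
  proof (rule path.exists_reach [OF _ _ _ path_box])
    fix x y c X Y c'
    assume "is_edge (x, y, c)" "\<not> (x mod 3 = 0 \<and> y mod 3 = 0)"
      "path.par (x, y, c) = (X, Y, c')"
    with flip [OF this(1,3)] show "\<not> (X mod 3 = 0 \<and> Y mod 3 = 0)"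
      by (auto simp: mod_eq_0_iff_dvd)
  qed (use K ie in \<open>auto simp: path_core_def\<close>)
  have Ke: "?K (x', y', c)" using K by simp
  have "\<exists>r\<in>set path_core. ?K r \<and> path.conn (x', y', c) r \<and>
      (\<exists>k0. \<forall>k\<ge>k0. (path.par ^^ (8 * k)) (x', y', c) = r)"
    by (rule path.conn_core [where K = ?K, OF ie Ke path_periodic zero_less_numeral _ reach])
      (rule K8; assumption)
  then obtain r where r: "r \<in> set path_core" "?K r" "path.conn (x', y', c) r"
    "\<exists>k0. \<forall>k\<ge>k0. (path.par ^^ (8 * k)) (x', y', c) = r"
    by (elim bexE conjE) (rule that; assumption)
  then have "\<exists>z\<in>path_reps. path.loc z = r"
    by (auto simp: path_core_def path_reps_def path.loc_def)
  then show ?thesis using r(3-) unfolding l by blast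
qed

lemma path_loc: "path.loc ` path_reps = {(3, 1, -1), (0, 1, -1), (0, -2, -1)}"
  by (simp add: path_reps_def path.loc_def)

lemma path_nonadjacent:
  assumes "z \<in> path.loc ` path_reps" "z' \<in> path.loc ` path_reps"
  shows "path.nxt z \<noteq> z'"
  using assms unfolding path_loc by (auto simp: next_edge_def dturn_odd dturn_even)

lemma path_loc_core: "path.loc ` path_reps \<subseteq> set path_core"
  unfolding path_loc by (simp add: path_core_def)

lemma path_system: "curve_system path.cturn path_reps"
proof (rule path.curve_systemI [where N = 7])
  show "(path.par ^^ Suc 7) (path.loc z) = path.loc z" if "z \<in> path_reps" for z
  proof -
    have "path.loc z \<in> set path_core" using that path_loc_core by blast
    then have "(path.par ^^ 8) (path.loc z) = path.loc z"
      using path_periodic unfolding periodic_def list_all_iff by blast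
    moreover have "Suc 7 = 8" by simp
    ultimately show ?thesis by (simp only:)
  qed
  show "path.nxt (path.loc z) \<noteq> path.loc z'" if "z \<in> path_reps" "z' \<in> path_reps" for z z'
    using that path_nonadjacent by blast
  show "is_edge z" if "z \<in> path_reps" for z
    using that by (auto simp: path_reps_def)
  show "\<exists>z\<in>path_reps. path.conn (path.loc e) (path.loc z)" if "is_edge e" for e
    using path_core_reach [OF that] by blast
qed

interpretation path_sys: curve_system path.cturn path_reps
  by (rule path_system)

interpretation star_sys: curve_system star.cturn star_reps
  by (rule star_system)

context curve_system
begin

lemma orb_representative:
  assumes "z \<in> Z" "z' \<in> Z" "orb z j = orb z' k"
  shows "z = z' \<and> j = k"
proof -
  have "orb z (j - k) = z'"
    using orb_add [of z j "-k"] orb_add [of z' k "-k"] assms is_edge_Z by simp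
  then have z: "z = z'" using distinct_Z assms by blast
  have "orb (orb z j) (k - j) = orb z j"
    using orb_add [of z j "k - j"] assms is_edge_Z z by simp
  then have "k - j = 0" using no_cycle is_edge_orb is_edge_Z assms(1) by blast
  with z show ?thesis by simp
qed

end

section \<open>Which of the three curves meet along a square\<close>

lemma is_edge_turned_pow: "is_edge e \<Longrightarrow> r \<in> {1, -1} \<Longrightarrow> is_edge ((turned m n r ^^ j) e)"
  by (induction j) (auto intro: is_edge_turned)

lemma loc_turned_pow: "path.loc ((turned 1 0 r ^^ j) e) = (turned 3 0 r ^^ j) (path.loc e)"
  by (induction j) (simp_all add: path.loc_turned del: turned.simps)

text \<open>Parents preserve \<open>same_face\<close>. After enough full periods of 8 both edges
  have become the core edges of their curves, still related by \<open>same_face\<close>.\<close>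

lemma path_faces:
  assumes e: "is_edge e" and r: "r \<in> {1, -1}"
  shows "\<exists>z\<in>path_reps. \<exists>z'\<in>path_reps. (\<exists>k. path.Z.orb z k = e) \<and>
    (\<exists>k. path.Z.orb z' k = (turned 1 0 r ^^ j) e) \<and> path.same_face r (path.loc z) (path.loc z')"
proof -
  define f where "f = (turned 1 0 r ^^ j) e"
  have f: "is_edge f" unfolding f_def using e r by (rule is_edge_turned_pow)
  obtain z k0 where z: "z \<in> path_reps" "path.conn (path.loc e) (path.loc z)"
    "\<And>k. k \<ge> k0 \<Longrightarrow> (path.par ^^ (8 * k)) (path.loc e) = path.loc z"
    using path_core_reach [OF e] by blast
  obtain z' k1 where z': "z' \<in> path_reps" "path.conn (path.loc f) (path.loc z')"
    "\<And>k. k \<ge> k1 \<Longrightarrow> (path.par ^^ (8 * k)) (path.loc f) = path.loc z'"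
    using path_core_reach [OF f] by blast
  have "path.same_face r (path.loc e) (path.loc f)"
    unfolding path.same_face_def f_def loc_turned_pow by blast
  then have "path.same_face r ((path.par ^^ k) (path.loc e)) ((path.par ^^ k) (path.loc f))" for k
  proof (induction k)
    case (Suc k)
    have "is_edge ((path.par ^^ k) (path.loc e))" using e path.is_edge_loc path.is_edge_par_pow by blast
    from path.same_face_par [OF this r Suc.IH [OF Suc.prems]] show ?case by (simp del: parent.simps)
  qed simp
  from this [of "8 * max k0 k1"] have "path.same_face r (path.loc z) (path.loc z')"
    using z(3) [of "max k0 k1"] z'(3) [of "max k0 k1"] by simp
  moreover have "is_edge z" "is_edge z'" using z(1) z'(1) path_sys.is_edge_Z by auto
  then have "\<exists>k. path.Z.orb z k = e" "\<exists>k. path.Z.orb z' k = f"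
    using path.conn_loc path.conn_sym z(2) z'(2) e f path.is_edge_loc by blast+
  ultimately show ?thesis using z(1) z'(1) unfolding f_def by blast
qed

text \<open>Each square in question has side 3; among its four sides, listed in the proof, only the
  initial one is the core edge of a curve.\<close>

lemma path_face_core:
  assumes z': "z' \<in> path_reps"
  shows "path.same_face 1 (path.loc (0, 0, -1)) (path.loc z') \<Longrightarrow> z' = (0, 0, -1)"
    and "path.same_face (-1) (path.loc (1, 1, -1)) (path.loc z') \<Longrightarrow> z' = (1, 1, -1)"
proof -
  have l: "path.loc (0, 0, -1) = (0, -2, -1)" "path.loc (1, 1, -1) = (3, 1, -1)" by (simp_all add: path.loc_def)
  have loc: "path.loc z' \<in> {(3, 1, -1), (0, 1, -1), (0, -2, -1)}" using z' path_loc by blast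
  have orbit: "(turned 3 0 1 ^^ j) (0, -2, -1) \<in> {(0, -2, -1), (-3, -2, -1), (-3, -5, 1), (0, -5, 1)}" for j
    by (induction j) auto
  have "path.loc z' = path.loc (0, 0, -1)" if same: "path.same_face 1 (path.loc (0, 0, -1)) (path.loc z')"
  proof -
    obtain j where "(turned 3 0 1 ^^ j) (0, -2, -1) = path.loc z'"
      using same unfolding path.same_face_def l by blast
    with orbit [of j] have "path.loc z' \<in> {(0, -2, -1), (-3, -2, -1), (-3, -5, 1), (0, -5, 1)}" by (simp only:)
    with loc show ?thesis unfolding l by auto
  qed
  then show "path.same_face 1 (path.loc (0, 0, -1)) (path.loc z') \<Longrightarrow> z' = (0, 0, -1)"
    using path.inj_loc by blast
  have orbit: "(turned 3 0 (-1) ^^ j) (3, 1, -1) \<in> {(3, 1, -1), (0, 1, 1), (0, 4, 1), (3, 4, -1)}" for j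
    by (induction j) auto
  have "path.loc z' = path.loc (1, 1, -1)" if same: "path.same_face (-1) (path.loc (1, 1, -1)) (path.loc z')"
  proof -
    obtain j where "(turned 3 0 (-1) ^^ j) (3, 1, -1) = path.loc z'"
      using same unfolding path.same_face_def l by blast
    with orbit [of j] have "path.loc z' \<in> {(3, 1, -1), (0, 1, 1), (0, 4, 1), (3, 4, -1)}" by (simp only:)
    with loc show ?thesis unfolding l by auto
  qed
  then show "path.same_face (-1) (path.loc (1, 1, -1)) (path.loc z') \<Longrightarrow> z' = (1, 1, -1)"
    using path.inj_loc by blast
qed

text \<open>Any curve met along a left square has its core edge on the left square of the core edge
  of this one, hence is the same curve. This and \<open>path_right_face\<close> are what the
  separation argument needs.\<close>

lemma path_left_face:
  "\<exists>k. path.Z.orb (0, 0, -1) k = (turned 1 0 1 ^^ j) (path.Z.orb (0, 0, -1) i)"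
proof -
  have b: "(0, 0, -1) \<in> path_reps" by (simp add: path_reps_def)
  have "is_edge (path.Z.orb (0, 0, -1) i)" by (simp add: path.Z.is_edge_orb)
  from path_faces [OF this, of 1 j] obtain z z' k k' where z: "z \<in> path_reps" "z' \<in> path_reps"
    "path.Z.orb z k = path.Z.orb (0, 0, -1) i"
    "path.Z.orb z' k' = (turned 1 0 1 ^^ j) (path.Z.orb (0, 0, -1) i)"
    "path.same_face 1 (path.loc z) (path.loc z')" by auto
  have "z = (0, 0, -1)" using path_sys.orb_representative [OF z(1) b z(3)] by simp
  then show ?thesis using path_face_core(1) [OF z(2)] z(4,5) by auto
qed

lemma path_right_face:
  "\<exists>k. path.Z.orb (1, 1, -1) k = (turned 1 0 (-1) ^^ j) (path.Z.orb (1, 1, -1) i)"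
proof -
  have b: "(1, 1, -1) \<in> path_reps" by (simp add: path_reps_def)
  have "is_edge (path.Z.orb (1, 1, -1) i)" by (simp add: path.Z.is_edge_orb)
  from path_faces [OF this, of "-1" j] obtain z z' k k' where z: "z \<in> path_reps" "z' \<in> path_reps"
    "path.Z.orb z k = path.Z.orb (1, 1, -1) i"
    "path.Z.orb z' k' = (turned 1 0 (-1) ^^ j) (path.Z.orb (1, 1, -1) i)"
    "path.same_face (-1) (path.loc z) (path.loc z')" by auto
  have "z = (1, 1, -1)" using path_sys.orb_representative [OF z(1) b z(3)] by simp
  then show ?thesis using path_face_core(2) [OF z(2)] z(4,5) by auto
qed

subsection \<open>The dragon curves\<close>

lemma length_folding: "folding n S \<Longrightarrow> length S = 2 ^ n - 1"
proof (induction rule: folding.induct)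
  case (2 n S e)
  have "(1::nat) \<le> 2 ^ n" by simp
  with 2 show ?case by (simp add: bar_def)
qed simp

text \<open>The first \<open>2 ^ Suc N - 1\<close> terms are \<open>bar S\<close>, a middle term of
  index \<open>2 ^ N\<close>, and \<open>S\<close>; reflection in the middle changes the
  sign.\<close>

lemma infty_folding_antisym:
  assumes "infty_folding a" "0 < i" "i < 2 ^ N"
  shows "a (2 ^ N + int i) = - a (2 ^ N - int i)"
proof -
  let ?L = "map a [1..2 ^ Suc N - 1]"
  have "folding (Suc N) ?L" using assms(1) unfolding infty_folding_def by blast
  then obtain S e where S: "?L = bar S @ [e] @ S" "folding N S"
    by (cases rule: folding.cases) auto
  have len: "length S = 2 ^ N - 1" using length_folding S(2) by blast
  have nth: "?L ! k = a (1 + int k)" if "k < 2 ^ Suc N - 1" for k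
  proof -
    have "int k < int (2 ^ Suc N - 1)" using that by (simp only: of_nat_less_iff)
    then have *: "1 + int k \<le> 2 ^ Suc N - 1" by (simp add: of_nat_diff)
    then have "k < length [1..2 ^ Suc N - 1::int]" by simp
    then show ?thesis using nth_upto [OF *] by (simp only: nth_map)
  qed
  have "a (2 ^ N + int i) = ?L ! (2 ^ N + i - 1)"
  proof -
    have "2 ^ N + i - 1 < 2 ^ Suc N - 1" using assms(2,3) by simp
    from nth [OF this] show ?thesis using assms(2) by (simp add: of_nat_diff)
  qed
  also have "\<dots> = S ! (i - 1)"
  proof -
    have "2 ^ N + i - 1 = length (bar S @ [e]) + (i - 1)"
      using assms(2,3) by (simp add: bar_def len)
    then show ?thesis unfolding S(1) by (metis append.assoc nth_append_length_plus)
  qed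
  finally have 1: "a (2 ^ N + int i) = S ! (i - 1)" .
  have "a (2 ^ N - int i) = ?L ! (2 ^ N - i - 1)"
  proof -
    have "2 ^ N - i - 1 < 2 ^ Suc N - 1" using assms(2,3) by simp
    from nth [OF this] show ?thesis using assms(2,3) by (simp add: of_nat_diff)
  qed
  also have "\<dots> = bar S ! (2 ^ N - i - 1)"
    unfolding S(1) using assms(2,3) by (subst nth_append) (auto simp: bar_def len)
  also have "\<dots> = - S ! (i - 1)"
  proof -
    have "2 ^ N - i - 1 < length S" using assms(2,3) len by simp
    then have "bar S ! (2 ^ N - i - 1) = - S ! (length S - Suc (2 ^ N - i - 1))"
      by (simp add: bar_def rev_nth)
    also have "length S - Suc (2 ^ N - i - 1) = i - 1" using assms(2,3) len by simp
    finally show ?thesis .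
  qed
  finally show ?thesis using 1 by simp
qed

lemma power2_bracket:
  assumes "(k::nat) > 0"
  obtains N where "2 ^ N \<le> k" "k < 2 ^ Suc N"
  using ex_power_ivl1 [of 2 k] assms by auto

text \<open>Reflection at \<open>2 ^ N\<close> commutes with doubling, which reduces the claim to
  powers of 2, where all terms are 1.\<close>

lemma dragon_double:
  assumes "infty_folding a" "\<forall>n::nat. a (2 ^ n) = 1" "k > 0"
  shows "a (2 * int k) = a (int k)"
  using assms(3)
proof (induction k rule: less_induct)
  case (less k)
  obtain N where N: "2 ^ N \<le> k" "k < 2 ^ Suc N" using power2_bracket less(2) by metis
  show ?case
  proof (cases "k = 2 ^ N")
    case True
    then have "a (2 * int k) = a (2 ^ Suc N)" "a (int k) = a (2 ^ N)" by simp_all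
    then show ?thesis using assms(2) by metis
  next
    case False
    define i where "i = k - 2 ^ N"
    have i: "0 < i" "i < 2 ^ N" "k = 2 ^ N + i" using False N by (auto simp: i_def)
    have "a (2 * int k) = a (2 ^ Suc N + int (2 * i))" by (simp add: i(3) algebra_simps)
    also have "\<dots> = - a (2 ^ Suc N - int (2 * i))"
      using i by (intro infty_folding_antisym assms) auto
    also have "2 ^ Suc N - int (2 * i) = 2 * int (2 ^ N - i)" using i by (simp add: of_nat_diff)
    also have "a (2 * int (2 ^ N - i)) = a (int (2 ^ N - i))" using i by (intro less) auto
    also have "int (2 ^ N - i) = 2 ^ N - int i" using i by (simp add: of_nat_diff)
    also have "- a (2 ^ N - int i) = a (2 ^ N + int i)"
      using infty_folding_antisym [OF assms(1) i(1,2)] by simp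
    finally show ?thesis by (simp add: i(3))
  qed
qed

lemma dragon_odd:
  assumes "infty_folding a" "\<forall>n::nat. a (2 ^ n) = 1"
  shows "a (2 * int j + 1) = (if even j then 1 else -1)"
proof (induction j rule: less_induct)
  case (less j)
  show ?case
  proof (cases "j = 0")
    case True
    then show ?thesis using assms(2) [rule_format, of 0] by simp
  next
    case False
    then obtain N where N: "2 ^ N \<le> j" "j < 2 ^ Suc N" using power2_bracket by (metis neq0_conv)
    define i where "i = j - 2 ^ N"
    have i: "i < 2 ^ N" "j = 2 ^ N + i" using N by (auto simp: i_def)
    have "a (2 * int j + 1) = a (2 ^ Suc N + int (2 * i + 1))" by (simp add: i(2) algebra_simps)
    also have "\<dots> = - a (2 ^ Suc N - int (2 * i + 1))"
      using i by (intro infty_folding_antisym assms) auto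
    also have "2 ^ Suc N - int (2 * i + 1) = 2 * int (2 ^ N - i - 1) + 1"
      using i by (simp add: of_nat_diff)
    also have "a \<dots> = (if even (2 ^ N - i - 1) then 1 else -1)" using i by (intro less) auto
    \<comment> \<open>\<open>j\<close> and its reflected index have opposite parity, also for
      \<open>N = 0\<close>.\<close>
    also have "- \<dots> = (if even j then 1 else -1)"
      using i by (cases N) auto
    finally show ?thesis .
  qed
qed

context fold_grid
begin

definition turn_after :: "edge \<Rightarrow> int" where
  "turn_after e = case_prod (dturn s) (edge_end m n e)"

lemma turn_after_child0:
  assumes "is_edge e"
  shows "turn_after (child0 e) = (if even_edge e then 1 else -1)"
proof -
  obtain x y c where e: "e = (x, y, c)" by (cases e)
  have c: "c = 1 \<or> c = -1" using assms by (simp add: e)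
  have "nxt (child0 e) = turned m n (turn_after (child0 e)) (child0 e)"
    by (simp add: next_edge_def turn_after_def)
  with nxt_child0 [OF assms] have "child1 e = turned m n (turn_after (child0 e)) (child0 e)" by simp
  then have "snd (snd (child1 e)) = snd (snd (turned m n (turn_after (child0 e)) (child0 e)))" by simp
  then have "c = turn_after (child0 e) * (if even (x + y) then c else - c)"
    by (simp add: e Let_def del: even_add split: if_split_asm)
  then have "turn_after (child0 e) = (if even (x + y) then 1 else -1)"
    using c by (cases "even (x + y)") auto
  then show ?thesis by (simp add: e even_edge_def)
qed

lemma turn_after_child1: "is_edge e \<Longrightarrow> turn_after (child1 e) = turn_after e"
  using edge_end_child1 [of e] by (cases "edge_end m n e") (simp add: turn_after_def dturn_scale)

text \<open>\<open>(0, 0, c)\<close> is its own parent, so edge \<open>i\<close> of the orbit has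
  the edges \<open>2 * i\<close> and \<open>2 * i + 1\<close> as children. The turns thus satisfy
  the recursions \<open>dragon_odd\<close> and \<open>dragon_double\<close>.\<close>

lemma dragon_turns:
  assumes a: "infty_folding a" "\<forall>n::nat. a (2 ^ n) = 1" and c: "c = 1 \<or> c = -1"
  shows "turn_after (orb (0, 0, c) (int j)) = a (int j + 1)"
proof (induction j rule: less_induct)
  case (less j)
  have e: "is_edge (0, 0, c)" "even_edge (0, 0, c)" "par (0, 0, c) = (0, 0, c)"
    using c by (auto simp: even_edge_def)
  define i where "i = j div 2"
  let ?e = "orb (0, 0, c) (int i)"
  have ie: "is_edge ?e" using e is_edge_orb by blast
  have ev: "orb (0, 0, c) (2 * int i) = child0 ?e"
    using child0_par [of "orb (0, 0, c) (2 * int i)"] par_orb_even [OF e(1,2), of "int i"] e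
    by (simp add: even_edge_orb)
  show ?case
  proof (cases "even j")
    case True
    then have j: "int j = 2 * int i" by (auto simp: i_def)
    have "turn_after (orb (0, 0, c) (int j)) = (if even i then 1 else -1)"
      unfolding j ev turn_after_child0 [OF ie] using e by (simp add: even_edge_orb)
    then show ?thesis using dragon_odd [OF a, of i] by (simp add: j)
  next
    case False
    then have j: "int j = 2 * int i + 1" by (auto simp: i_def elim: oddE)
    have "orb (0, 0, c) (int j) = child1 ?e"
      using orb_Suc [OF e(1), of "2 * int i"] ev nxt_child0 [OF ie] by (simp add: j)
    then have "turn_after (orb (0, 0, c) (int j)) = turn_after ?e" using turn_after_child1 [OF ie] by simp
    also have "\<dots> = a (int i + 1)" using False by (intro less) (auto simp: i_def elim: oddE)
    also have "\<dots> = a (2 * (int i + 1))" using dragon_double [OF a, of "Suc i"] by (simp add: add.commute)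
    finally show ?thesis by (simp add: j algebra_simps)
  qed
qed

end

interpretation dragon: fold_grid 1 0 1
  by unfold_locales (auto simp: signs_dturn)

text \<open>The periodic edges are the four at the centre; two leave it, and each of the two
  entering it is followed by one that leaves.\<close>

lemma dragon_cover:
  assumes "is_edge e"
  shows "\<exists>c\<in>{1, -1}. \<exists>k. dragon.orb (0, 0, c) k = e"
proof -
  have reach: "\<exists>k. (dragon.par ^^ k) e \<in> set dragon_core"
  proof -
    obtain x y c where e: "e = (x, y, c)" by (cases e)
    show ?thesis
      unfolding e by (rule dragon.exists_reach [OF _ _ _ dragon_box]) (use assms e in \<open>auto simp: dragon_core_def\<close>)
  qed
  have "\<exists>r\<in>set dragon_core. True \<and> dragon.conn e r \<and>
      (\<exists>k0. \<forall>k\<ge>k0. (dragon.par ^^ (1 * k)) e = r)"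
    by (rule dragon.conn_core [where K = "\<lambda>_. True", OF assms TrueI dragon_periodic zero_less_one TrueI reach])
  then obtain r where r: "r \<in> set dragon_core" "dragon.conn e r" by blast
  have ir: "is_edge r" using r(1) by (auto simp: dragon_core_def)
  obtain k where k: "dragon.orb r k = e" using dragon.conn_sym [OF assms r(2)] by (auto simp: dragon.conn_def)
  show ?thesis
  proof (cases "fst (snd r) = 0")
    case True
    then have "r \<in> {(0, 0, 1), (0, 0, -1)}" using r(1) by (auto simp: dragon_core_def)
    then show ?thesis using k by auto
  next
    case False
    then have "dragon.nxt r \<in> {(0, 0, 1), (0, 0, -1)}"
      using r(1) by (auto simp: dragon_core_def next_edge_def)
    moreover have "dragon.orb (dragon.nxt r) (k - 1) = e"
      using dragon.orb_add [OF ir, of 1 "k - 1"] dragon.orb_Suc [OF ir, of 0] k by simp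
    ultimately show ?thesis by auto
  qed
qed

text \<open>The edge obtained from \<open>e\<close> by a rotation of angle \<open>\<pi>/2\<close> around 0 and a reversal.\<close>

fun reverse_edge :: "edge \<Rightarrow> edge" where
  "reverse_edge (x, y, c) = (if even (x + y) then (- y, x + c, - c) else (- y - c, x, c))"

lemma is_edge_reverse: "is_edge e \<Longrightarrow> is_edge (reverse_edge e)"
  by (cases e) auto

text \<open>The rotation negates the signs away from the centre and backward traversal negates the
  turns, so the same signs result, except that \<open>s\<close> becomes \<open>- s\<close> at the
  centre.\<close>

lemma reverse_next:
  assumes "is_edge e"
  shows "reverse_edge (next_edge 1 0 (dturn s) e) = prev_edge 1 0 (dturn (- s)) (reverse_edge e)"
proof -
  obtain x y c where e: "e = (x, y, c)" by (cases e)
  have c: "c = 1 \<or> c = -1" using assms by (simp add: e)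
  show ?thesis
  proof (cases "even (x + y)")
    case True
    define t where "t = dturn s (x + c) y"
    have o: "odd (x + c + y)" "odd (- y + (x + c))" using True c by auto
    have n: "next_edge 1 0 (dturn s) e = (x + c, y, t * c)" using True by (simp add: e next_edge_def t_def)
    have p: "dturn (- s) (- y) (x + c) = - t" by (simp add: t_def dturn_rotate)
    have r: "reverse_edge e = (- y, x + c, - c)" using True by (simp add: e)
    have "reverse_edge (x + c, y, t * c) = (- y - t * c, x + c, t * c)"
      by (simp only: reverse_edge.simps o if_False)
    moreover have "prev_edge 1 0 (dturn (- s)) (- y, x + c, - c) = (- y - t * c, x + c, t * c)"
      by (simp only: prev_edge.simps Let_def o if_False p) (simp add: mult.commute)
    ultimately show ?thesis by (simp only: n r)
  next
    case False
    define t where "t = dturn s x (y + c)"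
    have o: "even (x + (y + c)) = True" "even (- y - c + x) = True" using False c by auto
    have n: "next_edge 1 0 (dturn s) e = (x, y + c, - t * c)" using False by (simp add: e next_edge_def t_def)
    have p: "dturn (- s) (- y - c) x = - t" using dturn_rotate [of s "y + c" x] by (simp add: t_def)
    have r: "reverse_edge e = (- y - c, x, c)" using False by (simp add: e)
    have "reverse_edge (x, y + c, - t * c) = (- y - c, x - t * c, t * c)"
      by (simp only: reverse_edge.simps o if_True) simp
    moreover have "prev_edge 1 0 (dturn (- s)) (- y - c, x, c) = (- y - c, x - t * c, t * c)"
      by (simp only: prev_edge.simps Let_def o if_True p) (simp add: mult.commute)
    ultimately show ?thesis by (simp only: n r)
  qed
qed

lemma reverse_orbit:
  assumes "is_edge e" "s \<in> {1, -1}"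
  shows "reverse_edge (orbit 1 0 (dturn s) e k) = orbit 1 0 (dturn (- s)) (reverse_edge e) (- k)"
proof -
  interpret A: fold_grid 1 0 s by unfold_locales (use assms(2) in \<open>auto simp: signs_dturn\<close>)
  interpret B: fold_grid 1 0 "- s" by unfold_locales (use assms(2) in \<open>auto intro: signs_dturn\<close>)
  have "reverse_edge (A.orb e (- k)) = B.orb (reverse_edge (A.orb e (- 0))) k" for k
  proof (rule B.orb_unique)
    show "is_edge (reverse_edge (A.orb e (- k)))" for k
      using assms(1) A.is_edge_orb is_edge_reverse by blast
    show "reverse_edge (A.orb e (- (k + 1))) = B.nxt (reverse_edge (A.orb e (- k)))" for k
    proof -
      have 1: "A.orb e (- k) = A.nxt (A.orb e (- (k + 1)))"
        using A.orb_Suc [OF assms(1), of "- (k + 1)"] by simp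
      have 2: "is_edge (A.orb e (- (k + 1)))" using assms(1) A.is_edge_orb by blast
      show ?thesis unfolding 1 reverse_next [OF 2] using B.nxt_prv is_edge_reverse 2 by metis
    qed
  qed
  from this [of "- k"] show ?thesis by simp
qed

subsection \<open>From the grid to the plane\<close>

fun edges_at :: "int \<times> int \<Rightarrow> edge set" where
  "edges_at (x, y) = {(x, y, 1), (x, y, -1)} \<union>
     (if even (x + y) then {(x, y - 1, 1), (x, y + 1, -1)} else {(x - 1, y, 1), (x + 1, y, -1)})"

fun edge_start :: "edge \<Rightarrow> int \<times> int" where
  "edge_start (x, y, c) = (x, y)"

lemma edges_at_iff: "e \<in> edges_at p \<longleftrightarrow> is_edge e \<and> (edge_start e = p \<or> edge_end 1 0 e = p)"
proof -
  obtain x y c where e: "e = (x, y, c)" by (cases e)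
  obtain u v where p: "p = (u, v)" by (cases p)
  show ?thesis unfolding e p
    by (cases "even (x + y)"; cases "even (u + v)") auto
qed

text \<open>Horizontal edges start at even points and vertical ones at odd points, which decides the
  orientation; \<open>f\<close> makes this choice.\<close>

lemma edge_unique:
  fixes a b d d' :: int
  assumes "d \<in> {1, -1} \<and> d' = 0 \<or> d = 0 \<and> d' \<in> {1, -1}"
  shows "\<exists>!e. is_edge e \<and> {edge_start e, edge_end 1 0 e} = {(a, b), (a + d, b + d')}"
proof -
  define f where "f = (if even (a + b) \<longleftrightarrow> d' = 0 then (a, b, d + d') else (a + d, b + d', - d - d'))"
  show ?thesis
  proof (rule ex1I [of _ f])
    show "is_edge f \<and> {edge_start f, edge_end 1 0 f} = {(a, b), (a + d, b + d')}"
      using assms by (cases "even (a + b)") (auto simp: f_def)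
    fix e assume e: "is_edge e \<and> {edge_start e, edge_end 1 0 e} = {(a, b), (a + d, b + d')}"
    obtain x y c where xyc: "e = (x, y, c)" by (cases e)
    from e have "(edge_start e = (a, b) \<and> edge_end 1 0 e = (a + d, b + d')) \<or>
        (edge_start e = (a + d, b + d') \<and> edge_end 1 0 e = (a, b))"
      by (auto simp: doubleton_eq_iff)
    then show "e = f" using assms e
      by (cases "even (x + y)") (auto simp: xyc f_def)
  qed
qed

text \<open>In the grid, edges leave even points horizontally. \<open>u = \<i>\<close> serves the
  coverings whose segments leave \<open>org\<close> vertically.\<close>

locale placement =
  fixes u org :: complex
  assumes unit: "u = 1 \<or> u = \<i>" and origin: "org \<in> lattice"
begin

definition point :: "int \<times> int \<Rightarrow> complex" where
  "point = (\<lambda>(x, y). org + u * Complex (of_int x) (of_int y))"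

definition place :: "edge \<Rightarrow> segment" where
  "place = (\<lambda>(x, y, c). (point (x, y), u * (if even (x + y) then of_int c else of_int c * \<i>)))"

lemma u_nz: "u \<noteq> 0"
  using unit by auto

lemma point_inj: "point p = point q \<longleftrightarrow> p = q"
  using u_nz by (auto simp: point_def split: prod.splits)

lemma point_lattice: "point p \<in> lattice"
  using unit origin by (auto simp: point_def lattice_def split: prod.splits)

lemma lattice_point:
  assumes "z \<in> lattice"
  obtains p where "z = point p"
proof -
  obtain a b where o: "Re org = of_int a" "Im org = of_int b"
    using origin by (auto simp: lattice_def elim!: Ints_cases)
  obtain c d where z: "Re z = of_int c" "Im z = of_int d"
    using assms by (auto simp: lattice_def elim!: Ints_cases)
  show thesis
  proof (cases "u = 1")
    case True
    then have "z = point (c - a, d - b)" using o z by (simp add: point_def complex_eq_iff)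
    then show thesis by (rule that)
  next
    case False
    then have "u = \<i>" using unit by simp
    then have "z = point (d - b, a - c)" using o z by (simp add: point_def complex_eq_iff)
    then show thesis by (rule that)
  qed
qed

lemma fst_place: "fst (place e) = point (edge_start e)"
  by (cases e) (simp add: place_def)

lemma seg_end_place: "seg_end (place e) = point (edge_end 1 0 e)"
  by (cases e) (auto simp: place_def seg_end_def point_def complex_eq_iff algebra_simps)

lemma snd_place: "snd (place (x, y, c)) = u * (if even (x + y) then of_int c else of_int c * \<i>)"
  by (simp add: place_def)

lemma place_even: "even (x + y) \<Longrightarrow> place (x, y, c) = (point (x, y), u * of_int c)"
  and place_odd: "odd (x + y) \<Longrightarrow> place (x, y, c) = (point (x, y), u * (of_int c * \<i>))"
  by (simp_all add: place_def)

lemma is_segment_place: "is_edge e \<Longrightarrow> is_segment (place e)"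
  using unit point_lattice by (cases e) (auto simp: is_segment_def place_def)

lemma place_turned:
  assumes "is_edge e" "r \<in> {1, -1}"
  shows "place (turned 1 0 r e) = (seg_end (place e), \<i> powi r * snd (place e))"
proof (rule prod_eqI)
  show "fst (place (turned 1 0 r e)) = fst (seg_end (place e), \<i> powi r * snd (place e))"
    unfolding fst_place seg_end_place by (cases e) auto
  obtain x y c where e: "e = (x, y, c)" by (cases e)
  have c: "c = 1 \<or> c = -1" using assms by (simp add: e)
  show "snd (place (turned 1 0 r e)) = snd (seg_end (place e), \<i> powi r * snd (place e))"
  proof (cases "even (x + y)")
    case True
    then have o: "odd (x + c + y)" using c by auto
    have "snd (place (turned 1 0 r e)) = u * (of_int (r * c) * \<i>)"
      unfolding e turned_even [OF True] snd_place using o by simp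
    then show ?thesis using assms(2) True by (auto simp: e snd_place)
  next
    case False
    then have o: "even (x + (y + c))" using c by auto
    have "snd (place (turned 1 0 r e)) = u * of_int (- r * c)"
      unfolding e turned_odd [OF False] snd_place using o by simp
    moreover have "\<i> * (u * (of_int c * \<i>)) = - (u * of_int c)" by (simp add: algebra_simps)
    ultimately show ?thesis using assms(2) False by (auto simp: e snd_place)
  qed
qed

lemma place_inj: "place e = place f \<Longrightarrow> e = f"
proof -
  assume eq: "place e = place f"
  obtain x y c where e: "e = (x, y, c)" by (cases e)
  obtain x' y' c' where f: "f = (x', y', c')" by (cases f)
  have "(x, y) = (x', y')" using arg_cong [OF eq, of fst] by (simp add: fst_place e f point_inj)
  moreover have "snd (place e) = snd (place f)" using eq by simp
  ultimately show "e = f" using u_nz by (auto simp: e f snd_place split: if_splits)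
qed

lemma even_point_iff: "even_point (point (x, y)) \<longleftrightarrow> (even_point org \<longleftrightarrow> even (x + y))"
proof -
  obtain a b where o: "Re org = of_int a" "Im org = of_int b"
    using origin by (auto simp: lattice_def elim!: Ints_cases)
  from unit show ?thesis
  proof
    assume u: "u = 1"
    have "Re (point (x, y)) = of_int (a + x)" "Im (point (x, y)) = of_int (b + y)"
      unfolding point_def unfolding u using o by simp_all
    then show ?thesis unfolding even_point_def o by (simp only: floor_of_int) auto
  next
    assume u: "u = \<i>"
    have "Re (point (x, y)) = of_int (a - y)" "Im (point (x, y)) = of_int (b + x)"
      unfolding point_def unfolding u using o by simp_all
    then show ?thesis unfolding even_point_def o by (simp only: floor_of_int) auto
  qed
qed

lemma place_edges_at:
  "place ` edges_at (x, y) =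
    (if even (x + y) \<longleftrightarrow> u = 1 then horizontal_out (point (x, y)) else vertical_out (point (x, y)))"
proof -
  define P where "P = point (x, y)"
  have P: "point (x + 1, y) = P + u" "point (x - 1, y) = P - u"
    "point (x, y + 1) = P + u * \<i>" "point (x, y - 1) = P - u * \<i>"
    by (auto simp: P_def point_def complex_eq_iff algebra_simps)
  show ?thesis
  proof (cases "even (x + y)")
    case True
    then have o: "odd (x + (y - 1))" "odd (x + (y + 1))" by auto
    have "place ` edges_at (x, y) = {place (x, y, 1), place (x, y, -1), place (x, y - 1, 1), place (x, y + 1, -1)}"
      using True by (simp add: insert_commute)
    also have "\<dots> = {(P, u), (P, - u), (P - u * \<i>, u * \<i>), (P + u * \<i>, - (u * \<i>))}"
      unfolding place_even [OF True] place_odd [OF o(1)] place_odd [OF o(2)] P P_def [symmetric] by simp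
    finally have "place ` edges_at (x, y) = \<dots>" .
    with True unit show ?thesis
      by (elim disjE) (simp_all only: P_def, simp_all add: horizontal_out_def vertical_out_def insert_commute del: even_add edges_at.simps)
  next
    case False
    then have o: "even (x - 1 + y)" "even (x + 1 + y)" by auto
    have "place ` edges_at (x, y) = {place (x, y, 1), place (x, y, -1), place (x - 1, y, 1), place (x + 1, y, -1)}"
      using False by (simp add: insert_commute)
    also have "\<dots> = {(P, u * \<i>), (P, - (u * \<i>)), (P - u, u), (P + u, - u)}"
      unfolding place_odd [OF False] place_even [OF o(1)] place_even [OF o(2)] P P_def [symmetric] by simp
    finally have "place ` edges_at (x, y) = \<dots>" .
    with False unit show ?thesis
      by (elim disjE) (simp_all only: P_def, simp_all add: horizontal_out_def vertical_out_def insert_commute del: even_add edges_at.simps)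
  qed
qed

lemma seg_supp_place: "seg_supp (place e) = closed_segment (point (edge_start e)) (point (edge_end 1 0 e))"
  by (simp add: seg_supp_def fst_place seg_end_place)

lemma seg_supp_place_eq:
  "seg_supp (place e) = closed_segment (point p) (point q) \<longleftrightarrow> {edge_start e, edge_end 1 0 e} = {p, q}"
proof -
  have "inj point" by (auto simp: inj_def point_inj)
  have "seg_supp (place e) = closed_segment (point p) (point q) \<longleftrightarrow>
      point ` {edge_start e, edge_end 1 0 e} = point ` {p, q}"
    by (simp add: seg_supp_place closed_segment_eq)
  then show ?thesis using inj_image_eq_iff [OF \<open>inj point\<close>] by metis
qed

lemma unit_interval:
  assumes "z \<in> lattice" "e \<in> {1, \<i>}"
  shows "\<exists>!f. is_edge f \<and> seg_supp (place f) = closed_segment z (z + e)"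
proof -
  obtain p where p: "z = point p" using lattice_point assms(1) by blast
  obtain x y where xy: "p = (x, y)" by (cases p)
  have "\<exists>d d'. (d \<in> {1, -1} \<and> d' = 0 \<or> d = 0 \<and> d' \<in> {1, -1}) \<and> z + e = point (x + d, y + d')"
  proof -
    have "z + e = point (x + 1, y + 0) \<or> z + e = point (x + 0, y + 1) \<or> z + e = point (x + 0, y + -1)"
      using unit assms(2) unfolding p xy point_def by (elim disjE) (auto simp: complex_eq_iff)
    then show ?thesis by blast
  qed
  then obtain d d' where d: "d \<in> {1, -1} \<and> d' = 0 \<or> d = 0 \<and> d' \<in> {1, -1}" "z + e = point (x + d, y + d')"
    by blast
  show ?thesis unfolding d(2) unfolding p xy seg_supp_place_eq by (rule edge_unique [OF d(1)])
qed

lemma edge_interval: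
  assumes "is_edge f"
  shows "\<exists>z\<in>lattice. \<exists>e\<in>{1, \<i>}. seg_supp (place f) = closed_segment z (z + e)"
proof -
  have s: "is_segment (place f)" by (rule is_segment_place [OF assms])
  have l: "fst (place f) \<in> lattice" "seg_end (place f) \<in> lattice"
    by (simp_all add: fst_place seg_end_place point_lattice)
  have "snd (place f) \<in> {1, \<i>} \<or> - snd (place f) \<in> {1, \<i>}" using s by (auto simp: is_segment_def)
  then show ?thesis
  proof
    assume "snd (place f) \<in> {1, \<i>}"
    then show ?thesis using l(1) by (intro bexI) (auto simp: seg_supp_def seg_end_def)
  next
    assume "- snd (place f) \<in> {1, \<i>}"
    moreover have "seg_supp (place f) = closed_segment (seg_end (place f)) (seg_end (place f) + - snd (place f))"
      by (simp add: seg_supp_def seg_end_def closed_segment_commute)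
    ultimately show ?thesis using l(2) by blast
  qed
qed

text \<open>Describes the given and the constructed coverings alike, by their signs and without
  representatives; the transfer of patterns works with this description.\<close>

definition models :: "(int \<Rightarrow> int \<Rightarrow> int) \<Rightarrow> (int \<Rightarrow> segment) set \<Rightarrow> bool" where
  "models \<tau> \<C> \<longleftrightarrow>
     (\<forall>C\<in>\<C>. \<forall>k. \<exists>e. is_edge e \<and> C k = place e \<and> C (k + 1) = place (next_edge 1 0 \<tau> e)) \<and>
     (\<forall>e. is_edge e \<longrightarrow> (\<exists>C\<in>\<C>. \<exists>k. C k = place e))"

definition curve_at :: "(int \<Rightarrow> int \<Rightarrow> int) \<Rightarrow> edge \<Rightarrow> int \<Rightarrow> segment" where
  "curve_at \<tau> e k = place (orbit 1 0 \<tau> e k)"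

end

locale placed_system = placement u org + curve_system \<tau> Z for u org \<tau> Z
begin

definition curves :: "(int \<Rightarrow> segment) set" where
  "curves = curve_at \<tau> ` Z"

lemma models_curves: "models \<tau> curves"
  unfolding models_def
proof (intro conjI ballI allI impI)
  fix C k assume "C \<in> curves"
  then obtain z where z: "z \<in> Z" "C = curve_at \<tau> z" by (auto simp: curves_def)
  then have "is_edge z" using is_edge_Z by blast
  then show "\<exists>e. is_edge e \<and> C k = place e \<and> C (k + 1) = place (nxt e)"
    by (intro exI [of _ "orb z k"]) (simp add: z(2) curve_at_def is_edge_orb orb_Suc)
next
  fix e assume "is_edge e"
  then obtain z k where "z \<in> Z" "orb z k = e" using cover by blast
  then show "\<exists>C\<in>curves. \<exists>k. C k = place e"
    unfolding curves_def by (auto simp: curve_at_def)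
qed

lemma complete_curve_at:
  assumes "is_edge z"
  shows "complete_curve (curve_at \<tau> z)"
proof -
  define a where "a k = case_prod \<tau> (edge_end 1 0 (orb z k))" for k
  have "curve_of UNIV a (curve_at \<tau> z)"
    unfolding curve_of_def
  proof (intro conjI ballI allI impI)
    fix k
    show "is_segment (curve_at \<tau> z k)"
      by (simp add: curve_at_def is_segment_place is_edge_orb assms)
    show a: "a k \<in> {1, -1}" using signs by (auto simp: a_def signs_def split: prod.splits)
    have *: "curve_at \<tau> z (k + 1) = place (turned 1 0 (a k) (orb z k))"
      by (simp add: curve_at_def orb_Suc assms next_edge_def a_def)
    show "seg_end (curve_at \<tau> z k) = fst (curve_at \<tau> z (k + 1))"
      "snd (curve_at \<tau> z (k + 1)) = \<i> powi a k * snd (curve_at \<tau> z k)"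
      unfolding * place_turned [OF is_edge_orb [OF assms] a] by (simp_all add: curve_at_def)
  qed
  then show ?thesis unfolding complete_curve_def by blast
qed

lemma segments_at_curves: "segments_at curves (point p) = place ` edges_at p"
proof -
  have *: "(\<exists>C\<in>curves. s \<in> range C) \<longleftrightarrow> (\<exists>e. is_edge e \<and> s = place e)" for s
    using models_curves unfolding models_def by (metis rangeE rangeI)
  show ?thesis
  proof (rule set_eqI)
    fix s
    have "s \<in> segments_at curves (point p) \<longleftrightarrow>
        (\<exists>e. is_edge e \<and> s = place e) \<and> (fst s = point p \<or> seg_end s = point p)"
      by (simp only: segments_at_def mem_Collect_eq *)
    also have "\<dots> \<longleftrightarrow> (\<exists>e. is_edge e \<and> s = place e \<and> (edge_start e = p \<or> edge_end 1 0 e = p))"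
      by (metis fst_place seg_end_place point_inj)
    also have "\<dots> \<longleftrightarrow> s \<in> place ` edges_at p" using edges_at_iff by blast
    finally show "s \<in> segments_at curves (point p) \<longleftrightarrow> s \<in> place ` edges_at p" .
  qed
qed

text \<open>A unit interval determines its oriented edge, and \<open>orb_representative\<close> then
  determines the curve and the index.\<close>

lemma covering_curves: "covering curves"
  unfolding covering_def
proof (intro conjI ballI)
  fix C assume "C \<in> curves"
  then show "complete_curve C" using complete_curve_at is_edge_Z by (auto simp: curves_def)
next
  fix z e :: complex assume "z \<in> lattice" "e \<in> {1, \<i>}"
  from unit_interval [OF this] obtain f where f: "is_edge f" "seg_supp (place f) = closed_segment z (z + e)"
    "\<And>g. is_edge g \<Longrightarrow> seg_supp (place g) = closed_segment z (z + e) \<Longrightarrow> g = f" by blast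
  obtain r k where r: "r \<in> Z" "orb r k = f" using cover f(1) by blast
  show "\<exists>!p. fst p \<in> curves \<and> seg_supp (fst p (snd p)) = closed_segment z (z + e)"
  proof (rule ex1I [of _ "(curve_at \<tau> r, k)"])
    show "fst (curve_at \<tau> r, k) \<in> curves \<and>
        seg_supp (fst (curve_at \<tau> r, k) (snd (curve_at \<tau> r, k))) = closed_segment z (z + e)"
      using r f(2) by (simp add: curves_def curve_at_def)
    fix p assume p: "fst p \<in> curves \<and> seg_supp (fst p (snd p)) = closed_segment z (z + e)"
    then obtain r' where r': "r' \<in> Z" "fst p = curve_at \<tau> r'" by (auto simp: curves_def)
    then have "orb r' (snd p) = f" using p f(3) is_edge_orb is_edge_Z by (auto simp: curve_at_def)
    then have "r' = r \<and> snd p = k" using orb_representative r r' by metis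
    then show "p = (curve_at \<tau> r, k)" using r' by (metis prod.collapse)
  qed
next
  show "well_oriented curves"
    unfolding well_oriented_def
  proof (intro exI ballI)
    fix z assume "z \<in> lattice"
    then obtain p where p: "z = point p" using lattice_point by blast
    obtain x y where xy: "p = (x, y)" by (cases p)
    show "segments_at curves z =
      (if even_point z = (even_point org = (u = 1)) then horizontal_out z else vertical_out z)"
      unfolding p segments_at_curves unfolding xy place_edges_at even_point_iff by auto
  qed
qed

lemma inj_curve_at: "inj_on (curve_at \<tau>) Z"
proof (rule inj_onI)
  fix z z' assume "curve_at \<tau> z = curve_at \<tau> z'"
  from fun_cong [OF this, of 0] show "z = z'" using place_inj by (simp add: curve_at_def)
qed

lemma card_curves: "card curves = card Z"
  unfolding curves_def by (rule card_image [OF inj_curve_at])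

end

section \<open>Transfer of bounded patterns by translation\<close>

context placement
begin

text \<open>The direction of an edge depends on the parity of its start, so the translation has to
  be even.\<close>

lemma translate_place:
  assumes "even (V + W)"
  shows "translate (point (V, W) - org) (place (x, y, c)) = place (x + V, y + W, c)"
proof -
  have "even (x + V + (y + W)) \<longleftrightarrow> even (x + y)" using assms by auto
  then show ?thesis
    by (simp add: translate_def place_def point_def complex_eq_iff algebra_simps del: even_add)
qed

lemma translate_next:
  assumes "even (V + W)" "is_edge e" "edge_end 1 0 e = (a, b)" "\<tau>' (a + V) (b + W) = \<tau> a b"
    and "translate (point (V, W) - org) (place e) = place f"
  shows "translate (point (V, W) - org) (place (next_edge 1 0 \<tau> e)) = place (next_edge 1 0 \<tau>' f)"
proof -
  obtain x y c where e: "e = (x, y, c)" by (cases e)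
  have f: "f = (x + V, y + W, c)" using assms(5) place_inj by (simp add: e translate_place [OF assms(1)])
  have ev: "even (x + V + (y + W)) \<longleftrightarrow> even (x + y)" using assms(1) by auto
  have "edge_end 1 0 f = (a + V, b + W)"
    using assms(3) ev by (auto simp: e f)
  then have n: "next_edge 1 0 \<tau>' f = turned 1 0 (\<tau> a b) f" "next_edge 1 0 \<tau> e = turned 1 0 (\<tau> a b) e"
    using assms(3,4) by (simp_all add: next_edge_def)
  show ?thesis
  proof (cases "even (x + y)")
    case True
    then show ?thesis
      unfolding n unfolding e f turned_even [OF True] turned_even [OF ev [THEN iffD2, OF True]]
      by (simp add: translate_place [OF assms(1)] algebra_simps)
  next
    case False
    then have o: "odd (x + V + (y + W))" using ev by simp
    show ?thesis
      unfolding n unfolding e f turned_odd [OF False] turned_odd [OF o]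
      by (simp add: translate_place [OF assms(1)] algebra_simps)
  qed
qed

text \<open>A bounded pattern involves only the signs at the ends of its finitely many edges. Once
  these agree after an even translation, the curves of \<open>\<D>\<close> follow the translated
  ones step by step.\<close>

lemma bounded_below_translate:
  assumes C: "models \<tau> \<C>" and D: "models \<tau>' \<D>" and B: "bounded_below \<B> \<C>"
    and approx: "\<And>F. finite F \<Longrightarrow> \<exists>V W. even (V + W) \<and> (\<forall>(x, y)\<in>F. \<tau>' (x + V) (y + W) = \<tau> x y)"
  shows "\<exists>v. bounded_below (translate_set v \<B>) \<D>"
proof -
  have fin: "finite \<B>" using B by (simp add: bounded_below_def)
  define S where "S = {e. place e \<in> segments_of \<B>}"
  have "inj place" using place_inj by (auto intro: injI)
  then have "finite S" using fin finite_vimageI [of "segments_of \<B>" place]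
    by (simp add: S_def segments_of_def vimage_def)
  obtain V W where VW: "even (V + W)" "\<forall>(x, y)\<in>edge_end 1 0 ` S. \<tau>' (x + V) (y + W) = \<tau> x y"
    using approx [of "edge_end 1 0 ` S"] \<open>finite S\<close> by blast
  define t where "t = translate (point (V, W) - org)"
  have t_inj: "s = s'" if "t s = t s'" for s s'
    using that by (auto simp: t_def translate_def prod_eq_iff)
  have seg: "\<exists>e. is_edge e \<and> s = place e" if s: "s \<in> segments_of \<B>" for s
  proof -
    obtain xs where xs: "xs \<in> \<B>" "s \<in> set xs" using s by (auto simp: segments_of_def)
    then obtain A m where "A \<in> \<C>" "\<forall>j<length xs. xs ! j = A (m + int j)"
      using B unfolding bounded_below_def finite_subcurve_def by metis
    then obtain k where "s = A k" using xs(2) by (metis in_set_conv_nth)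
    then show ?thesis using C \<open>A \<in> \<C>\<close> unfolding models_def by metis
  qed
  have nxt: "\<exists>g. is_edge g \<and> D k = place g \<and> D (k + 1) = place (next_edge 1 0 \<tau>' g)" if "D \<in> \<D>" for D k
    using D that unfolding models_def by blast
  \<comment> \<open>The successor \<open>A (j + 1)\<close> may lie outside the pattern. This
    generality yields the clause on consecutive segments, where the argument goes back from
    \<open>\<D>\<close> to \<open>\<C>\<close>.\<close>
  have step: "D (k + 1) = t (A (j + 1))"
    if "A \<in> \<C>" "D \<in> \<D>" "A j \<in> segments_of \<B>" "D k = t (A j)" for A D j k
  proof -
    obtain e where e: "is_edge e" "A j = place e" "A (j + 1) = place (next_edge 1 0 \<tau> e)"
      using C \<open>A \<in> \<C>\<close> unfolding models_def by blast
    obtain g where g: "D k = place g" "D (k + 1) = place (next_edge 1 0 \<tau>' g)"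
      using nxt \<open>D \<in> \<D>\<close> by blast
    obtain a b where ab: "edge_end 1 0 e = (a, b)" by (cases "edge_end 1 0 e")
    have "e \<in> S" using that(3) e(2) by (simp add: S_def)
    then have "(a, b) \<in> edge_end 1 0 ` S" using ab by (metis imageI)
    then have "\<tau>' (a + V) (b + W) = \<tau> a b" using VW(2) by blast
    from translate_next [of V W e a b \<tau>' \<tau> g, OF VW(1) e(1) ab this] show ?thesis
      using that(4) e g by (simp add: t_def)
  qed
  have "bounded_below (translate_set (point (V, W) - org) \<B>) \<D>"
    unfolding bounded_below_def
  proof (intro conjI ballI allI impI)
    show "finite (translate_set (point (V, W) - org) \<B>)" using fin by (simp add: translate_set_def)
  next
    fix ys assume "ys \<in> translate_set (point (V, W) - org) \<B>"
    then obtain xs where xs: "xs \<in> \<B>" "ys = map t xs" by (auto simp: translate_set_def t_def)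
    obtain A m where A: "A \<in> \<C>" "xs \<noteq> []" "\<And>j. j < length xs \<Longrightarrow> xs ! j = A (m + int j)"
      using B xs(1) unfolding bounded_below_def finite_subcurve_def by metis
    have in_seg: "A (m + int j) \<in> segments_of \<B>" if "j < length xs" for j
      using xs(1) nth_mem [OF that] unfolding segments_of_def A(3) [OF that, symmetric] by blast
    obtain e where e: "is_edge e" "A (m + int 0) = place e" using seg in_seg A(2) by blast
    obtain x y c where xyc: "e = (x, y, c)" by (cases e)
    have "t (A (m + int 0)) = place (x + V, y + W, c)"
      unfolding e(2) xyc t_def by (rule translate_place [OF VW(1)])
    moreover have "is_edge (x + V, y + W, c)" using e(1) by (simp add: xyc)
    ultimately obtain D k where D: "D \<in> \<D>" "D k = t (A (m + int 0))" using assms(2) unfolding models_def by metis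
    have "D (k + int j) = t (A (m + int j))" if "j < length xs" for j
      using that
    proof (induction j)
      case 0
      then show ?case using D by simp
    next
      case (Suc j)
      then have "D (k + int j) = t (A (m + int j))" by simp
      from step [OF A(1) D(1) in_seg this] Suc(2) show ?case by (simp add: ac_simps)
    qed
    then have "finite_subcurve ys D"
      unfolding finite_subcurve_def using A(2,3) xs(2) by (intro conjI exI [of _ k]) auto
    then show "\<exists>D\<in>\<D>. finite_subcurve ys D" using D(1) by blast
  next
    fix D k assume D: "D \<in> \<D>"
      "D k \<in> segments_of (translate_set (point (V, W) - org) \<B>) \<and>
       D (k + 1) \<in> segments_of (translate_set (point (V, W) - org) \<B>)"
    moreover have "segments_of (translate_set (point (V, W) - org) \<B>) = t ` segments_of \<B>"
      by (auto simp: segments_of_def translate_set_def t_def)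
    ultimately obtain s s' where s: "s \<in> segments_of \<B>" "D k = t s" "s' \<in> segments_of \<B>" "D (k + 1) = t s'"
      by blast
    obtain e where e: "is_edge e" "s = place e" using seg s(1) by blast
    obtain A j where A: "A \<in> \<C>" "A j = s" using C e unfolding models_def by metis
    have "t (A (j + 1)) = t s'" using step [OF A(1) D(1), of j k] A(2) s by simp
    then have "A (j + 1) = s'" by (rule t_inj)
    then obtain xs i where xs: "xs \<in> \<B>" "Suc i < length xs" "xs ! i = s" "xs ! Suc i = s'"
      using B A s unfolding bounded_below_def by metis
    then show "\<exists>ys\<in>translate_set (point (V, W) - org) \<B>. \<exists>j. Suc j < length ys \<and> ys ! j = D k \<and> ys ! Suc j = D (k + 1)"
      by (intro bexI [of _ "map t xs"] exI [of _ i]) (auto simp: s translate_set_def t_def)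
  qed
  then show ?thesis by blast
qed

end

lemma dturn_indep: "(x, y) \<noteq> (0, 0) \<Longrightarrow> dturn s x y = dturn s' x y"
proof (induction s x y rule: dturn.induct)
  case (1 s x y)
  show ?case
  proof (cases "odd (x + y)")
    case False
    have "((x + y) div 2, (y - x) div 2) \<noteq> (0, 0)" 
    proof -
      obtain k where "x + y = 2 * k" using False by (metis evenE)
      then have y: "y = 2 * k - x" by simp
      show ?thesis using 1(2) by (auto simp: y)
    qed
    then have "dturn s ((x + y) div 2) ((y - x) div 2) = dturn s' ((x + y) div 2) ((y - x) div 2)"
      using 1 False by auto
    then show ?thesis using dturn_even False by metis
  qed (simp add: dturn_odd)
qed

lemma unit_quotient:
  assumes "\<epsilon> \<in> {1, -1, \<i>, -\<i>}" "\<delta> \<in> {1, -1, \<i>, -\<i>}"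
  shows "\<exists>q<4. \<i> ^ q * \<epsilon> = \<delta>"
proof -
  have "\<delta> / \<epsilon> \<in> {1, -1, \<i>, -\<i>}"
    using assms unfolding insert_iff empty_iff by (elim disjE; simp add: divide_simps)
  then consider "\<delta> / \<epsilon> = \<i> ^ 0" | "\<delta> / \<epsilon> = \<i> ^ 1" | "\<delta> / \<epsilon> = \<i> ^ 2" | "\<delta> / \<epsilon> = \<i> ^ 3"
    by (auto simp: power3_eq_cube)
  then obtain q :: nat where "q < 4" "\<delta> / \<epsilon> = \<i> ^ q"
  proof cases
    case 1 then show thesis by (intro that [of 0]) simp_all
  next
    case 2 then show thesis by (intro that [of 1]) simp_all
  next
    case 3 then show thesis by (intro that [of 2]) simp_all
  next
    case 4 then show thesis by (intro that [of 3]) simp_all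
  qed
  moreover have "\<epsilon> \<noteq> 0" using assms(1) by auto
  ultimately show ?thesis by (intro exI [of _ q]) (simp add: field_simps)
qed

section \<open>The signs of the given covering\<close>

context placement
begin

lemma rev_rotate_place:
  assumes "is_edge e"
  shows "rev_seg (rotate_seg org 1 (place e)) = place (reverse_edge e)"
proof -
  obtain x y c where e: "e = (x, y, c)" by (cases e)
  have c: "c = 1 \<or> c = -1" using assms by (simp add: e)
  show ?thesis
  proof (cases "even (x + y)")
    case True
    then have o: "odd (- y + (x + c))" using c by auto
    have r: "reverse_edge e = (- y, x + c, - c)" using True by (simp add: e)
    show ?thesis
      unfolding r unfolding e place_even [OF True] place_odd [OF o]
      by (simp add: rev_seg_def rotate_seg_def seg_end_def point_def complex_eq_iff algebra_simps)
  next
    case False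
    then have o: "even (- y - c + x)" using c by auto
    have r: "reverse_edge e = (- y - c, x, c)" using False by (simp add: e)
    show ?thesis
      unfolding r unfolding e place_odd [OF False] place_even [OF o]
      by (simp add: rev_seg_def rotate_seg_def seg_end_def point_def complex_eq_iff algebra_simps)
  qed
qed

text \<open>\<open>q\<close> turns the first segment into a horizontal grid edge leaving the centre;
  from there on, both sides have the turns \<open>a\<close>.\<close>

lemma place_dragon:
  assumes D: "curve_of {1..} a D" "fst (D 1) = org" "\<i> ^ q * snd (D 1) = u * of_int c"
    and a: "infty_folding a" "\<forall>n::nat. a (2 ^ n) = 1" and c: "c = 1 \<or> c = -1" and s: "s \<in> {1, -1}"
  shows "rotate_seg org q (D (int j + 1)) = place (orbit 1 0 (dturn s) (0, 0, c) (int j))"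
proof -
  interpret A: fold_grid 1 0 s by unfold_locales (use s in \<open>auto simp: signs_dturn\<close>)
  have e: "is_edge (0, 0, c)" using c by simp
  show ?thesis
  proof (induction j)
    case 0
    show ?case using D(2,3) by (simp add: rotate_seg_def place_def point_def complex_eq_iff)
  next
    case (Suc j)
    let ?e = "A.orb (0, 0, c) (int j)"
    have t: "A.turn_after ?e = a (int j + 1)" by (rule A.dragon_turns [OF a c])
    have st: "seg_end (D (int j + 1)) = fst (D (int j + 1 + 1))"
      "snd (D (int j + 1 + 1)) = \<i> powi a (int j + 1) * snd (D (int j + 1))"
      "a (int j + 1) \<in> {1, -1}"
      using D(1) unfolding curve_of_def by (smt (verit) atLeast_iff of_nat_0_le_iff)+
    have "place (A.orb (0, 0, c) (int (Suc j))) = place (A.nxt ?e)"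
      using A.orb_Suc [OF e, of "int j"] by (simp add: add.commute)
    also have "A.nxt ?e = turned 1 0 (a (int j + 1)) ?e"
      using t by (simp add: next_edge_def A.turn_after_def)
    also have "place \<dots> = (seg_end (place ?e), \<i> powi a (int j + 1) * snd (place ?e))"
      by (rule place_turned [OF A.is_edge_orb [OF e] st(3)])
    also have "\<dots> = rotate_seg org q (D (int j + 1 + 1))"
      unfolding Suc [symmetric] rotate_seg_def seg_end_def fst_conv snd_conv st(1) [symmetric, unfolded seg_end_def] st(2)
      by (simp add: algebra_simps)
    finally show ?case by (simp add: add.commute)
  qed
qed

end

text \<open>The four half curves fix all turns away from the centre, by \<open>dragon_cover\<close>.
  The sign \<open>s\<close> tells how they are joined at the centre, which \<open>D\<close> does not
  determine.\<close>

lemma given_covering_models: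
  assumes cov: "covering \<C>" and a: "infty_folding a" "\<forall>n::nat. a (2 ^ n) = 1"
    and D: "curve_of {1..} a D" and gen: "generated_by \<C> D"
  shows "\<exists>u org s. placement u org \<and> s \<in> {1, -1} \<and> placement.models u org (dturn s) \<C>"
proof -
  define org where "org = fst (D 1)"
  have segD: "is_segment (D 1)" using D by (auto simp: curve_of_def)
  obtain b where b: "\<And>z. z \<in> lattice \<Longrightarrow> segments_at \<C> z =
      (if even_point z = b then horizontal_out z else vertical_out z)"
    using cov unfolding covering_def well_oriented_def by blast
  \<comment> \<open>With this choice the segments leaving \<open>org\<close> are horizontal in grid
    coordinates.\<close>
  define u where "u = (if even_point org = b then 1 else \<i>)"
  interpret placement u org
    by unfold_locales (use segD in \<open>auto simp: u_def org_def is_segment_def\<close>)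
  have u1: "u = 1 \<longleftrightarrow> even_point org = b" by (auto simp: u_def complex_eq_iff)
  have at: "segments_at \<C> (point p) = place ` edges_at p" for p
  proof -
    obtain x y where p: "p = (x, y)" by (cases p)
    show ?thesis unfolding p b [OF point_lattice] place_edges_at even_point_iff u1 by auto
  qed
  have comp: "\<exists>a. curve_of UNIV a C" if "C \<in> \<C>" for C
    using cov that unfolding covering_def complete_curve_def by blast
  have seg: "\<exists>e. is_edge e \<and> C k = place e" if C: "C \<in> \<C>" for C k
  proof -
    have "fst (C k) \<in> lattice" using comp [OF C] unfolding curve_of_def is_segment_def by auto
    then obtain p where p: "fst (C k) = point p" using lattice_point by blast
    then have "C k \<in> segments_at \<C> (point p)" using C unfolding segments_at_def by blast
    then show ?thesis unfolding at using edges_at_iff by blast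
  qed
  have occ: "\<exists>C\<in>\<C>. \<exists>k. C k = place e" if e: "is_edge e" for e
  proof -
    have "e \<in> edges_at (edge_start e)" using e by (simp only: edges_at_iff) simp
    then have "place e \<in> segments_at \<C> (point (edge_start e))" unfolding at by blast
    then show ?thesis unfolding segments_at_def by fastforce
  qed
  have uniq: "C = C' \<and> k = k'" if h: "C \<in> \<C>" "C' \<in> \<C>" "C k = C' k'" for C C' k k'
  proof -
    obtain e where e: "is_edge e" "C k = place e" using seg [OF h(1)] by blast
    obtain z w where z: "z \<in> lattice" "w \<in> {1, \<i>}" "seg_supp (place e) = closed_segment z (z + w)"
      using edge_interval [OF e(1)] by blast
    have "\<exists>!p. fst p \<in> \<C> \<and> seg_supp (fst p (snd p)) = closed_segment z (z + w)"
      using cov z(1,2) unfolding covering_def by blast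
    moreover have "fst (C, k) \<in> \<C> \<and> seg_supp (fst (C, k) (snd (C, k))) = closed_segment z (z + w)"
      "fst (C', k') \<in> \<C> \<and> seg_supp (fst (C', k') (snd (C', k'))) = closed_segment z (z + w)"
      using h e z(3) by simp_all
    ultimately have "(C, k) = (C', k')" by blast
    then show ?thesis by simp
  qed
  have turn: "\<exists>r\<in>{1, -1}. C (k + 1) = place (turned 1 0 r e)" if h: "C \<in> \<C>" "is_edge e" "C k = place e" for C k e
  proof -
    obtain \<alpha> where "curve_of UNIV \<alpha> C" using comp [OF h(1)] by blast
    then have r: "\<alpha> k \<in> {1, -1}" "seg_end (C k) = fst (C (k + 1))" "snd (C (k + 1)) = \<i> powi \<alpha> k * snd (C k)"
      unfolding curve_of_def by auto
    have "C (k + 1) = place (turned 1 0 (\<alpha> k) e)"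
      unfolding place_turned [OF h(2) r(1)] using r(2,3) h(3) by (simp add: prod_eq_iff)
    then show ?thesis using r(1) by blast
  qed
  have gen': "\<exists>C\<in>\<C>. half_subcurve (\<lambda>k. rotate_seg org q (D k)) C" if "q < 4" for q
    using gen that unfolding generated_by_def org_def by blast
  have eps: "snd (D 1) \<in> {1, -1, \<i>, -\<i>}" using segD by (simp add: is_segment_def)
  have units: "u * of_int c \<in> {1, -1, \<i>, -\<i>}" "\<i> * (u * of_int c) \<in> {1, -1, \<i>, -\<i>}" if "c = 1 \<or> c = -1" for c :: int
    using unit that by auto
  \<comment> \<open>The two horizontal copies run forward: reversed, they would reach the centre
    horizontally, against the orientation convention.\<close>
  have fwd: "\<exists>C\<in>\<C>. \<exists>m. \<forall>j. C (m + int j) = place (dragon.orb (0, 0, c) (int j))" if c: "c = 1 \<or> c = -1" for c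
  proof -
    obtain q where q: "q < 4" "\<i> ^ q * snd (D 1) = u * of_int c"
      using unit_quotient [OF eps units(1) [OF c]] by blast
    have *: "rotate_seg org q (D (int j + 1)) = place (dragon.orb (0, 0, c) (int j))" for j
      using place_dragon [OF D _ q(2) a c, of 1] by (simp add: org_def)
    obtain C where C: "C \<in> \<C>" "half_subcurve (\<lambda>k. rotate_seg org q (D k)) C" using gen' q(1) by blast
    from C(2) consider m where "\<forall>k\<ge>1. C (m + k) = rotate_seg org q (D k)"
      | m where "\<forall>k\<ge>1. C (m - k) = rev_seg (rotate_seg org q (D k))"
      unfolding half_subcurve_def by blast
    then show ?thesis
    proof cases
      case 1
      have "C (m + 1 + int j) = place (dragon.orb (0, 0, c) (int j))" for j
        using 1 [rule_format, of "int j + 1"] * [of j] by (simp add: ac_simps)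
      then show ?thesis using C(1) by blast
    next
      case 2
      have "C (m - 1) = rev_seg (place (0, 0, c))" using 2 * [of 0] by simp
      moreover obtain f where f: "is_edge f" "C (m - 1) = place f" using seg C(1) by blast
      ultimately have f': "place f = rev_seg (place (0, 0, c))" by simp
      have "point (edge_start f) = point (c, 0)"
        using arg_cong [OF f', of fst] by (simp add: fst_place rev_seg_def seg_end_place)
      then obtain d where d: "f = (c, 0, d)" by (cases f) (auto simp: point_inj)
      have "snd (place f) = - (u * of_int c)" by (simp add: f' rev_seg_def snd_place)
      moreover have "snd (place f) = u * (of_int d * \<i>)" using c by (auto simp: d snd_place)
      ultimately have "of_int d * \<i> = (- of_int c :: complex)" using u_nz
        by (metis mult_cancel_left mult_minus_right)
      then show ?thesis using c by (auto simp: complex_eq_iff)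
    qed
  qed
  \<comment> \<open>Likewise the two vertical copies run backward. They are quarter turns of the
    horizontal ones, so \<open>reverse_orbit\<close> describes them as the backward orbits of the
    edges entering the centre.\<close>
  have bwd: "\<exists>C\<in>\<C>. \<exists>m. \<forall>j. C (m - int j) = place (dragon.orb (0, c, - c) (- int j))" if c: "c = 1 \<or> c = -1" for c
  proof -
    obtain q where q: "q < 4" "\<i> ^ q * snd (D 1) = u * of_int c"
      using unit_quotient [OF eps units(1) [OF c]] by blast
    obtain q' where q': "q' < 4" "\<i> ^ q' * snd (D 1) = \<i> * (u * of_int c)"
      using unit_quotient [OF eps units(2) [OF c]] by blast
    have ii: "\<i> ^ q' = \<i> * \<i> ^ q"
    proof -
      have "\<i> ^ q' * snd (D 1) = \<i> * \<i> ^ q * snd (D 1)" using q(2) q'(2) by simp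
      moreover have "snd (D 1) \<noteq> 0" using eps by auto
      ultimately show ?thesis by simp
    qed
    have rot: "rotate_seg org q' s = rotate_seg org 1 (rotate_seg org q s)" for s
      by (simp add: rotate_seg_def ii)
    have *: "rev_seg (rotate_seg org q' (D (int j + 1))) = place (dragon.orb (0, c, - c) (- int j))" for j
    proof -
      \<comment> \<open>The sign -1 at the centre becomes 1 under the reversal.\<close>
      let ?e = "orbit 1 0 (dturn (- 1)) (0, 0, c) (int j)"
      interpret A: fold_grid 1 0 "- 1" by unfold_locales (auto simp: signs_dturn)
      have ie: "is_edge ?e" using c by (intro A.is_edge_orb) simp
      have "rotate_seg org q (D (int j + 1)) = place ?e"
        using place_dragon [OF D _ q(2) a c, of "- 1"] by (simp add: org_def)
      then have "rev_seg (rotate_seg org q' (D (int j + 1))) = place (reverse_edge ?e)"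
        unfolding rot using rev_rotate_place [OF ie] by simp
      also have "reverse_edge ?e = orbit 1 0 (dturn (- (- 1))) (reverse_edge (0, 0, c)) (- int j)"
        using c by (intro reverse_orbit) auto
      finally show ?thesis by simp
    qed
    obtain C where C: "C \<in> \<C>" "half_subcurve (\<lambda>k. rotate_seg org q' (D k)) C" using gen' q'(1) by blast
    from C(2) consider m where "\<forall>k\<ge>1. C (m + k) = rotate_seg org q' (D k)"
      | m where "\<forall>k\<ge>1. C (m - k) = rev_seg (rotate_seg org q' (D k))"
      unfolding half_subcurve_def by blast
    then show ?thesis
    proof cases
      case 1
      obtain f where f: "is_edge f" "C (m + 1) = place f" using seg C(1) by blast
      have f': "place f = rotate_seg org q' (D 1)" using 1 f(2) by simp
      have "point (0, 0) = org" by (simp add: point_def complex_eq_iff)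
      moreover have "fst (rotate_seg org q' (D 1)) = org" by (simp add: rotate_seg_def flip: org_def)
      ultimately have "point (edge_start f) = point (0, 0)"
        using arg_cong [OF f', of fst] fst_place by metis
      then obtain d where d: "f = (0, 0, d)" by (cases f) (auto simp: point_inj)
      have "snd (place f) = u * (\<i> * of_int c)" by (simp add: f' rotate_seg_def q'(2))
      moreover have "snd (place f) = u * of_int d" by (simp add: d snd_place)
      ultimately have "of_int d = (\<i> * of_int c :: complex)" using u_nz
        by (metis mult_cancel_left)
      then show ?thesis using c by (auto simp: complex_eq_iff)
    next
      case 2
      have "C (m - 1 - int j) = place (dragon.orb (0, c, - c) (- int j))" for j
        using 2 [rule_format, of "int j + 1"] * [of j] by (simp add: algebra_simps)
      then show ?thesis using C(1) by blast
    qed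
  qed
  have ends0: "e = (0, 1, -1) \<or> e = (0, -1, 1)" if "is_edge e" "edge_end 1 0 e = (0, 0)" for e
  proof -
    have "e \<in> edges_at (0, 0)" using that edges_at_iff by blast
    then show ?thesis using that(2) by auto
  qed
  obtain C0 k0 where C0: "C0 \<in> \<C>" "C0 k0 = place (0, 1, -1)" using occ [of "(0, 1, -1)"] by auto
  \<comment> \<open>The turn after one of the two edges entering the centre defines
    \<open>s\<close>.\<close>
  obtain s where s: "s \<in> {1, -1}" "C0 (k0 + 1) = place (turned 1 0 s (0, 1, -1))"
    using turn [OF C0(1) _ C0(2)] by auto
  have main: "C (k + 1) = place (next_edge 1 0 (dturn s) e)" if h: "C \<in> \<C>" "is_edge e" "C k = place e" for C k e
  proof (cases "edge_end 1 0 e = (0, 0)")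
    case True
    then have n: "next_edge 1 0 (dturn s) e = turned 1 0 s e" by (simp add: next_edge_def)
    from ends0 [OF h(2) True] show ?thesis
    proof
      assume "e = (0, 1, -1)"
      then have "C = C0 \<and> k = k0" using uniq [OF h(1) C0(1), of k k0] h(3) C0(2) by simp
      then show ?thesis unfolding n using s(2) \<open>e = (0, 1, -1)\<close> by simp
    next
      assume e: "e = (0, -1, 1)"
      obtain r where r: "r \<in> {1, -1}" "C (k + 1) = place (turned 1 0 r e)" using turn [OF h] by blast
      show ?thesis
      proof (cases "r = s")
        \<comment> \<open>With different turns, both entering edges would be followed by the same
          segment.\<close>
        case False
        then have "r = - s" using r(1) s(1) by auto
        then have "C (k + 1) = C0 (k0 + 1)" using r(2) s(2) by (simp add: e)
        then have "C = C0 \<and> k = k0" using uniq [OF h(1) C0(1), of "k + 1" "k0 + 1"] by simp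
        then have "e = (0, 1, -1)" using h(3) C0(2) place_inj by simp
        then show ?thesis using e by simp
      qed (use r n in simp)
    qed
  next
    case False
    have n: "next_edge 1 0 (dturn s) e = dragon.nxt e"
      using dturn_indep [of _ _ s 1] False by (cases "edge_end 1 0 e") (simp add: next_edge_def)
    obtain c j where cj: "c = 1 \<or> c = -1" "dragon.orb (0, 0, c) j = e" using dragon_cover [OF h(2)] by auto
    have ic: "is_edge (0, 0, c)" using cj(1) by simp
    show ?thesis
    proof (cases "j \<ge> 0")
      case True
      obtain C' m where C': "C' \<in> \<C>" "\<And>j. C' (m + int j) = place (dragon.orb (0, 0, c) (int j))"
        using fwd [OF cj(1)] by blast
      have "C' (m + j) = place e" using C'(2) [of "nat j"] True cj(2) by simp
      then have eq: "C = C'" "k = m + j" using uniq [OF h(1) C'(1), of k "m + j"] h(3) by simp_all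
      have "C' (m + (j + 1)) = place (dragon.orb (0, 0, c) (j + 1))" using C'(2) [of "nat (j + 1)"] True by simp
      then show ?thesis unfolding n using dragon.orb_Suc [OF ic, of j] cj(2) eq by (simp add: ac_simps)
    next
      case neg: False
      \<comment> \<open>\<open>f\<close> is the edge through which this curve enters the centre;
        \<open>e\<close> lies before it, on a copy that runs backward.\<close>
      define f where "f = dragon.orb (0, 0, c) (-1)"
      have f: "is_edge f" "dragon.nxt f = (0, 0, c)"
        using dragon.orb_Suc [OF ic, of "-1"] dragon.is_edge_orb [OF ic] by (auto simp: f_def)
      have f0: "edge_end 1 0 f = (0, 0)"
        using f(2) by (cases f) (auto simp: next_edge_def split: if_splits)
      obtain d where d: "d = 1 \<or> d = -1" "f = (0, d, - d)"
        using ends0 [OF f(1) f0]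
      proof
        assume "f = (0, 1, -1)" then show thesis by (intro that [of 1]) simp_all
      next
        assume "f = (0, -1, 1)" then show thesis by (intro that [of "-1"]) simp_all
      qed
      define i where "i = nat (- (j + 1))"
      have i: "j + 1 = - int i" using neg by (simp add: i_def)
      have e: "dragon.orb f (- int i) = e"
      proof -
        have "dragon.orb (0, 0, c) (-1 + (j + 1)) = dragon.orb f (j + 1)"
          unfolding f_def by (rule dragon.orb_add [OF ic])
        then show ?thesis using cj(2) unfolding i by (simp flip: i)
      qed
      obtain C' m where C': "C' \<in> \<C>" "\<And>j. C' (m - int j) = place (dragon.orb f (- int j))"
        using bwd [OF d(1)] d(2) by blast
      have "i \<noteq> 0"
      proof
        assume "i = 0"
        then have "f = e" using e by simp
        then show False using False f0 by simp
      qed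
      then obtain i' where i': "i = Suc i'" by (cases i) auto
      have "C' (m - int i) = place e" using C'(2) [of i] e by simp
      then have eq: "C = C'" "k = m - int i" using uniq [OF h(1) C'(1), of k "m - int i"] h(3) by simp_all
      have "C (k + 1) = place (dragon.orb f (- int i'))" using C'(2) [of i'] by (simp add: eq i')
      also have "dragon.orb f (- int i') = dragon.nxt e"
        using dragon.orb_Suc [OF f(1), of "- int i"] e by (simp add: i')
      finally show ?thesis unfolding n .
    qed
  qed
  have "models (dturn s) \<C>"
    unfolding models_def using seg main occ by blast
  then show ?thesis using placement_axioms s(1) by blast
qed

subsection \<open>Rounded curves\<close>

lemma int_near: "\<bar>real_of_int x - real_of_int y\<bar> < 1 \<Longrightarrow> x = y"
  by linarith

text \<open>Each piece stays close to its index, so a convergent sequence eventually meets only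
  finitely many pieces.\<close>

lemma closed_UN_locally_finite:
  fixes S :: "int \<times> int \<Rightarrow> complex set"
  assumes closed: "\<And>p. closed (S p)"
    and near: "\<And>i j w. w \<in> S (i, j) \<Longrightarrow> \<bar>Re w - of_int i\<bar> \<le> 1 \<and> \<bar>Im w - of_int j\<bar> \<le> 1"
  shows "closed (\<Union>p\<in>I. S p)"
  unfolding closed_sequential_limits
proof (intro allI impI)
  fix x l assume x: "(\<forall>n. x n \<in> (\<Union>p\<in>I. S p)) \<and> x \<longlonglongrightarrow> l"
  define K where "K = {\<lfloor>Re l\<rfloor> - 3..\<lfloor>Re l\<rfloor> + 3} \<times> {\<lfloor>Im l\<rfloor> - 3..\<lfloor>Im l\<rfloor> + 3}"
  have "closed (\<Union>p\<in>I \<inter> K. S p)" using closed by (intro closed_UN) (auto simp: K_def)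
  moreover have "\<forall>\<^sub>F n in sequentially. x n \<in> (\<Union>p\<in>I \<inter> K. S p)"
  proof -
    have "\<forall>\<^sub>F n in sequentially. dist (x n) l < 1" using x by (intro tendstoD) auto
    then show ?thesis
    proof eventually_elim
      case (elim n)
      obtain i j where ij: "(i, j) \<in> I" "x n \<in> S (i, j)" using x by force
      have "\<bar>Re (x n) - Re l\<bar> < 1" "\<bar>Im (x n) - Im l\<bar> < 1"
        using elim abs_Re_le_cmod [of "x n - l"] abs_Im_le_cmod [of "x n - l"] by (auto simp: dist_norm)
      moreover have "\<bar>Re (x n) - of_int i\<bar> \<le> 1" "\<bar>Im (x n) - of_int j\<bar> \<le> 1" using near ij(2) by auto
      ultimately have "\<bar>Re l - of_int i\<bar> < 2" "\<bar>Im l - of_int j\<bar> < 2" by linarith+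
      then have "(i, j) \<in> K" unfolding K_def by (auto; linarith)
      then show ?case using ij by blast
    qed
  qed
  ultimately show "l \<in> (\<Union>p\<in>I. S p)"
    using Lim_in_closed_set [of "\<Union>p\<in>I \<inter> K. S p" x sequentially l] x by fastforce
qed

text \<open>Each unit square minus four concave corners, and the concave diamond around each vertex.
  The rounded curves only run along the boundaries of these pieces.\<close>

abbreviation corner_dist :: "int \<Rightarrow> int \<Rightarrow> complex \<Rightarrow> real" where
  "corner_dist x y w \<equiv> (\<bar>Re w - of_int x\<bar> - 1/4)\<^sup>2 + (\<bar>Im w - of_int y\<bar> - 1/4)\<^sup>2"

abbreviation corner_point :: "int \<Rightarrow> int \<Rightarrow> int \<Rightarrow> int \<Rightarrow> real \<Rightarrow> real \<Rightarrow> complex" where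
  "corner_point x y a b s t \<equiv> Complex (of_int x + of_int a * ((1 - s) / 4)) (of_int y + of_int b * ((1 - t) / 4))"

definition diamond :: "int \<times> int \<Rightarrow> complex set" where
  "diamond = (\<lambda>(x, y). {w. \<bar>Re w - of_int x\<bar> \<le> 1/4 \<and> \<bar>Im w - of_int y\<bar> \<le> 1/4 \<and>
     corner_dist x y w \<ge> 1/16})"

text \<open>1/16 is the squared radius of the rounded corners. Weak inequalities make this set and
  the diamond both closed; they overlap in the four arcs.\<close>

definition off_diamond :: "int \<times> int \<Rightarrow> complex set" where
  "off_diamond = (\<lambda>(x, y). {w. \<bar>Re w - of_int x\<bar> \<ge> 1/4 \<or> \<bar>Im w - of_int y\<bar> \<ge> 1/4 \<or>
     corner_dist x y w \<le> 1/16})"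

definition square_core :: "int \<times> int \<Rightarrow> complex set" where
  "square_core = (\<lambda>(i, j). {w. of_int i \<le> Re w \<and> Re w \<le> of_int i + 1 \<and> of_int j \<le> Im w \<and> Im w \<le> of_int j + 1}
     \<inter> (\<Inter>p. off_diamond p))"

lemma closed_diamond: "closed (diamond p)"
  unfolding diamond_def by (cases p) (auto intro!: closed_Collect_conj closed_Collect_le continuous_intros)

lemma closed_square_core: "closed (square_core p)"
proof -
  have "closed (off_diamond q)" for q
    unfolding off_diamond_def by (cases q) (auto intro!: closed_Collect_disj closed_Collect_le continuous_intros)
  then show ?thesis
    unfolding square_core_def by (cases p) (auto intro!: closed_Int closed_INT closed_Collect_conj closed_Collect_le continuous_intros)
qed

definition hmid :: "int \<times> int \<Rightarrow> complex set" where
  "hmid = (\<lambda>(i, j). {w. Im w = of_int j \<and> of_int i + 1/4 \<le> Re w \<and> Re w \<le> of_int i + 3/4})"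

definition vmid :: "int \<times> int \<Rightarrow> complex set" where
  "vmid = (\<lambda>(i, j). {w. Re w = of_int i \<and> of_int j + 1/4 \<le> Im w \<and> Im w \<le> of_int j + 3/4})"

text \<open>The rounded corner in the quadrant of signs \<open>a\<close>, \<open>b\<close>, given by
  its equation.\<close>

definition quarter :: "int \<Rightarrow> int \<Rightarrow> int \<Rightarrow> int \<Rightarrow> complex set" where
  "quarter x y a b = {w. \<exists>\<xi> \<eta>. w = Complex (of_int x + of_int a * \<xi>) (of_int y + of_int b * \<eta>) \<and>
     0 \<le> \<xi> \<and> \<xi> \<le> 1/4 \<and> 0 \<le> \<eta> \<and> \<eta> \<le> 1/4 \<and> (\<xi> - 1/4)\<^sup>2 + (\<eta> - 1/4)\<^sup>2 = 1/16}"

lemma quarter_cases: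
  assumes "w \<in> quarter x y a b" "a \<in> {1, -1}" "b \<in> {1, -1}"
  shows "\<bar>Re w - of_int x\<bar> \<le> 1/4" "\<bar>Im w - of_int y\<bar> \<le> 1/4"
    "corner_dist x y w = 1/16"
    "Re w = of_int x + of_int a * \<bar>Re w - of_int x\<bar>" "Im w = of_int y + of_int b * \<bar>Im w - of_int y\<bar>"
proof -
  obtain \<xi> \<eta> where w: "w = Complex (of_int x + of_int a * \<xi>) (of_int y + of_int b * \<eta>)"
     "0 \<le> \<xi>" "\<xi> \<le> 1/4" "0 \<le> \<eta>" "\<eta> \<le> 1/4" "(\<xi> - 1/4)\<^sup>2 + (\<eta> - 1/4)\<^sup>2 = 1/16"
    using assms(1) unfolding quarter_def by blast
  have "\<bar>Re w - of_int x\<bar> = \<xi>" "\<bar>Im w - of_int y\<bar> = \<eta>" using w(1,2,4) assms(2,3) by (auto simp: abs_mult)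
  with w show "\<bar>Re w - of_int x\<bar> \<le> 1/4" "\<bar>Im w - of_int y\<bar> \<le> 1/4"
    "corner_dist x y w = 1/16"
    "Re w = of_int x + of_int a * \<bar>Re w - of_int x\<bar>" "Im w = of_int y + of_int b * \<bar>Im w - of_int y\<bar>"
    by simp_all
qed

lemma quarterI:
  assumes "\<bar>Re w - of_int x\<bar> \<le> 1/4" "\<bar>Im w - of_int y\<bar> \<le> 1/4"
    "corner_dist x y w = 1/16"
    "Re w = of_int x + of_int a * \<bar>Re w - of_int x\<bar>" "Im w = of_int y + of_int b * \<bar>Im w - of_int y\<bar>"
  shows "w \<in> quarter x y a b"
  unfolding quarter_def
  by (intro CollectI exI [of _ "\<bar>Re w - of_int x\<bar>"] exI [of _ "\<bar>Im w - of_int y\<bar>"])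
    (use assms in \<open>auto simp: complex_eq_iff\<close>)

text \<open>The first form fits corners reached along a horizontal edge, the second those reached
  along a vertical one.\<close>

lemma quarter_param:
  assumes "a \<in> {1, -1}" "b \<in> {1, -1}"
  shows "quarter x y a b = (\<lambda>\<theta>. corner_point x y a b (cos \<theta>) (sin \<theta>)) ` {0..pi/2}"
    and "quarter x y a b = (\<lambda>\<theta>. corner_point x y a b (sin \<theta>) (cos \<theta>)) ` {0..pi/2}"
proof -
  have cs: "(((1 - cos \<theta>) / 4) - 1/4)\<^sup>2 + (((1 - sin \<theta>) / 4) - 1/4)\<^sup>2 = 1/16" for \<theta> :: real
    using sin_cos_squared_add [of \<theta>] by (simp add: power2_eq_square field_simps)
  have rng: "0 \<le> (1 - cos \<theta>) / 4" "(1 - cos \<theta>) / 4 \<le> 1/4" "0 \<le> (1 - sin \<theta>) / 4" "(1 - sin \<theta>) / 4 \<le> 1/4"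
    if "\<theta> \<in> {0..pi/2}" for \<theta> :: real
  proof -
    have "0 \<le> cos \<theta>" "0 \<le> sin \<theta>" using that by (auto intro: cos_ge_zero sin_ge_zero)
    then show "0 \<le> (1 - cos \<theta>) / 4" "(1 - cos \<theta>) / 4 \<le> 1/4" "0 \<le> (1 - sin \<theta>) / 4" "(1 - sin \<theta>) / 4 \<le> 1/4"
      using cos_le_one [of \<theta>] sin_le_one [of \<theta>] by simp_all
  qed
  have ex: "\<exists>\<theta>\<in>{0..pi/2}. \<xi> = (1 - cos \<theta>) / 4 \<and> \<eta> = (1 - sin \<theta>) / 4"
    if h: "\<xi> \<le> 1/4" "\<eta> \<le> 1/4" "(\<xi> - 1/4)\<^sup>2 + (\<eta> - 1/4)\<^sup>2 = 1/16" for \<xi> \<eta> :: real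
  proof -
    have "0 \<le> 1 - 4 * \<xi>" "0 \<le> 1 - 4 * \<eta>" using h by linarith+
    moreover have "(1 - 4 * \<xi>)\<^sup>2 + (1 - 4 * \<eta>)\<^sup>2 = 1" using h(3) by (simp add: power2_eq_square field_simps)
    ultimately obtain \<theta> where "0 \<le> \<theta>" "\<theta> \<le> pi/2" "1 - 4 * \<xi> = cos \<theta>" "1 - 4 * \<eta> = sin \<theta>"
      using sincos_total_pi_half by metis
    then show ?thesis by (intro bexI [of _ \<theta>]) (auto simp: field_simps)
  qed
  show "quarter x y a b = (\<lambda>\<theta>. corner_point x y a b (cos \<theta>) (sin \<theta>)) ` {0..pi/2}" (is "_ = ?R")
  proof
    show "quarter x y a b \<subseteq> ?R"
    proof
      fix w assume "w \<in> quarter x y a b"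
      then obtain \<xi> \<eta> where w: "w = Complex (of_int x + of_int a * \<xi>) (of_int y + of_int b * \<eta>)"
        "\<xi> \<le> 1/4" "\<eta> \<le> 1/4" "(\<xi> - 1/4)\<^sup>2 + (\<eta> - 1/4)\<^sup>2 = 1/16" unfolding quarter_def by blast
      from ex [OF w(2-4)] show "w \<in> ?R" using w(1) by blast
    qed
    show "?R \<subseteq> quarter x y a b" unfolding quarter_def using rng cs by blast
  qed
  then have "quarter x y a b = (\<lambda>\<theta>. corner_point x y a b (cos \<theta>) (sin \<theta>)) ` ((-) (pi/2) ` {0..pi/2})"
    by simp
  then show "quarter x y a b = (\<lambda>\<theta>. corner_point x y a b (sin \<theta>) (cos \<theta>)) ` {0..pi/2}"
    by (simp only: image_image sin_diff cos_diff) simp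
qed

text \<open>The edges around a vertex and around a square, regardless of their orientation.\<close>

definition hor :: "int \<Rightarrow> int \<Rightarrow> edge" where
  "hor i j = (if even (i + j) then (i, j, 1) else (i + 1, j, -1))"

definition ver :: "int \<Rightarrow> int \<Rightarrow> edge" where
  "ver i j = (if odd (i + j) then (i, j, 1) else (i, j + 1, -1))"

definition hor_at :: "int \<Rightarrow> int \<Rightarrow> int \<Rightarrow> edge" where
  "hor_at x y a = (if even (x + y) then (x, y, a) else (x + a, y, - a))"

definition ver_at :: "int \<Rightarrow> int \<Rightarrow> int \<Rightarrow> edge" where
  "ver_at x y b = (if even (x + y) then (x, y + b, - b) else (x, y, b))"

lemma hor_at_eq: "hor_at x y 1 = hor x y" "hor_at x y (-1) = hor (x - 1) y"
  by (auto simp: hor_at_def hor_def)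

lemma ver_at_eq: "ver_at x y 1 = ver x y" "ver_at x y (-1) = ver x (y - 1)"
  by (auto simp: ver_at_def ver_def)

lemma is_edge_hor: "is_edge (hor i j)" and is_edge_ver: "is_edge (ver i j)"
  by (auto simp: hor_def ver_def)

lemma edge_hor_ver:
  assumes "is_edge e"
  obtains i j where "e = hor i j" | i j where "e = ver i j"
proof -
  obtain x y c where e: "e = (x, y, c)" by (cases e)
  have c: "c = 1 \<or> c = -1" using assms by (simp add: e)
  show thesis
  proof (cases "even (x + y)")
    case True
    then have "e = hor_at x y c" by (simp add: e hor_at_def)
    then show thesis using c that(1) hor_at_eq by metis
  next
    case False
    then have "e = ver_at x y c" by (simp add: e ver_at_def)
    then show thesis using c that(2) ver_at_eq by metis
  qed
qed

text \<open>The sides of an even square run counterclockwise and those of an odd square clockwise,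
  so turning always to the same side visits all of them.\<close>

lemma square_sides:
  assumes "e \<in> {hor i j, hor i (j + 1), ver i j, ver (i + 1) j}"
    and r: "r = (if even (i + j) then 1 else -1)"
  shows "\<exists>k. (turned 1 0 r ^^ k) (hor i j) = e" "\<exists>k. (turned 1 0 r ^^ k) e = hor i j"
proof -
  let ?t = "turned 1 0 r"
  define a where "a = (if even (i + j) then ver (i + 1) j else ver i j)"
  define b where "b = (if even (i + j) then ver i j else ver (i + 1) j)"
  have 1: "?t (hor i j) = a" "?t a = hor i (j + 1)" "?t (hor i (j + 1)) = b" "?t b = hor i j"
    by (auto simp: a_def b_def r hor_def ver_def)
  have p: "(?t ^^ 0) z = z" "(?t ^^ 1) z = ?t z" "(?t ^^ 2) z = ?t (?t z)" "(?t ^^ 3) z = ?t (?t (?t z))" for z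
    by (simp_all add: numeral_eq_Suc)
  have e: "e = hor i j \<or> e = a \<or> e = hor i (j + 1) \<or> e = b" using assms(1) by (auto simp: a_def b_def)
  show "\<exists>k. (?t ^^ k) (hor i j) = e"
    using e p [of "hor i j"] 1 by metis
  show "\<exists>k. (?t ^^ k) e = hor i j"
    using e p [of e] 1 by metis
qed

text \<open>Squares are named by their lower left corners; this gives one coordinate of the square
  in a given quadrant at a vertex.\<close>

definition face_index :: "int \<Rightarrow> int \<Rightarrow> int" where
  "face_index x a = (if a = 1 then x else x - 1)"

lemma core_hmid:
  assumes "w \<in> square_core (i, j)" "Im w = of_int k"
  shows "w \<in> hmid (i, k)"
proof -
  have "w \<in> off_diamond (i, k)" "w \<in> off_diamond (i + 1, k)" "of_int i \<le> Re w" "Re w \<le> of_int i + 1"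
    using assms(1) by (auto simp: square_core_def)
  then have "\<bar>Re w - of_int i\<bar> \<ge> 1/4 \<or> (\<bar>Re w - of_int i\<bar> - 1/4)\<^sup>2 \<le> 0"
    "\<bar>Re w - of_int (i + 1)\<bar> \<ge> 1/4 \<or> (\<bar>Re w - of_int (i + 1)\<bar> - 1/4)\<^sup>2 \<le> 0"
    using assms(2) by (auto simp: off_diamond_def power2_eq_square)
  then have "\<bar>Re w - of_int i\<bar> \<ge> 1/4" "\<bar>Re w - of_int (i + 1)\<bar> \<ge> 1/4" by auto
  with \<open>of_int i \<le> Re w\<close> \<open>Re w \<le> of_int i + 1\<close> assms(2) show ?thesis by (auto simp: hmid_def)
qed

lemma core_vmid:
  assumes "w \<in> square_core (i, j)" "Re w = of_int k"
  shows "w \<in> vmid (k, j)"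
proof -
  have "w \<in> off_diamond (k, j)" "w \<in> off_diamond (k, j + 1)" "of_int j \<le> Im w" "Im w \<le> of_int j + 1"
    using assms(1) by (auto simp: square_core_def)
  then have "\<bar>Im w - of_int j\<bar> \<ge> 1/4 \<or> (\<bar>Im w - of_int j\<bar> - 1/4)\<^sup>2 \<le> 0"
    "\<bar>Im w - of_int (j + 1)\<bar> \<ge> 1/4 \<or> (\<bar>Im w - of_int (j + 1)\<bar> - 1/4)\<^sup>2 \<le> 0"
    using assms(2) by (auto simp: off_diamond_def power2_eq_square)
  then have "\<bar>Im w - of_int j\<bar> \<ge> 1/4" "\<bar>Im w - of_int (j + 1)\<bar> \<ge> 1/4" by auto
  with \<open>of_int j \<le> Im w\<close> \<open>Im w \<le> of_int j + 1\<close> assms(2) show ?thesis by (auto simp: vmid_def)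
qed

lemma quarter_dist:
  assumes "\<bar>t - of_int x\<bar> \<le> (1/4::real)" "x' \<noteq> x"
  shows "1/4 \<le> \<bar>t - of_int x'\<bar>"
proof -
  have "\<bar>real_of_int x - of_int x'\<bar> \<ge> 1" using assms(2) by linarith
  then show ?thesis using assms(1) by linarith
qed

lemma mid_dist:
  assumes "of_int i + 1/4 \<le> t" "t \<le> of_int i + (3/4::real)"
  shows "1/4 \<le> \<bar>t - of_int x'\<bar>"
proof (cases "x' \<le> i")
  case True
  then have "real_of_int x' \<le> of_int i" by simp
  then show ?thesis using assms by linarith
next
  case False
  then have "real_of_int x' \<ge> of_int i + 1" by linarith
  then show ?thesis using assms by linarith
qed

lemma hmid_core: "hmid (i, j) \<subseteq> square_core (i, j)"
  using mid_dist by (auto simp: hmid_def square_core_def off_diamond_def)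

lemma vmid_core: "vmid (i, j) \<subseteq> square_core (i, j)"
  using mid_dist by (auto simp: vmid_def square_core_def off_diamond_def)

lemma quarter_core:
  assumes "a \<in> {1, -1}" "b \<in> {1, -1}"
  shows "quarter x y a b \<subseteq> square_core (face_index x a, face_index y b)"
proof
  fix w assume w: "w \<in> quarter x y a b"
  note c = quarter_cases [OF w assms]
  have "w \<in> off_diamond p" for p
  proof -
    obtain x' y' where p: "p = (x', y')" by (cases p)
    show ?thesis
      using quarter_dist [OF c(1), of x'] quarter_dist [OF c(2), of y'] c(3)
      by (cases "x' = x \<and> y' = y") (auto simp: p off_diamond_def)
  qed
  moreover have "of_int (face_index x a) \<le> Re w \<and> Re w \<le> of_int (face_index x a) + 1"
    using c(1,4) assms(1) by (auto simp: face_index_def)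
  moreover have "of_int (face_index y b) \<le> Im w \<and> Im w \<le> of_int (face_index y b) + 1"
    using c(2,5) assms(2) by (auto simp: face_index_def)
  ultimately show "w \<in> square_core (face_index x a, face_index y b)" by (auto simp: square_core_def)
qed

text \<open>The opposite weak inequalities that define the two sets force equality, which is the
  equation of an arc.\<close>

lemma core_diamond:
  assumes "w \<in> square_core (i, j)" "w \<in> diamond (x, y)"
  obtains a b where "a \<in> {1, -1}" "b \<in> {1, -1}" "i = face_index x a" "j = face_index y b" "w \<in> quarter x y a b"
proof -
  have r: "of_int i \<le> Re w" "Re w \<le> of_int i + 1" "of_int j \<le> Im w" "Im w \<le> of_int j + 1"
    and o: "w \<in> off_diamond (x, y)" using assms(1) by (auto simp: square_core_def)
  have d: "\<bar>Re w - of_int x\<bar> \<le> 1/4" "\<bar>Im w - of_int y\<bar> \<le> 1/4"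
    "corner_dist x y w \<ge> 1/16"
    using assms(2) by (auto simp: diamond_def)
  have x: "x = i \<or> x = i + 1" and y: "y = j \<or> y = j + 1" using r d by linarith+
  define a b :: int where "a = (if x = i then 1 else -1)" and "b = (if y = j then 1 else -1)"
  have sq: "(t - 1/4)\<^sup>2 \<le> (1/16::real)" if "0 \<le> t" "t \<le> 1/4" for t :: real
  proof -
    have "(1/4 - t)\<^sup>2 \<le> (1/4)\<^sup>2" using that by (intro power_mono) auto
    moreover have "(t - 1/4)\<^sup>2 = (1/4 - t)\<^sup>2" by (rule power2_commute)
    ultimately show ?thesis by (simp add: power_divide)
  qed
  have "corner_dist x y w \<le> 1/16"
  proof -
    consider "\<bar>Re w - of_int x\<bar> = 1/4" | "\<bar>Im w - of_int y\<bar> = 1/4"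
      | "corner_dist x y w \<le> 1/16"
      using o d unfolding off_diamond_def by force
    then show ?thesis
    proof cases
      case 1
      then have "(\<bar>Re w - of_int x\<bar> - 1/4)\<^sup>2 = 0" by simp
      then show ?thesis using sq [OF abs_ge_zero d(2)] by (simp only: add_0)
    next
      case 2
      then have "(\<bar>Im w - of_int y\<bar> - 1/4)\<^sup>2 = 0" by simp
      then show ?thesis using sq [OF abs_ge_zero d(1)] by (simp only: add_0_right)
    qed
  qed
  then have eq: "corner_dist x y w = 1/16" using d(3) by linarith
  show thesis
  proof (rule that [of a b])
    show "w \<in> quarter x y a b"
      using d eq x y r by (intro quarterI) (auto simp: a_def b_def)
  qed (use x y in \<open>auto simp: a_def b_def face_index_def\<close>)
qed

lemma connected_chain_int:
  fixes S :: "int \<Rightarrow> 'a::topological_space set"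
  assumes conn: "\<And>k. connected (S k)" and meet: "\<And>k. S k \<inter> S (k + 1) \<noteq> {}"
  shows "connected (\<Union>k. S k)"
proof -
  have meet0: "S 0 \<noteq> {}" using meet [of 0] by auto
  have "connected (\<Union>k\<in>{- int n..int n}. S k)" for n
  proof (induction n)
    case 0
    then show ?case using conn by simp
  next
    case (Suc n)
    have "{- int (Suc n)..int (Suc n)} = insert (- int n - 1) (insert (int n + 1) {- int n..int n})" by auto
    then have eq: "(\<Union>k\<in>{- int (Suc n)..int (Suc n)}. S k) = S (- int n - 1) \<union> (S (int n + 1) \<union> (\<Union>k\<in>{- int n..int n}. S k))"
      by simp
    have 1: "S (int n + 1) \<inter> (\<Union>k\<in>{- int n..int n}. S k) \<noteq> {}" using meet [of "int n"] by fastforce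
    have 2: "S (- int n - 1) \<inter> (S (int n + 1) \<union> (\<Union>k\<in>{- int n..int n}. S k)) \<noteq> {}"
      using meet [of "- int n - 1"] by fastforce
    show ?case unfolding eq by (intro connected_Un conn Suc 1 2)
  qed
  moreover have "(\<Union>k. S k) = (\<Union>n. \<Union>k\<in>{- int n..int n}. S k)"
  proof -
    have "k \<in> {- int (nat \<bar>k\<bar>)..int (nat \<bar>k\<bar>)}" for k by auto
    then show ?thesis by blast
  qed
  moreover have "S 0 \<subseteq> (\<Union>k\<in>{- int n..int n}. S k)" for n by (rule UN_upper) simp
  then have "\<Inter> (range (\<lambda>n. \<Union>k\<in>{- int n..int n}. S k)) \<noteq> {}" using meet0 by blast
  ultimately show ?thesis by (simp only:) (intro connected_Union, auto)
qed

lemma connected_rounded_curve: "connected (rounded_curve C)" if C: "\<And>k. seg_end (C k) = fst (C (k + 1))"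
proof -
  define S where "S k = closed_segment (fst (C k) + snd (C k) / 4) (fst (C k) + 3 * snd (C k) / 4)
          \<union> rounded_corner (C k) (C (k + 1))" for k
  have start: "fst (C (k + 1)) + snd (C (k + 1)) / 4 \<in> rounded_corner (C k) (C (k + 1))" for k
    unfolding rounded_corner_def
    by (rule image_eqI [of _ _ 0]) (simp_all add: C field_simps)
  have stop: "fst (C k) + 3 * snd (C k) / 4 \<in> rounded_corner (C k) (C (k + 1))" for k
    unfolding rounded_corner_def
    by (rule image_eqI [of _ _ "pi/2"]) (simp_all add: seg_end_def field_simps)
  have "connected (rounded_corner (C k) (C (k + 1)))" for k
    unfolding rounded_corner_def
    by (intro connected_continuous_image continuous_intros connected_Icc) auto
  then have "connected (S k)" for k
    unfolding S_def using stop [of k] by (intro connected_Un) auto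
  moreover have "S k \<inter> S (k + 1) \<noteq> {}" for k
  proof -
    have "fst (C (k + 1)) + snd (C (k + 1)) / 4 \<in> S k \<inter> S (k + 1)" using start by (auto simp: S_def)
    then show ?thesis by blast
  qed
  ultimately have "connected (\<Union>k. S k)" by (rule connected_chain_int)
  then show ?thesis by (simp add: rounded_curve_def S_def)
qed

section \<open>Rounded curves in grid coordinates\<close>

context turn_grid
begin

text \<open>Holds when an arc at \<open>(x, y)\<close> lies in the quadrant of signs
  \<open>a\<close>, \<open>b\<close>. Both arcs turn to the same side, so they occupy opposite
  quadrants; the parity tells whether edges arrive vertically or horizontally.\<close>

definition hugged :: "int \<Rightarrow> int \<Rightarrow> int \<Rightarrow> int \<Rightarrow> bool" where
  "hugged x y a b \<longleftrightarrow> (a = b \<longleftrightarrow> (even (x + y) \<longleftrightarrow> \<tau> x y = 1))"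

end

context curve_system
begin

lemma hugged_nxt:
  assumes ab: "a \<in> {1, -1}" "b \<in> {1, -1}" and h: "hugged x y a b"
  shows "even (x + y) \<Longrightarrow> nxt (ver_at x y b) = hor_at x y a"
    and "odd (x + y) \<Longrightarrow> nxt (hor_at x y a) = ver_at x y b"
proof -
  have t: "\<tau> x y = 1 \<or> \<tau> x y = -1" by (rule signs_cases [OF signs])
  show "nxt (ver_at x y b) = hor_at x y a" if ev: "even (x + y)"
  proof -
    have ta: "\<tau> x y * b = a" using h t ev ab by (auto simp: hugged_def)
    have o: "odd (x + (y + b))" using ev ab by auto
    have "edge_end 1 0 (x, y + b, - b) = (x, y)" by (simp only: edge_end.simps o if_False) simp
    then have "nxt (x, y + b, - b) = turned 1 0 (\<tau> x y) (x, y + b, - b)" by (simp only: next_edge_def case_prod_conv)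
    also have "\<dots> = (x, y, a)" unfolding turned_odd [OF o] using ta by simp
    finally show ?thesis using ev by (simp add: ver_at_def hor_at_def)
  qed
  show "nxt (hor_at x y a) = ver_at x y b" if od: "odd (x + y)"
  proof -
    have ta: "\<tau> x y * - a = b" using h t od ab by (auto simp: hugged_def)
    have o: "even (x + a + y) = True" using od ab by auto
    have "edge_end 1 0 (x + a, y, - a) = (x, y)" by (simp only: edge_end.simps o if_True) simp
    then have "nxt (x + a, y, - a) = turned 1 0 (\<tau> x y) (x + a, y, - a)" by (simp only: next_edge_def case_prod_conv)
    also have "\<dots> = (x, y, b)" using turned_even [of "x + a" y] o ta by simp
    finally show ?thesis using od by (simp add: ver_at_def hor_at_def)
  qed
qed

definition rep :: "edge \<Rightarrow> edge" where
  "rep e = (THE z. z \<in> Z \<and> (\<exists>k. orb z k = e))"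

lemma rep_orb: "z \<in> Z \<Longrightarrow> rep (orb z k) = z"
  unfolding rep_def using orb_representative by blast

lemma rep_cases:
  assumes "is_edge e"
  obtains k where "rep e \<in> Z" "orb (rep e) k = e"
  using cover [OF assms] rep_orb by metis

lemma rep_in: "is_edge e \<Longrightarrow> rep e \<in> Z"
  by (metis rep_cases)

lemma rep_nxt:
  assumes "is_edge e"
  shows "rep (nxt e) = rep e"
proof -
  obtain k where k: "rep e \<in> Z" "orb (rep e) k = e" by (rule rep_cases [OF assms])
  then have "nxt e = orb (rep e) (k + 1)" using orb_Suc is_edge_Z by simp
  then show ?thesis using rep_orb k(1) by simp
qed

lemma is_edge_at: "a \<in> {1, -1} \<Longrightarrow> is_edge (hor_at x y a)" "b \<in> {1, -1} \<Longrightarrow> is_edge (ver_at x y b)"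
  by (auto simp: hor_at_def ver_at_def)

lemma rep_hugged:
  assumes "a \<in> {1, -1}" "b \<in> {1, -1}" "hugged x y a b"
  shows "rep (ver_at x y b) = rep (hor_at x y a)"
  using hugged_nxt [OF assms] rep_nxt is_edge_at assms by (cases "even (x + y)") metis+

text \<open>The rounded curve described by the position of its pieces instead of their index along
  the curve, which suits the comparison of different curves.\<close>

definition drawn :: "edge \<Rightarrow> complex set" where
  "drawn z = {w. (\<exists>i j. rep (hor i j) = z \<and> w \<in> hmid (i, j)) \<or> (\<exists>i j. rep (ver i j) = z \<and> w \<in> vmid (i, j)) \<or>
     (\<exists>x y a b. a \<in> {1, -1} \<and> b \<in> {1, -1} \<and> hugged x y a b \<and> rep (hor_at x y a) = z \<and> w \<in> quarter x y a b)}"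

lemma drawn_cases:
  assumes "w \<in> drawn z"
  obtains (h) i j where "rep (hor i j) = z" "w \<in> hmid (i, j)"
  | (v) i j where "rep (ver i j) = z" "w \<in> vmid (i, j)"
  | (q) x y a b where "a \<in> {1, -1}" "b \<in> {1, -1}" "hugged x y a b" "rep (hor_at x y a) = z" "w \<in> quarter x y a b"
  using assms unfolding drawn_def by blast

lemma hmid_index: "w \<in> hmid (i, j) \<Longrightarrow> i = \<lfloor>Re w\<rfloor> \<and> j = \<lfloor>Im w\<rfloor>"
  by (auto simp: hmid_def intro!: floor_unique [symmetric])

lemma vmid_index: "w \<in> vmid (i, j) \<Longrightarrow> i = \<lfloor>Re w\<rfloor> \<and> j = \<lfloor>Im w\<rfloor>"
  by (auto simp: vmid_def intro!: floor_unique [symmetric])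

lemma hmid_vmid_disjoint: "w \<in> hmid (i, j) \<Longrightarrow> w \<in> vmid (i', j') \<Longrightarrow> False"
proof -
  assume a: "w \<in> hmid (i, j)" "w \<in> vmid (i', j')"
  then have "i = i'" using hmid_index vmid_index by metis
  then show False using a by (auto simp: hmid_def vmid_def)
qed

lemma hmid_quarter:
  assumes "w \<in> hmid (i, j)" "w \<in> quarter x y a b" "a \<in> {1, -1}" "b \<in> {1, -1}"
  shows "hor i j = hor_at x y a"
proof -
  note c = quarter_cases [OF assms(2-4)]
  have w: "Im w = of_int j" "of_int i + 1/4 \<le> Re w" "Re w \<le> of_int i + 3/4" using assms(1) by (auto simp: hmid_def)
  have y: "j = y" using c(2) w(1) by (intro int_near) simp
  have "(\<bar>Re w - of_int x\<bar> - 1/4)\<^sup>2 = 0" using c(3) w(1) y by (simp add: power2_eq_square)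
  then have r: "\<bar>Re w - of_int x\<bar> = 1/4" by simp
  from assms(3) show ?thesis
  proof
    assume a: "a = 1"
    then have "i = x" using c(4) r w by (intro int_near) simp
    then show ?thesis using a y hor_at_eq by simp
  next
    assume "a \<in> {-1}"
    then have a: "a = -1" by simp
    then have "Re w = of_int x - 1/4" using c(4) r by simp
    then have "i = x - 1" using w by (intro int_near) simp
    then show ?thesis using a y hor_at_eq by simp
  qed
qed

lemma vmid_quarter:
  assumes "w \<in> vmid (i, j)" "w \<in> quarter x y a b" "a \<in> {1, -1}" "b \<in> {1, -1}"
  shows "ver i j = ver_at x y b"
proof -
  note c = quarter_cases [OF assms(2-4)]
  have w: "Re w = of_int i" "of_int j + 1/4 \<le> Im w" "Im w \<le> of_int j + 3/4" using assms(1) by (auto simp: vmid_def)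
  have x: "i = x" using c(1) w(1) by (intro int_near) simp
  have "(\<bar>Im w - of_int y\<bar> - 1/4)\<^sup>2 = 0" using c(3) w(1) x by (simp add: power2_eq_square)
  then have r: "\<bar>Im w - of_int y\<bar> = 1/4" by simp
  from assms(4) show ?thesis
  proof
    assume b: "b = 1"
    then have "j = y" using c(5) r w by (intro int_near) simp
    then show ?thesis using b x ver_at_eq by simp
  next
    assume "b \<in> {-1}"
    then have b: "b = -1" by simp
    then have "Im w = of_int y - 1/4" using c(5) r by simp
    then have "j = y - 1" using w by (intro int_near) simp
    then show ?thesis using b x ver_at_eq by simp
  qed
qed

text \<open>The two arcs at a vertex lie in opposite quadrants, which only share the vertex itself,
  and this is on neither arc.\<close>

lemma quarter_quarter:
  assumes w: "w \<in> quarter x y a b" "w \<in> quarter x' y' a' b'"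
    and s: "a \<in> {1, -1}" "b \<in> {1, -1}" "a' \<in> {1, -1}" "b' \<in> {1, -1}"
    and h: "hugged x y a b" "hugged x' y' a' b'"
  shows "hor_at x y a = hor_at x' y' a'"
proof -
  note c = quarter_cases [OF w(1) s(1,2)]
  note c' = quarter_cases [OF w(2) s(3,4)]
  have x: "x = x'" "y = y'" using c(1,2) c'(1,2) by linarith+
  show ?thesis
  proof (cases "a = a'")
    case False
    then have "a' = - a" using s by auto
    moreover have "b' = - b" using h s False unfolding x hugged_def by auto
    ultimately have "Re w = of_int x" "Im w = of_int y"
      using c(4,5) c'(4,5) s(1,2) unfolding x by auto
    then show ?thesis using c(3) by (simp add: power2_eq_square)
  qed (use x in simp)
qed

lemma drawn_disjoint:
  assumes "w \<in> drawn z" "w \<in> drawn z'"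
  shows "z = z'"
  using assms(1)
proof (cases rule: drawn_cases)
  case h1: (h i j)
  from assms(2) show ?thesis
  proof (cases rule: drawn_cases)
    case (h i' j')
    then show ?thesis using h1 hmid_index by metis
  next
    case (v i' j')
    then show ?thesis using h1 hmid_vmid_disjoint by blast
  next
    case (q x y a b)
    then show ?thesis using hmid_quarter h1 by metis
  qed
next
  case v1: (v i j)
  from assms(2) show ?thesis
  proof (cases rule: drawn_cases)
    case (h i' j')
    then show ?thesis using v1 hmid_vmid_disjoint by blast
  next
    case (v i' j')
    then show ?thesis using v1 vmid_index by metis
  next
    case (q x y a b)
    then show ?thesis using vmid_quarter rep_hugged v1 by metis
  qed
next
  case q1: (q x y a b)
  from assms(2) show ?thesis
  proof (cases rule: drawn_cases)
    case (h i' j')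
    then show ?thesis using hmid_quarter q1 by metis
  next
    case (v i' j')
    then show ?thesis using vmid_quarter rep_hugged q1 by metis
  next
    case (q x' y' a' b')
    then show ?thesis using quarter_quarter [OF q1(5) q(5) q1(1,2) q(1,2) q1(3) q(3)] q1(4) by simp
  qed
qed

end

lemma hmid_segment: "hmid (i, j) = closed_segment (Complex (of_int i + 1/4) (of_int j)) (Complex (of_int i + 3/4) (of_int j))"
  by (auto simp: hmid_def closed_segment_same_Im closed_segment_eq_real_ivl)

lemma vmid_segment: "vmid (i, j) = closed_segment (Complex (of_int i) (of_int j + 1/4)) (Complex (of_int i) (of_int j + 3/4))"
  by (auto simp: vmid_def closed_segment_same_Re closed_segment_eq_real_ivl)

context placement
begin

definition embed :: "complex \<Rightarrow> complex" where
  "embed w = org + u * w"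

lemma embed_segment: "embed ` closed_segment a b = closed_segment (embed a) (embed b)"
proof -
  have "embed ` closed_segment a b = (+) org ` ((*) u ` closed_segment a b)"
    by (auto simp: embed_def image_iff)
  also have "\<dots> = closed_segment (embed a) (embed b)"
    by (simp add: closed_segment_linear_image closed_segment_translation embed_def)
  finally show ?thesis .
qed

definition straight :: "segment \<Rightarrow> complex set" where
  "straight s = closed_segment (fst s + snd s / 4) (fst s + 3 * snd s / 4)"

lemma straight_hor: "straight (place (hor i j)) = embed ` hmid (i, j)"
proof (cases "even (i + j)")
  case True
  then have "place (hor i j) = (point (i, j), u)" by (simp add: hor_def place_even)
  moreover have "point (i, j) + u / 4 = embed (Complex (of_int i + 1/4) (of_int j))"
    "point (i, j) + 3 * u / 4 = embed (Complex (of_int i + 3/4) (of_int j))"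
    by (simp_all add: point_def embed_def complex_eq_iff algebra_simps)
  ultimately show ?thesis unfolding straight_def hmid_segment embed_segment by simp
next
  case False
  then have "place (hor i j) = (point (i + 1, j), - u)" by (simp add: hor_def place_even)
  moreover have "point (i + 1, j) + - u / 4 = embed (Complex (of_int i + 3/4) (of_int j))"
    "point (i + 1, j) + 3 * - u / 4 = embed (Complex (of_int i + 1/4) (of_int j))"
    by (simp_all add: point_def embed_def complex_eq_iff algebra_simps)
  ultimately show ?thesis unfolding straight_def hmid_segment embed_segment
    by (simp add: closed_segment_commute)
qed

lemma straight_ver: "straight (place (ver i j)) = embed ` vmid (i, j)"
proof (cases "odd (i + j)")
  case True
  then have "place (ver i j) = (point (i, j), u * \<i>)" by (simp add: ver_def place_odd)
  moreover have "point (i, j) + u * \<i> / 4 = embed (Complex (of_int i) (of_int j + 1/4))"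
    "point (i, j) + 3 * (u * \<i>) / 4 = embed (Complex (of_int i) (of_int j + 3/4))"
    by (simp_all add: point_def embed_def complex_eq_iff algebra_simps)
  ultimately show ?thesis unfolding straight_def vmid_segment embed_segment by simp
next
  case False
  then have "odd (i + (j + 1))" by simp
  then have "place (ver i j) = (point (i, j + 1), - (u * \<i>))" using False by (simp add: ver_def place_odd del: even_add)
  moreover have "point (i, j + 1) + - (u * \<i>) / 4 = embed (Complex (of_int i) (of_int j + 3/4))"
    "point (i, j + 1) + 3 * - (u * \<i>) / 4 = embed (Complex (of_int i) (of_int j + 1/4))"
    by (simp_all add: point_def embed_def complex_eq_iff algebra_simps)
  ultimately show ?thesis unfolding straight_def vmid_segment embed_segment
    by (simp add: closed_segment_commute)
qed

lemma corner_even: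
  assumes "even (x + y)" "c \<in> {1, -1}" "r \<in> {1, -1}"
  shows "rounded_corner (place (x, y, c)) (place (turned 1 0 r (x, y, c))) = embed ` quarter (x + c) y (- c) (r * c)"
proof -
  have o: "odd (x + c + y)" using assms(1,2) by auto
  have t: "place (turned 1 0 r (x, y, c)) = (point (x + c, y), u * (of_int (r * c) * \<i>))"
    unfolding turned_even [OF assms(1)] using place_odd [OF o] by simp
  have e: "place (x, y, c) = (point (x, y), u * of_int c)" by (rule place_even [OF assms(1)])
  have se: "seg_end (place (x, y, c)) = point (x + c, y)"
    using assms(1) by (simp add: seg_end_place)
  have "quarter (x + c) y (- c) (r * c) = (\<lambda>\<theta>. corner_point (x + c) y (- c) (r * c) (cos \<theta>) (sin \<theta>)) ` {0..pi/2}"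
    using assms(2,3) by (intro quarter_param(1)) auto
  then show ?thesis
    unfolding rounded_corner_def se unfolding t e image_image
    by (simp only: image_image) (rule image_cong [OF refl], simp add: embed_def point_def complex_eq_iff field_simps)
qed

lemma corner_odd:
  assumes "odd (x + y)" "c \<in> {1, -1}" "r \<in> {1, -1}"
  shows "rounded_corner (place (x, y, c)) (place (turned 1 0 r (x, y, c))) = embed ` quarter x (y + c) (- r * c) (- c)"
proof -
  have o: "even (x + (y + c))" using assms(1,2) by auto
  have t: "place (turned 1 0 r (x, y, c)) = (point (x, y + c), u * of_int (- r * c))"
    unfolding turned_odd [OF assms(1)] using place_even [OF o] by simp
  have e: "place (x, y, c) = (point (x, y), u * (of_int c * \<i>))" by (rule place_odd [OF assms(1)])
  have se: "seg_end (place (x, y, c)) = point (x, y + c)"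
    using assms(1) by (simp add: seg_end_place)
  have "quarter x (y + c) (- r * c) (- c) = (\<lambda>\<theta>. corner_point x (y + c) (- r * c) (- c) (sin \<theta>) (cos \<theta>)) ` {0..pi/2}"
    using assms(2,3) by (intro quarter_param(2)) auto
  then show ?thesis
    unfolding rounded_corner_def se unfolding t e image_image
    by (simp only: image_image) (rule image_cong [OF refl], simp add: embed_def point_def complex_eq_iff field_simps)
qed

end

context placed_system
begin

lemma corner_quarter:
  assumes "a \<in> {1, -1}" "b \<in> {1, -1}" "hugged x y a b"
  defines "e \<equiv> if even (x + y) then ver_at x y b else hor_at x y a"
  shows "rounded_corner (place e) (place (nxt e)) = embed ` quarter x y a b"
    "is_edge e" "rep e = rep (hor_at x y a)"
proof -
  show "is_edge e" using is_edge_at assms by (auto simp: e_def)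
  show "rep e = rep (hor_at x y a)" using rep_hugged [OF assms(1-3)] by (simp add: e_def)
  have t: "\<tau> x y \<in> {1, -1}" using signs by (simp add: signs_def)
  show "rounded_corner (place e) (place (nxt e)) = embed ` quarter x y a b"
  proof (cases "even (x + y)")
    case True
    then have e: "e = (x, y + b, - b)" by (simp add: e_def ver_at_def)
    have o: "odd (x + (y + b))" using True assms(2) by auto
    have "edge_end 1 0 e = (x, y)" unfolding e by (simp only: edge_end.simps o if_False) simp
    then have n: "nxt e = turned 1 0 (\<tau> x y) e" by (simp add: next_edge_def)
    have "\<tau> x y * b = a" using assms(1-3) t True by (auto simp: hugged_def)
    then have q: "quarter x (y + b + - b) (- \<tau> x y * (- b)) (- (- b)) = quarter x y a b" by simp
    have "- b \<in> {1, -1}" using assms(2) by auto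
    from corner_odd [OF o this t] show ?thesis unfolding n unfolding e q .
  next
    case False
    then have e: "e = (x + a, y, - a)" by (simp add: e_def hor_at_def)
    have o: "even (x + a + y)" using False assms(1) by auto
    have "edge_end 1 0 e = (x, y)" unfolding e using o by (simp only: edge_end.simps simp_thms if_True) simp
    then have n: "nxt e = turned 1 0 (\<tau> x y) e" by (simp add: next_edge_def)
    have "\<tau> x y * (- a) = b" using assms(1-3) t False by (auto simp: hugged_def)
    then have q: "quarter (x + a + - a) y (- (- a)) (\<tau> x y * (- a)) = quarter x y a b" by simp
    have "- a \<in> {1, -1}" using assms(1) by auto
    from corner_even [OF o this t] show ?thesis unfolding n unfolding e q .
  qed
qed

lemma corner_exists:
  assumes "is_edge e"
  shows "\<exists>x y a b. a \<in> {1, -1} \<and> b \<in> {1, -1} \<and> hugged x y a b \<and> rep (hor_at x y a) = rep e \<and>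
    rounded_corner (place e) (place (nxt e)) = embed ` quarter x y a b"
proof -
  obtain x' y' c where e: "e = (x', y', c)" by (cases e)
  have c: "c = 1 \<or> c = -1" using assms by (simp add: e)
  show ?thesis
  proof (cases "even (x' + y')")
    case True
    define b :: int where "b = (if hugged (x' + c) y' (- c) 1 then 1 else -1)"
    have od: "odd (x' + c + y')" using True c by auto
    have ab: "- c \<in> {1, -1}" "b \<in> {1, -1}" using c by (auto simp: b_def)
    have h: "hugged (x' + c) y' (- c) b" using c by (auto simp: b_def hugged_def)
    have "hor_at (x' + c) y' (- c) = e" unfolding hor_at_def if_not_P [OF od] by (simp add: e)
    with corner_quarter [OF ab h] ab h show ?thesis unfolding if_not_P [OF od] by metis
  next
    case False
    define a :: int where "a = (if hugged x' (y' + c) 1 (- c) then 1 else -1)"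
    have ev: "even (x' + (y' + c))" using False c by auto
    have ab: "a \<in> {1, -1}" "- c \<in> {1, -1}" using c by (auto simp: a_def)
    have h: "hugged x' (y' + c) a (- c)" using c by (auto simp: a_def hugged_def)
    have "ver_at x' (y' + c) (- c) = e" unfolding ver_at_def if_P [OF ev] by (simp add: e)
    with corner_quarter [OF ab h] ab h show ?thesis unfolding if_P [OF ev] by metis
  qed
qed

lemma rounded_curve_at:
  assumes z: "z \<in> Z"
  shows "rounded_curve (curve_at \<tau> z) = embed ` drawn z"
proof -
  have iz: "is_edge z" using is_edge_Z z by blast
  have rc: "rounded_curve (curve_at \<tau> z) =
      (\<Union>k. straight (place (orb z k)) \<union> rounded_corner (place (orb z k)) (place (nxt (orb z k))))"
    by (simp add: rounded_curve_def straight_def curve_at_def orb_Suc [OF iz])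
  show ?thesis
  proof
    show "rounded_curve (curve_at \<tau> z) \<subseteq> embed ` drawn z"
    proof
      fix p assume "p \<in> rounded_curve (curve_at \<tau> z)"
      then obtain k where k: "p \<in> straight (place (orb z k)) \<or>
          p \<in> rounded_corner (place (orb z k)) (place (nxt (orb z k)))"
        unfolding rc by blast
      have e: "is_edge (orb z k)" "rep (orb z k) = z" using is_edge_orb iz rep_orb z by auto
      from k show "p \<in> embed ` drawn z"
      proof
        assume p: "p \<in> straight (place (orb z k))"
        from edge_hor_ver [OF e(1)] show ?thesis
        proof cases
          case (1 i j)
          then show ?thesis using p e(2) straight_hor unfolding drawn_def by auto
        next
          case (2 i j)
          then show ?thesis using p e(2) straight_ver unfolding drawn_def by auto
        qed
      next
        assume "p \<in> rounded_corner (place (orb z k)) (place (nxt (orb z k)))"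
        then obtain x y a b where "a \<in> {1, -1}" "b \<in> {1, -1}" "hugged x y a b" "rep (hor_at x y a) = z"
          "p \<in> embed ` quarter x y a b"
          using corner_exists [OF e(1)] e(2) by metis
        then show ?thesis unfolding drawn_def by blast
      qed
    qed
    show "embed ` drawn z \<subseteq> rounded_curve (curve_at \<tau> z)"
    proof (rule image_subsetI)
      fix w assume "w \<in> drawn z"
      then show "embed w \<in> rounded_curve (curve_at \<tau> z)"
      proof (cases rule: drawn_cases)
        case (h i j)
        obtain k where "orb z k = hor i j" using rep_cases [OF is_edge_hor] h(1) by metis
        moreover have "embed w \<in> straight (place (hor i j))" using h(2) straight_hor by blast
        ultimately show ?thesis unfolding rc by (intro UN_I [of k UNIV]) simp_all
      next
        case (v i j)
        obtain k where "orb z k = ver i j" using rep_cases [OF is_edge_ver] v(1) by metis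
        moreover have "embed w \<in> straight (place (ver i j))" using v(2) straight_ver by blast
        ultimately show ?thesis unfolding rc by (intro UN_I [of k UNIV]) simp_all
      next
        case (q x y a b)
        obtain e where e: "rounded_corner (place e) (place (nxt e)) = embed ` quarter x y a b"
          "is_edge e" "rep e = z" using corner_quarter [OF q(1-3)] q(4) by metis
        obtain k where "orb z k = e" using rep_cases [OF e(2)] e(3) by metis
        moreover have "embed w \<in> rounded_corner (place e) (place (nxt e))" using e(1) q(5) by blast
        ultimately show ?thesis unfolding rc by (intro UN_I [of k UNIV]) simp_all
      qed
    qed
  qed
qed

end

section \<open>Separation of two curves by the third\<close>

text \<open>A system of three curves such that the left side of \<open>E\<close> only sees \<open>A\<close> and its right side only
  sees \<open>B\<close>: the left squares along \<open>B\<close> and the right squares along \<open>A\<close> are bounded by a single curve.\<close>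

locale separating_system = placed_system u org \<tau> Z for u org \<tau> Z +
  fixes A B E :: edge
  assumes Z_eq: "Z = {A, B, E}" and distinct_ABE: "A \<noteq> B" "A \<noteq> E" "B \<noteq> E"
    and left_B: "\<exists>k. orb B k = (turned 1 0 1 ^^ j) (orb B i)"
    and right_A: "\<exists>k. orb A k = (turned 1 0 (-1) ^^ j) (orb A i)"
begin

lemma ABE_in: "A \<in> Z" "B \<in> Z" "E \<in> Z"
  by (auto simp: Z_eq)

lemma rep_left: "is_edge e \<Longrightarrow> rep e = B \<Longrightarrow> rep ((turned 1 0 1 ^^ j) e) = B"
  using rep_cases left_B rep_orb ABE_in by metis

lemma rep_right: "is_edge e \<Longrightarrow> rep e = A \<Longrightarrow> rep ((turned 1 0 (-1) ^^ j) e) = A"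
  using rep_cases right_A rep_orb ABE_in by metis

text \<open>\<open>True\<close> is the side of \<open>B\<close>. An even square is on the left of
  its sides, hence bounded by \<open>B\<close> alone or without side in \<open>B\<close>; an odd one
  is on the right, hence bounded by \<open>A\<close> alone or without side in
  \<open>A\<close>.\<close>

definition square_side :: "int \<Rightarrow> int \<Rightarrow> bool" where
  "square_side i j = (if even (i + j) then rep (hor i j) = B else rep (hor i j) \<noteq> A)"

text \<open>\<open>p\<close> tells whether the adjacent square is even, that is, on the left of the
  edge. Only along \<open>E\<close> does the side depend on it.\<close>

definition edge_side :: "edge \<Rightarrow> bool \<Rightarrow> bool" where
  "edge_side z p \<longleftrightarrow> z = B \<or> z = E \<and> \<not> p"

lemma square_side_eq:
  assumes e: "e \<in> {hor i j, hor i (j + 1), ver i j, ver (i + 1) j}"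
  shows "square_side i j \<longleftrightarrow> edge_side (rep e) (even (i + j))"
proof -
  have ie: "is_edge e" using e is_edge_hor is_edge_ver by blast
  have Ze: "rep e \<in> {A, B, E}" using rep_in [OF ie] Z_eq by simp
  show ?thesis
  proof (cases "even (i + j)")
    case True
    then have r: "(1::int) = (if even (i + j) then 1 else -1)" by simp
    have "rep e = B \<longleftrightarrow> rep (hor i j) = B"
      using square_sides [OF e r] rep_left ie is_edge_hor by metis
    then show ?thesis using True distinct_ABE by (simp add: square_side_def edge_side_def)
  next
    case False
    then have r: "(-1::int) = (if even (i + j) then 1 else -1)" by simp
    have "rep e = A \<longleftrightarrow> rep (hor i j) = A"
      using square_sides [OF e r] rep_right ie is_edge_hor by metis
    then show ?thesis using False distinct_ABE Ze by (auto simp: square_side_def edge_side_def)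
  qed
qed

text \<open>The arcs cut the diamond off from two opposite squares; it takes the side of the other
  two, to which it is open.\<close>

definition vertex_side :: "int \<Rightarrow> int \<Rightarrow> bool" where
  "vertex_side x y = (if hugged x y 1 1 then square_side (x - 1) y else square_side x y)"

lemma hugged_flip: "a \<in> {1, -1} \<Longrightarrow> b \<in> {1, -1} \<Longrightarrow> hugged x y a b \<longleftrightarrow> (a = b \<longleftrightarrow> hugged x y 1 1)"
  by (auto simp: hugged_def)

text \<open>The two open squares have equal parity and border the two edges joined by one arc, which
  belong to the same curve; hence they are on the same side.\<close>

lemma vertex_side_open:
  assumes ab: "a \<in> {1, -1}" "b \<in> {1, -1}" and h: "\<not> hugged x y a b"
  shows "vertex_side x y = square_side (face_index x a) (face_index y b)"
proof (cases "hugged x y 1 1")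
  case True
  then have neg: "a \<noteq> b" using h hugged_flip [OF ab] by blast
  have r: "rep (ver x y) = rep (hor x y)" using rep_hugged [of 1 1 x y] True by (simp add: hor_at_eq ver_at_eq)
  have "square_side (x - 1) y = edge_side (rep (ver x y)) (even (x - 1 + y))"
    by (rule square_side_eq) simp
  moreover have "square_side x (y - 1) = edge_side (rep (hor x y)) (even (x + (y - 1)))"
    by (rule square_side_eq) simp
  moreover have "even (x - 1 + y) \<longleftrightarrow> even (x + (y - 1))" by auto
  ultimately have "square_side (x - 1) y = square_side x (y - 1)" using r by (simp only:)
  then show ?thesis using True neg ab by (auto simp: vertex_side_def face_index_def)
next
  case False
  then have eq: "a = b" using h hugged_flip [OF ab] by blast
  have "hugged x y (-1) 1" using False hugged_flip [of "-1" 1 x y] by simp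
  then have r: "rep (ver x y) = rep (hor (x - 1) y)" using rep_hugged [of "-1" 1 x y] by (simp add: hor_at_eq ver_at_eq)
  have "square_side x y = edge_side (rep (ver x y)) (even (x + y))"
    by (rule square_side_eq) simp
  moreover have "square_side (x - 1) (y - 1) = edge_side (rep (hor (x - 1) y)) (even (x - 1 + (y - 1)))"
    by (rule square_side_eq) simp
  moreover have "even (x - 1 + (y - 1)) \<longleftrightarrow> even (x + y)" by auto
  ultimately have "square_side x y = square_side (x - 1) (y - 1)" using r by (simp only:)
  then show ?thesis using False eq ab by (auto simp: vertex_side_def face_index_def)
qed

lemma hor_at_face:
  assumes "a \<in> {1, -1}" "b \<in> {1, -1}"
  shows "square_side (face_index x a) (face_index y b) =
    edge_side (rep (hor_at x y a)) (even (face_index x a + face_index y b))"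
  using assms by (intro square_side_eq) (auto simp: face_index_def hor_at_eq)

lemma vertex_side_hugged:
  assumes ab: "a \<in> {1, -1}" "b \<in> {1, -1}" and h: "hugged x y a b"
  shows "vertex_side x y = edge_side (rep (hor_at x y a)) (odd (face_index x a + face_index y b))"
proof -
  have b': "- b \<in> {1, -1}" using ab by auto
  have "\<not> hugged x y a (- b)" using h ab hugged_flip [OF ab] hugged_flip [OF ab(1) b'] by auto
  from vertex_side_open [OF ab(1) b' this] hor_at_face [OF ab(1) b', of x y]
  have "vertex_side x y = edge_side (rep (hor_at x y a)) (even (face_index x a + face_index y (- b)))" by simp
  also have "even (face_index x a + face_index y (- b)) \<longleftrightarrow> odd (face_index x a + face_index y b)"
    using ab by (auto simp: face_index_def)
  finally show ?thesis .
qed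

definition region :: "bool \<Rightarrow> complex set" where
  "region s = (\<Union>p\<in>{(i, j). square_side i j = s}. square_core p) \<union> (\<Union>p\<in>{(x, y). vertex_side x y = s}. diamond p)"

lemma closed_region: "closed (region s)"
  unfolding region_def
  by (intro closed_Un closed_UN_locally_finite closed_square_core closed_diamond)
    (auto simp: square_core_def diamond_def)

lemma region_cover: "w \<in> region True \<union> region False"
proof (cases "w \<in> square_core (\<lfloor>Re w\<rfloor>, \<lfloor>Im w\<rfloor>)")
  case True
  then show ?thesis unfolding region_def by auto
next
  case False
  have "of_int \<lfloor>Re w\<rfloor> \<le> Re w" "Re w \<le> of_int \<lfloor>Re w\<rfloor> + 1" "of_int \<lfloor>Im w\<rfloor> \<le> Im w" "Im w \<le> of_int \<lfloor>Im w\<rfloor> + 1"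
    by linarith+
  with False obtain x y where "w \<notin> off_diamond (x, y)" by (force simp: square_core_def)
  then have "w \<in> diamond (x, y)" by (auto simp: off_diamond_def diamond_def)
  then have "w \<in> region (vertex_side x y)" unfolding region_def by blast
  then show ?thesis by (cases "vertex_side x y") auto
qed

lemma edge_side_differ: "edge_side z p \<noteq> edge_side z q \<Longrightarrow> z = E"
  by (auto simp: edge_side_def)

text \<open>Squares with a common edge see the same curve there, so only \<open>E\<close> can give
  them different sides. Squares with just a common corner do not meet, as the corners have been
  removed.\<close>

lemma core_core_drawn:
  assumes "w \<in> square_core (i, j)" "w \<in> square_core (i', j')" "square_side i j \<noteq> square_side i' j'"
  shows "w \<in> drawn E"
proof -
  have r: "of_int i \<le> Re w" "Re w \<le> of_int i + 1" "of_int j \<le> Im w" "Im w \<le> of_int j + 1"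
    "of_int i' \<le> Re w" "Re w \<le> of_int i' + 1" "of_int j' \<le> Im w" "Im w \<le> of_int j' + 1"
    using assms(1,2) by (auto simp: square_core_def)
  show ?thesis
  proof (cases "i = i'")
    case i: True
    then have "j \<noteq> j'" using assms(3) by auto
    define k where "k = max j j'"
    have k: "Im w = of_int k" "(j = k \<and> j' = k - 1) \<or> (j = k - 1 \<and> j' = k)"
      using r(3,4,7,8) \<open>j \<noteq> j'\<close> unfolding k_def by linarith+
    have "w \<in> hmid (i, k)" by (rule core_hmid [OF assms(1) k(1)])
    moreover have "square_side i k = edge_side (rep (hor i k)) (even (i + k))"
      "square_side i (k - 1) = edge_side (rep (hor i k)) (even (i + (k - 1)))"
      by (rule square_side_eq; simp)+
    then have "rep (hor i k) = E" using assms(3) k(2) i edge_side_differ by metis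
    ultimately show ?thesis unfolding drawn_def by blast
  next
    case i: False
    define k where "k = max i i'"
    have k: "Re w = of_int k" "(i = k \<and> i' = k - 1) \<or> (i = k - 1 \<and> i' = k)"
      using r(1,2,5,6) i unfolding k_def by linarith+
    have v: "w \<in> vmid (k, j)" "w \<in> vmid (k, j')" using core_vmid assms(1,2) k(1) by auto
    then have j: "j = j'" using vmid_index by metis
    have "square_side k j = edge_side (rep (ver k j)) (even (k + j))"
      "square_side (k - 1) j = edge_side (rep (ver k j)) (even (k - 1 + j))"
      by (rule square_side_eq; simp)+
    then have "rep (ver k j) = E" using assms(3) k(2) j edge_side_differ by metis
    then show ?thesis using v(1) unfolding drawn_def by blast
  qed
qed

lemma core_diamond_drawn:
  assumes "w \<in> square_core (i, j)" "w \<in> diamond (x, y)" "square_side i j \<noteq> vertex_side x y"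
  shows "w \<in> drawn E"
proof -
  obtain a b where ab: "a \<in> {1, -1}" "b \<in> {1, -1}" "i = face_index x a" "j = face_index y b" "w \<in> quarter x y a b"
    by (rule core_diamond [OF assms(1,2)])
  have h: "hugged x y a b" using vertex_side_open [OF ab(1,2)] assms(3) ab(3,4) by blast
  have "rep (hor_at x y a) = E"
    using vertex_side_hugged [OF ab(1,2) h] hor_at_face [OF ab(1,2), of x y] assms(3) ab(3,4) edge_side_differ by metis
  then show ?thesis using ab h unfolding drawn_def by blast
qed

lemma diamond_index: "w \<in> diamond (x, y) \<Longrightarrow> w \<in> diamond (x', y') \<Longrightarrow> x = x' \<and> y = y'"
proof -
  assume "w \<in> diamond (x, y)" "w \<in> diamond (x', y')"
  then have "\<bar>Re w - of_int x\<bar> \<le> 1/4" "\<bar>Im w - of_int y\<bar> \<le> 1/4"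
    "\<bar>Re w - of_int x'\<bar> \<le> 1/4" "\<bar>Im w - of_int y'\<bar> \<le> 1/4" by (auto simp: diamond_def)
  then show "x = x' \<and> y = y'" by linarith
qed

lemma region_inter: "region True \<inter> region False \<subseteq> drawn E"
proof
  fix w assume "w \<in> region True \<inter> region False"
  then show "w \<in> drawn E"
    unfolding region_def using core_core_drawn core_diamond_drawn diamond_index by fast
qed

lemma drawn_region:
  assumes z: "\<And>p. edge_side z p = s"
  shows "drawn z \<subseteq> region s"
proof
  fix w assume "w \<in> drawn z"
  then show "w \<in> region s"
  proof (cases rule: drawn_cases)
    case (h i j)
    have "square_side i j = s" using square_side_eq [of "hor i j" i j] h(1) z by simp
    then show ?thesis using h(2) hmid_core unfolding region_def by blast
  next
    case (v i j)
    have "square_side i j = s" using square_side_eq [of "ver i j" i j] v(1) z by simp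
    then show ?thesis using v(2) vmid_core unfolding region_def by blast
  next
    case (q x y a b)
    have "square_side (face_index x a) (face_index y b) = s" using hor_at_face [OF q(1,2)] q(4) z by simp
    moreover have "w \<in> square_core (face_index x a, face_index y b)" using quarter_core [OF q(1,2)] q(5) by blast
    ultimately show ?thesis unfolding region_def by blast
  qed
qed

lemma embed_inverse: "embed ((w - org) / u) = w"
  using u_nz by (simp add: embed_def)

lemma inj_embed: "embed v = embed w \<Longrightarrow> v = w"
  using u_nz by (simp add: embed_def)

text \<open>The two closed regions cover the plane and meet only on \<open>E\<close>, so a connected
  set avoiding \<open>E\<close> cannot meet both.\<close>

theorem separated: "separated_by (curve_at \<tau> A) (curve_at \<tau> B) (curve_at \<tau> E)"
proof -
  let ?R = "\<lambda>z. rounded_curve (curve_at \<tau> z)"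
  define W where "W s = (\<lambda>w. (w - org) / u) -` region s" for s
  have cl: "closed (W s)" for s
    unfolding W_def by (intro closed_vimage closed_region continuous_intros) (use u_nz in auto)
  have cov: "W True \<union> W False = UNIV" using region_cover by (auto simp: W_def)
  have "(w - org) / u \<in> drawn E" if "w \<in> W True" "w \<in> W False" for w
    using that region_inter by (auto simp: W_def)
  then have int: "W True \<inter> W False \<subseteq> ?R E"
    unfolding rounded_curve_at [OF ABE_in(3)] using embed_inverse by (metis Int_iff image_eqI subsetI)
  have sub: "?R z \<subseteq> W s" if "z \<in> Z" "\<And>p. edge_side z p = s" for z s
    unfolding rounded_curve_at [OF that(1)] W_def
    using drawn_region [OF that(2)] u_nz by (auto simp: embed_def)
  have disj: "?R z \<subseteq> - ?R E" if "z \<in> Z" "z \<noteq> E" for z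
    unfolding rounded_curve_at [OF that(1)] rounded_curve_at [OF ABE_in(3)]
    using drawn_disjoint that(2) inj_embed by blast
  have conn: "connected (?R z)" if "z \<in> Z" for z
  proof (rule connected_rounded_curve)
    fix k
    have "is_edge z" using is_edge_Z that by blast
    then have "curve_at \<tau> z (k + 1) = place (turned 1 0 (case_prod \<tau> (edge_end 1 0 (orb z k))) (orb z k))"
      by (simp add: curve_at_def orb_Suc next_edge_def)
    moreover have "case_prod \<tau> (edge_end 1 0 (orb z k)) \<in> {1, -1}"
      using signs by (auto simp: signs_def split: prod.splits)
    ultimately show "seg_end (curve_at \<tau> z k) = fst (curve_at \<tau> z (k + 1))"
      using place_turned is_edge_orb \<open>is_edge z\<close> by (simp add: curve_at_def)
  qed
  have ne: "?R z \<noteq> {}" for z by (auto simp: rounded_curve_def)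
  obtain a b where ab: "a \<in> ?R A" "b \<in> ?R B" using ne by blast
  have comp: "?R z \<subseteq> connected_component_set (- ?R E) p" if "z \<in> Z" "z \<noteq> E" "p \<in> ?R z" for z p
    using that conn disj by (intro connected_component_maximal) auto
  have "edge_side A p = False" "edge_side B p = True" for p
    using distinct_ABE by (auto simp: edge_side_def)
  then have "?R A \<subseteq> W False" "?R B \<subseteq> W True" using sub ABE_in by blast+
  then have a: "a \<in> - ?R E" "a \<in> W False" and b: "b \<in> - ?R E" "b \<in> W True"
    using ab disj [OF ABE_in(1) distinct_ABE(2)] disj [OF ABE_in(2) distinct_ABE(3)] by blast+
  have "connected_component_set (- ?R E) a \<noteq> connected_component_set (- ?R E) b"
  proof
    assume eq: "connected_component_set (- ?R E) a = connected_component_set (- ?R E) b"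
    let ?K = "connected_component_set (- ?R E) a"
    have "connected ?K" by simp
    moreover have "?K \<subseteq> - ?R E" by (rule connected_component_subset)
    then have "W True \<inter> W False \<inter> ?K = {}" using int by blast
    moreover have "?K \<subseteq> W True \<union> W False" using cov by blast
    moreover have "b \<in> ?K" unfolding eq using b(1) by simp
    then have "W True \<inter> ?K \<noteq> {}" using b(2) by blast
    moreover have "a \<in> ?K" using a(1) by simp
    then have "W False \<inter> ?K \<noteq> {}" using a(2) by blast
    ultimately show False using connected_closedD [OF \<open>connected ?K\<close> _ _ cl cl] by blast
  qed
  moreover have "connected_component_set (- ?R E) a \<in> components (- ?R E)"
    "connected_component_set (- ?R E) b \<in> components (- ?R E)"
    using a(1) b(1) by (auto intro: componentsI)
  moreover have "?R A \<subseteq> connected_component_set (- ?R E) a" "?R B \<subseteq> connected_component_set (- ?R E) b"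
    using comp [OF ABE_in(1) distinct_ABE(2) ab(1)] comp [OF ABE_in(2) distinct_ABE(3) ab(2)] .
  ultimately show ?thesis
    unfolding separated_by_def
    by (intro bexI [of _ "connected_component_set (- ?R E) a"] bexI [of _ "connected_component_set (- ?R E) b"] conjI)
qed

end

subsection \<open>The theorem\<close>

context placed_system
begin

lemma vertices_curve_at:
  assumes "v \<in> vertices (curve_at \<tau> z)" "z \<in> Z"
  obtains p e where "v = point p" "e \<in> edges_at p" "rep e = z"
proof -
  have iz: "is_edge z" using is_edge_Z assms(2) by blast
  obtain k where "v = fst (place (orb z k)) \<or> v = seg_end (place (orb z k))"
    using assms(1) by (auto simp: vertices_def curve_at_def)
  then obtain p where "v = point p" "edge_start (orb z k) = p \<or> edge_end 1 0 (orb z k) = p"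
    unfolding fst_place seg_end_place by blast
  then show thesis using that edges_at_iff is_edge_orb [OF iz] rep_orb [OF assms(2)] by metis
qed

lemma point_in_vertices:
  assumes "is_edge z"
  shows "point (edge_start (orb z k)) \<in> vertices (curve_at \<tau> z)"
    "point (edge_end 1 0 (orb z k)) \<in> vertices (curve_at \<tau> z)"
  unfolding vertices_def curve_at_def fst_place [symmetric] seg_end_place [symmetric] by blast+

end

context separating_system
begin

text \<open>Each edge at a vertex borders a square open to the diamond, or is joined by an arc to
  one that does. Since \<open>A\<close> and \<open>B\<close> have constant, opposite sides, they
  cannot share a vertex.\<close>

lemma edge_side_vertex:
  assumes "e \<in> edges_at (x, y)"
  shows "\<exists>p. edge_side (rep e) p = vertex_side x y"
proof -
  have h: "\<exists>p. edge_side (rep (hor_at x y a)) p = vertex_side x y" if a: "a \<in> {1, -1}" for a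
  proof -
    define b where "b = (if hugged x y 1 1 then - a else a)"
    have b: "b \<in> {1, -1}" using a by (auto simp: b_def)
    have "\<not> hugged x y a b" using hugged_flip [OF a b] a by (auto simp: b_def)
    from vertex_side_open [OF a b this] hor_at_face [OF a b, of x y] show ?thesis by metis
  qed
  have v: "\<exists>p. edge_side (rep (ver_at x y b)) p = vertex_side x y" if b: "b \<in> {1, -1}" for b
  proof -
    define a where "a = (if hugged x y 1 1 then b else - b)"
    have a: "a \<in> {1, -1}" using b by (auto simp: a_def)
    have "hugged x y a b" using hugged_flip [OF a b] b by (auto simp: a_def)
    from rep_hugged [OF a b this] h [OF a] show ?thesis by simp
  qed
  have "(\<exists>a\<in>{1, -1}. e = hor_at x y a) \<or> (\<exists>b\<in>{1, -1}. e = ver_at x y b)"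
    using assms by (cases "even (x + y)") (auto simp: hor_at_def ver_at_def)
  then show ?thesis using h v by blast
qed

lemma disjoint_vertices: "vertices (curve_at \<tau> A) \<inter> vertices (curve_at \<tau> B) = {}"
proof -
  have False if v: "v \<in> vertices (curve_at \<tau> A)" "v \<in> vertices (curve_at \<tau> B)" for v
  proof -
    obtain p e where e: "v = point p" "e \<in> edges_at p" "rep e = A"
      by (rule vertices_curve_at [OF v(1) ABE_in(1)])
    obtain p' f where f: "v = point p'" "f \<in> edges_at p'" "rep f = B"
      by (rule vertices_curve_at [OF v(2) ABE_in(2)])
    obtain x y where p: "p = (x, y)" by (cases p)
    have "p' = p" using e(1) f(1) point_inj by simp
    then obtain s t where "edge_side A s = vertex_side x y" "edge_side B t = vertex_side x y"
      using edge_side_vertex e f p by metis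
    then show False using distinct_ABE by (auto simp: edge_side_def)
  qed
  then show ?thesis by blast
qed

end

lemma shift_equiv_vertices:
  assumes "shift_equiv C D"
  shows "vertices D = vertices C"
proof -
  obtain m where m: "\<And>k. D k = C (k + m)" using assms unfolding shift_equiv_def by blast
  have "range (\<lambda>k. f (D k)) = range (\<lambda>k. f (C k))" for f :: "segment \<Rightarrow> complex"
  proof -
    have "f (C k) = f (D (k - m))" for k by (simp add: m)
    then show ?thesis using m by (metis (no_types, lifting) image_cong rangeI range_eqI subsetI subset_antisym image_subsetI)
  qed
  then show ?thesis by (simp add: vertices_def)
qed

lemma path_separating:
  assumes "placement u org"
  shows "separating_system u org path.cturn path_reps (1, 1, -1) (0, 0, -1) (0, 1, -1)"
proof -
  interpret placement u org by (rule assms)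
  interpret placed_system u org path.cturn path_reps by unfold_locales
  show ?thesis
    by unfold_locales (auto simp: path_reps_def intro: path_left_face path_right_face)
qed

text \<open>The three representatives and the successor of \<open>(1, -1, -1)\<close> are the four
  sides of one unit square, so any two of the curves share a corner of it.\<close>

lemma star_meet:
  assumes "placement u org" "z \<in> star_reps" "z' \<in> star_reps" "z \<noteq> z'"
  shows "vertices (placement.curve_at u org star.cturn z) \<inter> vertices (placement.curve_at u org star.cturn z') \<noteq> {}"
proof -
  interpret placement u org by (rule assms)
  interpret placed_system u org star.cturn star_reps by unfold_locales
  let ?V = "\<lambda>z. vertices (curve_at star.cturn z)"
  have nxt: "star.Z.orb (1, -1, -1) 1 = (0, -1, 1)"
    using star.Z.orb_Suc [of "(1, -1, -1)" 0]
    by (simp add: next_edge_def star.cturn_def dturn_odd)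
  have "point (1, 0) \<in> ?V (1, 0, -1)" "point (1, -1) \<in> ?V (1, 0, -1)"
    "point (0, 0) \<in> ?V (0, 0, 1)" "point (1, 0) \<in> ?V (0, 0, 1)"
    "point (1, -1) \<in> ?V (1, -1, -1)" "point (0, 0) \<in> ?V (1, -1, -1)"
    using point_in_vertices [of "(1, 0, -1)" 0] point_in_vertices [of "(0, 0, 1)" 0]
      point_in_vertices [of "(1, -1, -1)" 0] point_in_vertices [of "(1, -1, -1)" 1] nxt by simp_all
  then show ?thesis using assms(2-4) unfolding star_reps_def by blast
qed

lemma coset_locally_isomorphic:
  assumes "coset_grid m n s0 p1 p2" "placement u org" "s \<in> {1, -1}"
    and inv: "m * \<alpha> - n * \<beta> = 15" "m * \<beta> + n * \<alpha> = 0"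
    and nz: "\<And>x y. (m * x - n * y - p1, n * x + m * y - p2) \<noteq> (0, 0)"
    and C: "placement.models u org (dturn s) \<C>"
    and D: "placement.models u org (coset_grid.cturn m n s0 p1 p2) \<D>"
  shows "locally_isomorphic \<C> \<D>"
proof -
  interpret coset_grid m n s0 p1 p2 by (rule assms)
  interpret placement u org by (rule assms)
  show ?thesis
    unfolding locally_isomorphic_def
  proof (intro conjI allI impI)
    fix \<B> assume "bounded_below \<B> \<C>"
    then show "\<exists>v. bounded_below (translate_set v \<B>) \<D>"
      by (rule bounded_below_translate [OF C D]) (rule cturn_approx [OF inv assms(3)])
  next
    fix \<B> assume "bounded_below \<B> \<D>"
    then show "\<exists>v. bounded_below (translate_set v \<B>) \<C>"
      by (rule bounded_below_translate [OF D C]) (rule approx_cturn [OF inv _ nz])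
  qed
qed

theorem mainTheorem6:
  fixes \<C> :: "(int \<Rightarrow> segment) set" and a :: "int \<Rightarrow> int" and D :: "int \<Rightarrow> segment"
  assumes "covering \<C>"
    and "\<forall>C\<in>\<C>. complete_folding_curve C"
    and "local_isomorphism_property \<C>"
    and "infty_folding a"
    and "\<forall>n::nat. a (2 ^ n) = 1"
    and "curve_of {1..} a D"
    and "generated_by \<C> D"
  shows "\<exists>\<D>\<^sub>1 \<D>\<^sub>2.
    covering \<D>\<^sub>1 \<and> locally_isomorphic \<C> \<D>\<^sub>1 \<and> card \<D>\<^sub>1 = 3 \<and>
    (\<forall>A\<in>\<D>\<^sub>1. \<forall>B\<in>\<D>\<^sub>1. A \<noteq> B \<longrightarrow> vertices A \<inter> vertices B \<noteq> {}) \<and>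
    covering \<D>\<^sub>2 \<and> locally_isomorphic \<C> \<D>\<^sub>2 \<and> card \<D>\<^sub>2 = 3 \<and>
    (\<exists>A\<in>\<D>\<^sub>2. \<exists>B\<in>\<D>\<^sub>2. \<exists>E\<in>\<D>\<^sub>2.
       A \<noteq> B \<and> A \<noteq> E \<and> B \<noteq> E \<and> separated_by A B E) \<and>
    \<not> same_covering \<D>\<^sub>1 \<D>\<^sub>2"
proof -
  obtain u org s where pl: "placement u org" and s: "s \<in> {1, -1}"
    and C: "placement.models u org (dturn s) \<C>"
    using given_covering_models [OF assms(1,4-7)] by blast
  interpret placement u org by (rule pl)
  interpret S: placed_system u org star.cturn star_reps by unfold_locales
  interpret P: separating_system u org path.cturn path_reps "(1, 1, -1)" "(0, 0, -1)" "(0, 1, -1)"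
    by (rule path_separating [OF pl])
  let ?A = "curve_at path.cturn (1, 1, -1)" and ?B = "curve_at path.cturn (0, 0, -1)"
    and ?E = "curve_at path.cturn (0, 1, -1)"
  have in2: "?A \<in> P.curves" "?B \<in> P.curves" "?E \<in> P.curves"
    using P.ABE_in by (auto simp: P.curves_def)
  have ne2: "?A \<noteq> ?B" "?A \<noteq> ?E" "?B \<noteq> ?E"
    using inj_onD [OF P.inj_curve_at] P.ABE_in P.distinct_ABE by blast+
  have meet: "vertices A \<inter> vertices B \<noteq> {}" if "A \<in> S.curves" "B \<in> S.curves" "A \<noteq> B" for A B
    using that star_meet [OF pl] unfolding S.curves_def by blast
  have iso1: "locally_isomorphic \<C> S.curves"
  \<comment> \<open>\<open>3 + 6\<i>\<close> is 15 divided by \<open>1 - 2\<i>\<close>.\<close>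
  proof (rule coset_locally_isomorphic [where \<alpha> = 3 and \<beta> = 6, OF star.coset_grid_axioms pl s _ _ _ C S.models_curves])
    show "(1 * x - (-2) * y - 0, -2 * x + 1 * y - (-2)) \<noteq> (0, 0)" for x y :: int
    proof
      assume "(1 * x - (-2) * y - 0, -2 * x + 1 * y - (-2)) = (0, 0)"
      then have "x = - 2 * y" "5 * y = - 2" by auto
      then show False by presburger
    qed
  qed simp_all
  have iso2: "locally_isomorphic \<C> P.curves"
  proof (rule coset_locally_isomorphic [where \<alpha> = 5 and \<beta> = 0, OF path.coset_grid_axioms pl s _ _ _ C P.models_curves])
    show "(3 * x - 0 * y - 0, 0 * x + 3 * y - 2) \<noteq> (0, 0)" for x y :: int
    proof
      assume "(3 * x - 0 * y - 0, 0 * x + 3 * y - 2) = (0, 0)"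
      then have "3 * y = 2" by auto
      then show False by presburger
    qed
  qed simp_all
  \<comment> \<open>Any two curves of the first covering share a vertex, while \<open>?A\<close> and
    \<open>?B\<close> in the second do not.\<close>
  have "\<not> same_covering S.curves P.curves"
  proof
    assume same: "same_covering S.curves P.curves"
    obtain A1 where A1: "A1 \<in> S.curves" "shift_equiv A1 ?A" using same in2 unfolding same_covering_def by blast
    obtain B1 where B1: "B1 \<in> S.curves" "shift_equiv B1 ?B" using same in2 unfolding same_covering_def by blast
    have v: "vertices A1 \<inter> vertices B1 = {}"
      using P.disjoint_vertices shift_equiv_vertices A1(2) B1(2) by metis
    have "vertices A1 \<noteq> {}" by (auto simp: vertices_def)
    with v have "A1 \<noteq> B1" by auto
    then show False using meet A1(1) B1(1) v by blast
  qed
  moreover have "card S.curves = 3" "card P.curves = 3"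
    unfolding S.card_curves P.card_curves by (simp_all add: star_reps_def path_reps_def)
  ultimately show ?thesis
    using S.covering_curves P.covering_curves iso1 iso2 meet in2 ne2 P.separated by blast
qed

end
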